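(* Let $\mathcal{C}\subset\mathbb{P}^2$ be a reduced free curve with exponents $(a,b)$, $a\le b$. (1) Let $L\subset\mathbb{P}^2$ be a line which is an irreducible component of $\mathcal{C}$, and write $\mathcal{C}=\mathcal{C}'\cup L$, where $\mathcal{C}'$ is the union of the irreducible components of $\mathcal{C}$ other than $L$. Then either $|\mathcal{C}'\cap L| = b+1-\epsilon(\mathcal{C}',L)$ or $|\mathcal{C}'\cap L|\le a+1-\epsilon(\mathcal{C}',L)$. (2) Let $L\subset\mathbb{P}^2$ be a line which is not an irreducible component of $\mathcal{C}$. Then either $|\mathcal{C}\cap L| = a+1-\epsilon(\mathcal{C},L)$ or $|\mathcal{C}\cap L|\ge b+1-\epsilon(\mathcal{C},L)$.
   Context: Let $S=\mathbb{C}[x,y,z]$. For a reduced curve $\mathcal{C}\subset\mathbb{P}^2$ defined by a reduced homogeneous polynomial $f$, let $D_0(\mathcal{C})=\{\theta=g_1\partial_x+g_2\partial_y+g_3\partial_z,\ g_i\in S : \theta(f)=0\}$, a graded $S$-module (a derivation has degree $e$ if its coefficients $g_i$ are homogeneous of degree $e$). $\mathcal{C}$ is free with exponents $(a,b)$ if $D_0(\mathcal{C})$ is a free $S$-module with a basis consisting of homogeneous derivations of degrees $a$ and $b$. For a reduced curve $\mathcal{D}$ and a point $p$, let $\mu(\mathcal{D},p)$ and $\tau(\mathcal{D},p)$ be the Milnor and Tjurina numbers of $\mathcal{D}$ at $p$ (both $0$ if $p$ is a smooth point or not on $\mathcal{D}$), and $\epsilon(\mathcal{D},p)=\mu(\mathcal{D},p)-\tau(\mathcal{D},p)\ge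 0$. For reduced curves $\mathcal{C}_1,\mathcal{C}_2$ with no common irreducible component, $\epsilon(\mathcal{C}_1,\mathcal{C}_2)=\sum_{p\in\mathcal{C}_1\cap\mathcal{C}_2}\big(\epsilon(\mathcal{C}_1\cup\mathcal{C}_2,p)-\epsilon(\mathcal{C}_1,p)\big)$. $|\cdot|$ denotes the number of distinct points of a finite set. *)

theory Defs
  imports Complex_Main "HOL-Library.Poly_Mapping" "HOL-Library.Extended_Nat"
begin

text \<open>Polynomials in the variables x_0, x_1, x_2, ... over the complex numbers:
  monomials are finitely supported exponent vectors, polynomials are finitely
  supported coefficient maps (a commutative ring via convolution).
  The ring S = C[x,y,z] is the subring of polynomials in the variables 0,1,2.\<close>

type_synonym mpoly = "(nat \<Rightarrow>\<^sub>0 nat) \<Rightarrow>\<^sub>0 complex"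

definition mdeg :: "(nat \<Rightarrow>\<^sub>0 nat) \<Rightarrow> nat" where
  "mdeg m = (\<Sum>i\<in>Poly_Mapping.keys m. Poly_Mapping.lookup m i)"

definition Var :: "nat \<Rightarrow> mpoly" where
  "Var i = Poly_Mapping.single (Poly_Mapping.single i 1) 1"

definition Const :: "complex \<Rightarrow> mpoly" where
  "Const c = Poly_Mapping.single 0 c"

definition poly_in :: "nat set \<Rightarrow> mpoly \<Rightarrow> bool" where
  "poly_in V p \<longleftrightarrow> (\<forall>m\<in>Poly_Mapping.keys p. Poly_Mapping.keys m \<subseteq> V)"

abbreviation inS :: "mpoly \<Rightarrow> bool" where
  "inS \<equiv> poly_in {0,1,2}"

text \<open>homogeneous of degree d (the zero polynomial is homogeneous of every degree)\<close>
definition homog :: "nat \<Rightarrow> mpoly \<Rightarrow> bool" where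
  "homog d p \<longleftrightarrow> (\<forall>m\<in>Poly_Mapping.keys p. mdeg m = d)"

definition meval :: "mpoly \<Rightarrow> (nat \<Rightarrow> complex) \<Rightarrow> complex" where
  "meval p v = (\<Sum>m\<in>Poly_Mapping.keys p. Poly_Mapping.lookup p m * (\<Prod>i\<in>Poly_Mapping.keys m. v i ^ Poly_Mapping.lookup m i))"

definition pder :: "nat \<Rightarrow> mpoly \<Rightarrow> mpoly" where
  "pder i p = (\<Sum>m\<in>Poly_Mapping.keys p. Poly_Mapping.single (m - Poly_Mapping.single i 1)
                               (of_nat (Poly_Mapping.lookup m i) * Poly_Mapping.lookup p m))"

definition dehom :: "nat \<Rightarrow> mpoly \<Rightarrow> mpoly" where
  "dehom k p = (\<Sum>m\<in>Poly_Mapping.keys p. Poly_Mapping.single (m - Poly_Mapping.single k (Poly_Mapping.lookup m k)) (Poly_Mapping.lookup p m))"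

definition reduced_curve :: "mpoly \<Rightarrow> bool" where
  "reduced_curve f \<longleftrightarrow> inS f \<and> f \<noteq> 0 \<and> (\<exists>d\<ge>1. homog d f) \<and>
     (\<forall>g h. inS g \<and> inS h \<and> f = g * g * h \<longrightarrow> (\<exists>c. g = Const c))"

text \<open>Derivations g1 d_x + g2 d_y + g3 d_z represented as coefficient triples.\<close>
type_synonym deriv = "mpoly \<times> mpoly \<times> mpoly"

definition D0 :: "mpoly \<Rightarrow> deriv set" where
  "D0 f = {(g1, g2, g3). inS g1 \<and> inS g2 \<and> inS g3 \<and>
             g1 * pder 0 f + g2 * pder 1 f + g3 * pder 2 f = 0}"

definition homog_deriv :: "nat \<Rightarrow> deriv \<Rightarrow> bool" where
  "homog_deriv e \<theta> \<longleftrightarrow> (case \<theta> of (g1, g2, g3) \<Rightarrow> homog e g1 \<and> homog e g2 \<and> homog e g3)"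

definition dlin :: "mpoly \<Rightarrow> deriv \<Rightarrow> mpoly \<Rightarrow> deriv \<Rightarrow> deriv" where
  "dlin h1 \<theta>1 h2 \<theta>2 = (case \<theta>1 of (a1, a2, a3) \<Rightarrow> case \<theta>2 of (b1, b2, b3) \<Rightarrow>
      (h1 * a1 + h2 * b1, h1 * a2 + h2 * b2, h1 * a3 + h2 * b3))"

definition free_curve :: "mpoly \<Rightarrow> nat \<Rightarrow> nat \<Rightarrow> bool" where
  "free_curve f a b \<longleftrightarrow> (\<exists>\<theta>1 \<theta>2. \<theta>1 \<in> D0 f \<and> \<theta>2 \<in> D0 f \<and> homog_deriv a \<theta>1 \<and> homog_deriv b \<theta>2 \<and>
      (\<forall>\<theta>\<in>D0 f. \<exists>!(h1, h2). inS h1 \<and> inS h2 \<and> \<theta> = dlin h1 \<theta>1 h2 \<theta>2))"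

text \<open>Points of P^2, via the normalised representative: coordinates 0,1,2 (others 0),
  first nonzero coordinate equal to 1.\<close>
definition ppoint :: "(nat \<Rightarrow> complex) \<Rightarrow> bool" where
  "ppoint q \<longleftrightarrow> (\<forall>i\<ge>3. q i = 0) \<and> (\<exists>k<3. q k = 1 \<and> (\<forall>j<k. q j = 0))"

definition chart :: "(nat \<Rightarrow> complex) \<Rightarrow> nat" where
  "chart q = (LEAST k. q k \<noteq> 0)"

text \<open>The ideal generated by G in the local ring of C[x_i : i in V] at the point q
  (membership of a polynomial u).\<close>
definition loc_ideal :: "nat set \<Rightarrow> mpoly list \<Rightarrow> (nat \<Rightarrow> complex) \<Rightarrow> mpoly \<Rightarrow> bool" where
  "loc_ideal V G q u \<longleftrightarrow> (\<exists>s w. poly_in V s \<and> meval s q \<noteq> 0 \<and> (\<forall>i<length G. poly_in V (w i)) \<and>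
      s * u = (\<Sum>i<length G. w i * G ! i))"

definition loc_indep :: "nat set \<Rightarrow> mpoly list \<Rightarrow> (nat \<Rightarrow> complex) \<Rightarrow> nat \<Rightarrow> (nat \<Rightarrow> mpoly) \<Rightarrow> bool" where
  "loc_indep V G q n P \<longleftrightarrow> (\<forall>i<n. poly_in V (P i)) \<and>
     (\<forall>c. loc_ideal V G q (\<Sum>i<n. Const (c i) * P i) \<longrightarrow> (\<forall>i<n. c i = 0))"

definition loc_dim :: "nat set \<Rightarrow> mpoly list \<Rightarrow> (nat \<Rightarrow> complex) \<Rightarrow> enat" where
  "loc_dim V G q = Sup {enat n | n. \<exists>P. loc_indep V G q n P}"

definition chart_vars :: "(nat \<Rightarrow> complex) \<Rightarrow> nat set" where
  "chart_vars p = {0,1,2} - {chart p}"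

text \<open>Milnor and Tjurina numbers of the curve g = 0 at the point p of P^2, computed in the
  affine chart (first nonzero coordinate of p) = 1; both are 0 if p is not on the curve.\<close>
definition milnor :: "mpoly \<Rightarrow> (nat \<Rightarrow> complex) \<Rightarrow> enat" where
  "milnor g p = (if meval g p \<noteq> 0 then 0 else
     loc_dim (chart_vars p) (map (\<lambda>i. pder i (dehom (chart p) g)) (sorted_list_of_set (chart_vars p))) p)"

definition tjurina :: "mpoly \<Rightarrow> (nat \<Rightarrow> complex) \<Rightarrow> enat" where
  "tjurina g p = (if meval g p \<noteq> 0 then 0 else
     loc_dim (chart_vars p) (dehom (chart p) g #
        map (\<lambda>i. pder i (dehom (chart p) g)) (sorted_list_of_set (chart_vars p))) p)"

definition eps_pt :: "mpoly \<Rightarrow> (nat \<Rightarrow> complex) \<Rightarrow> int" where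
  "eps_pt g p = int (the_enat (milnor g p)) - int (the_enat (tjurina g p))"

definition cap :: "mpoly \<Rightarrow> mpoly \<Rightarrow> (nat \<Rightarrow> complex) set" where
  "cap f1 f2 = {p. ppoint p \<and> meval f1 p = 0 \<and> meval f2 p = 0}"

text \<open>epsilon(C1, C2); the union C1 \<union> C2 is defined by the product f1 * f2\<close>
definition eps_curves :: "mpoly \<Rightarrow> mpoly \<Rightarrow> int" where
  "eps_curves f1 f2 = (\<Sum>p\<in>cap f1 f2. eps_pt (f1 * f2) p - eps_pt f1 p)"

definition is_line :: "mpoly \<Rightarrow> bool" where
  "is_line l \<longleftrightarrow> (\<exists>\<alpha> \<beta> \<gamma>. (\<alpha>, \<beta>, \<gamma>) \<noteq> (0, 0, 0) \<and>
      l = Const \<alpha> * Var 0 + Const \<beta> * Var 1 + Const \<gamma> * Var 2)"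

end

theory Submission
  imports Defs "HOL-Computational_Algebra.Computational_Algebra" "HOL-Computational_Algebra.Field_as_Ring"
begin

text \<open>
  Let \<open>g\<close> be a reduced curve that does not contain the line \<open>l\<close>. A derivation killing \<open>g l\<close> is tangent
  to \<open>l\<close> and restricts, modulo the Euler derivation, to a vector field on \<open>l\<close>. The coefficients of these
  vector fields, written as polynomials in an affine coordinate \<open>z\<close> of \<open>l\<close> whose point at infinity is off
  the curve, generate an ideal \<open>(Q)\<close> of \<open>C[z]\<close>, and \<open>deg Q = |g \<inter> l| + \<epsilon>(g, l)\<close>: the zeros of \<open>Q\<close> are the
  points of \<open>g \<inter> l\<close>, and the order of \<open>Q\<close> at such a point \<open>p\<close> is \<open>1 + \<epsilon>(g l, p) - \<epsilon>(g, p)\<close>. With \<open>s = 0\<close> a local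
  equation of \<open>l\<close>, \<open>t\<close> a coordinate on it and \<open>i\<close> the intersection number, this local statement is a computation
  with colon ideals together with \<open>\<mu>(s g) = \<mu>(g) + 2 i - 1\<close>. The latter reduces to the ideals
  \<open>(s g_s, g_t)\<close> and \<open>(g + s g_s, g_t)\<close> having the same colength, which is seen on the Puiseux branches of \<open>g_t\<close>.

  If \<open>f = l g\<close> is free, \<open>Q\<close> is the gcd of two polynomials coming from forms of degree \<open>a + 1\<close> and \<open>b + 1\<close>,
  at least one of which does not vanish at infinity: either the first is zero and \<open>deg Q = b + 1\<close>, or
  \<open>deg Q \<le> a + 1\<close>. If \<open>g = f\<close> is free with basis \<open>\<theta>_1, \<theta>_2\<close>, let \<open>u_i\<close> be the restriction of \<open>\<theta>_i(l)\<close> to \<open>l\<close>.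
  The derivations killing \<open>f l\<close> are, modulo the Euler derivation, the \<open>h_1 \<theta>_1 + h_2 \<theta>_2\<close> with
  \<open>h_1 u_1 + h_2 u_2 = 0\<close> on \<open>l\<close>, so \<open>deg Q = a + b + 1 - deg gcd(u_1, u_2)\<close>. This is \<open>a + 1\<close> if \<open>u_1 = 0\<close> and
  at least \<open>b + 1\<close> otherwise.
\<close>

section \<open>Substitution, derivatives and homogeneity of polynomials\<close>

text \<open>Why the ideal M = (g, s g_s, s g_t) governs the local count: a field A d_s + B d_t
  tangent to the line and to g has A in (s) and A g_s + B g_t in (g), so B g_t lies in (g, s g_s).
  On the line only B modulo s is visible, which accounts for the generator s g_t. Thus M : g_t = (s,
  t^m), where m is the order to be found.

  The obstacle is that g need not lie in (g_s, g_t), a defect measured by \<epsilon>. The two polar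
  ideals are then different and only their colengths can be compared, by orders of vanishing along
  the branches of g_t = 0. These become power series after s \<mapsto> s^n, so the local rings are
  completed to C[[s]][[t]]; finite colength makes the completion harmless. Finiteness comes from
  reducedness, through a relation \<alpha> g + \<beta> g_t = r(s) with r nonzero.

  Derivations with \<theta> f = \<kappa> f are not lost by working in \<open>D0\<close>: a multiple
  of the Euler derivation repairs them without changing det (N, X, \<theta>).\<close>

definition rhom :: "('a::comm_ring_1 \<Rightarrow> 'b::comm_ring_1) \<Rightarrow> bool" where
  "rhom h \<longleftrightarrow> h 1 = 1 \<and> (\<forall>x y. h (x + y) = h x + h y) \<and> (\<forall>x y. h (x * y) = h x * h y)"

lemma rhom_1: "rhom h \<Longrightarrow> h 1 = 1"
  and rhom_add: "rhom h \<Longrightarrow> h (x + y) = h x + h y"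
  and rhom_mult: "rhom h \<Longrightarrow> h (x * y) = h x * h y"
  by (simp_all add: rhom_def)

lemma rhom_0: assumes "rhom h" shows "h 0 = 0"
  using rhom_add[OF assms, of 0 0] by simp

lemma rhom_uminus: assumes "rhom h" shows "h (- x) = - h x"
  using rhom_add[OF assms, of x "- x"] rhom_0[OF assms] by (simp add: eq_neg_iff_add_eq_0 add.commute)

lemma rhom_diff: assumes "rhom h" shows "h (x - y) = h x - h y"
  using rhom_add[OF assms, of x "- y"] rhom_uminus[OF assms] by simp

lemma rhom_power: "rhom h \<Longrightarrow> h (x ^ n) = h x ^ n"
  by (induction n) (simp_all add: rhom_1 rhom_mult)

lemma rhom_sum: "rhom h \<Longrightarrow> h (sum f A) = (\<Sum>x\<in>A. h (f x))"
  by (induction A rule: infinite_finite_induct) (simp_all add: rhom_0 rhom_add)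

lemma rhom_prod: "rhom h \<Longrightarrow> h (prod f A) = (\<Prod>x\<in>A. h (f x))"
  by (induction A rule: infinite_finite_induct) (simp_all add: rhom_1 rhom_mult)

lemma rhom_of_nat: "rhom h \<Longrightarrow> h (of_nat n) = of_nat n"
  by (induction n) (simp_all add: rhom_0 rhom_1 rhom_add)

lemmas rhom_simps = rhom_0 rhom_1 rhom_add rhom_mult rhom_uminus rhom_diff rhom_power rhom_sum
  rhom_prod rhom_of_nat

lemma rhom_comp: "rhom f \<Longrightarrow> rhom g \<Longrightarrow> rhom (\<lambda>x. g (f x))"
  by (simp add: rhom_def)

lemma rhom_id: "rhom (\<lambda>x. x)"
  by (simp add: rhom_def)

section \<open>Monomials and evaluation homomorphisms\<close>

definition mon :: "(nat \<Rightarrow> 'r::comm_ring_1) \<Rightarrow> (nat \<Rightarrow>\<^sub>0 nat) \<Rightarrow> 'r" where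
  "mon \<rho> m = (\<Prod>i\<in>Poly_Mapping.keys m. \<rho> i ^ Poly_Mapping.lookup m i)"

text \<open>Coefficients and variables are mapped separately, by \<open>e\<close> and
  \<open>\<rho>\<close>, so that evaluation at a point, dehomogenisation, passage to a chart,
  restriction to a line and reduction modulo a linear form are instances of one
  homomorphism.\<close>

definition psub :: "(complex \<Rightarrow> 'r::comm_ring_1) \<Rightarrow> (nat \<Rightarrow> 'r) \<Rightarrow> mpoly \<Rightarrow> 'r" where
  "psub e \<rho> p = (\<Sum>m\<in>Poly_Mapping.keys p. e (Poly_Mapping.lookup p m) * mon \<rho> m)"

lemma keys_addD: "x \<in> Poly_Mapping.keys (f + g) \<Longrightarrow> x \<in> Poly_Mapping.keys f \<or> x \<in> Poly_Mapping.keys g"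
  using keys_add[of f g] by auto

lemma mon_superset:
  assumes "finite A" "Poly_Mapping.keys m \<subseteq> A"
  shows "mon \<rho> m = (\<Prod>i\<in>A. \<rho> i ^ Poly_Mapping.lookup m i)"
  unfolding mon_def by (rule prod.mono_neutral_left[OF assms]) (auto simp: in_keys_iff)

lemma mon_0 [simp]: "mon \<rho> 0 = 1"
  by (simp add: mon_def)

lemma mon_single [simp]: "mon \<rho> (Poly_Mapping.single i k) = \<rho> i ^ k"
  by (cases "k = 0") (simp_all add: mon_def)

lemma mon_add: "mon \<rho> (m + m') = mon \<rho> m * mon \<rho> m'"
proof -
  let ?A = "Poly_Mapping.keys m \<union> Poly_Mapping.keys m'"
  have "mon \<rho> (m + m') = (\<Prod>i\<in>?A. \<rho> i ^ Poly_Mapping.lookup (m + m') i)"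
    by (rule mon_superset) (auto dest: keys_addD)
  also have "\<dots> = (\<Prod>i\<in>?A. \<rho> i ^ Poly_Mapping.lookup m i) * (\<Prod>i\<in>?A. \<rho> i ^ Poly_Mapping.lookup m' i)"
    by (simp add: lookup_add power_add prod.distrib)
  also have "\<dots> = mon \<rho> m * mon \<rho> m'"
    by (subst (1 2) mon_superset[of ?A]) auto
  finally show ?thesis .
qed

lemma mon_hom: "rhom h \<Longrightarrow> h (mon \<rho> m) = mon (\<lambda>i. h (\<rho> i)) m"
  by (simp add: mon_def rhom_prod rhom_power)

lemma mon_scale: "mon (\<lambda>i. c * \<rho> i) m = c ^ mdeg m * mon \<rho> m"
  by (simp add: mon_def mdeg_def power_mult_distrib prod.distrib power_sum)

lemma meval_eq_psub: "meval p v = psub (\<lambda>c. c) v p"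
  by (simp add: meval_def psub_def mon_def)

lemma psub_superset:
  assumes "finite A" "Poly_Mapping.keys p \<subseteq> A" "rhom e"
  shows "psub e \<rho> p = (\<Sum>m\<in>A. e (Poly_Mapping.lookup p m) * mon \<rho> m)"
  unfolding psub_def by (rule sum.mono_neutral_left[OF assms(1,2)]) (auto simp: in_keys_iff rhom_0[OF assms(3)])

lemma psub_add: assumes "rhom e" shows "psub e \<rho> (p + q) = psub e \<rho> p + psub e \<rho> q"
proof -
  let ?A = "Poly_Mapping.keys p \<union> Poly_Mapping.keys q"
  have "psub e \<rho> (p + q) = (\<Sum>m\<in>?A. e (Poly_Mapping.lookup (p + q) m) * mon \<rho> m)"
    by (rule psub_superset[OF _ _ assms]) (auto dest: keys_addD)
  also have "\<dots> = (\<Sum>m\<in>?A. e (Poly_Mapping.lookup p m) * mon \<rho> m) + (\<Sum>m\<in>?A. e (Poly_Mapping.lookup q m) * mon \<rho> m)"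
    by (simp add: lookup_add rhom_add[OF assms] algebra_simps sum.distrib)
  also have "\<dots> = psub e \<rho> p + psub e \<rho> q"
    by (subst (1 2) psub_superset[OF _ _ assms, of ?A]) auto
  finally show ?thesis .
qed

lemma psub_0 [simp]: "psub e \<rho> 0 = 0"
  by (simp add: psub_def)

lemma psub_sum: "rhom e \<Longrightarrow> psub e \<rho> (sum f A) = (\<Sum>x\<in>A. psub e \<rho> (f x))"
  by (induction A rule: infinite_finite_induct) (simp_all add: psub_add)

lemma psub_single: "rhom e \<Longrightarrow> psub e \<rho> (Poly_Mapping.single m c) = e c * mon \<rho> m"
  by (cases "c = 0") (simp_all add: psub_def rhom_0)

lemma mpoly_sum_singles:
  "(p :: 'a \<Rightarrow>\<^sub>0 'b::comm_monoid_add) = (\<Sum>m\<in>Poly_Mapping.keys p. Poly_Mapping.single m (Poly_Mapping.lookup p m))"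
proof (rule poly_mapping_eqI)
  fix k
  have "(\<Sum>m\<in>Poly_Mapping.keys p. (Poly_Mapping.lookup p m when m = k)) =
     (\<Sum>m\<in>Poly_Mapping.keys p. if m = k then Poly_Mapping.lookup p k else 0)"
    by (rule sum.cong) (auto simp: when_def)
  then show "Poly_Mapping.lookup p k = Poly_Mapping.lookup (\<Sum>m\<in>Poly_Mapping.keys p. Poly_Mapping.single m (Poly_Mapping.lookup p m)) k"
    by (simp add: lookup_sum lookup_single sum.delta in_keys_iff)
qed

lemma psub_mult: assumes "rhom e" shows "psub e \<rho> (p * q) = psub e \<rho> p * psub e \<rho> q"
proof -
  have "psub e \<rho> (p * q) = psub e \<rho> ((\<Sum>m\<in>Poly_Mapping.keys p. Poly_Mapping.single m (Poly_Mapping.lookup p m)) *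
     (\<Sum>m\<in>Poly_Mapping.keys q. Poly_Mapping.single m (Poly_Mapping.lookup q m)))"
    using mpoly_sum_singles[of p] mpoly_sum_singles[of q] by simp
  also have "\<dots> = (\<Sum>m\<in>Poly_Mapping.keys p. \<Sum>n\<in>Poly_Mapping.keys q.
      (e (Poly_Mapping.lookup p m) * mon \<rho> m) * (e (Poly_Mapping.lookup q n) * mon \<rho> n))"
    by (simp only: sum_product mult_single psub_sum[OF assms] psub_single[OF assms] mon_add
        rhom_mult[OF assms] mult_ac)
  also have "\<dots> = psub e \<rho> p * psub e \<rho> q"
    by (simp only: psub_def sum_product)
  finally show ?thesis .
qed

lemma psub_Const [simp]: "rhom e \<Longrightarrow> psub e \<rho> (Const c) = e c"
  by (simp add: Const_def psub_single)

lemma psub_Var [simp]: "rhom e \<Longrightarrow> psub e \<rho> (Var i) = \<rho> i"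
  by (simp add: Var_def psub_single rhom_1)

lemma rhom_psub: "rhom e \<Longrightarrow> rhom (psub e \<rho>)"
  using psub_Const[of e \<rho> 1] by (simp add: rhom_def psub_add psub_mult Const_def)

lemma psub_hom: "rhom h \<Longrightarrow> h (psub e \<rho> p) = psub (\<lambda>c. h (e c)) (\<lambda>i. h (\<rho> i)) p"
  by (simp add: psub_def rhom_sum rhom_mult mon_hom)

lemma psub_cong:
  assumes "poly_in V p" "\<And>i. i \<in> V \<Longrightarrow> \<rho> i = \<rho>' i"
  shows "psub e \<rho> p = psub e \<rho>' p"
  unfolding psub_def mon_def
proof (intro sum.cong prod.cong arg_cong2[where f = "(*)"] refl)
  fix m i assume "m \<in> Poly_Mapping.keys p" "i \<in> Poly_Mapping.keys m"
  then have "i \<in> V" using assms(1) by (auto simp: poly_in_def)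
  then show "\<rho> i ^ Poly_Mapping.lookup m i = \<rho>' i ^ Poly_Mapping.lookup m i" by (simp add: assms(2))
qed

lemma rhom_Const: "rhom Const"
  by (simp add: rhom_def Const_def mult_single single_add)

lemma Const_0 [simp]: "Const 0 = 0" and Const_1 [simp]: "Const 1 = 1"
  and Const_add: "Const (a + b) = Const a + Const b" and Const_mult: "Const (a * b) = Const a * Const b"
  and Const_uminus: "Const (- a) = - Const a" and Const_diff: "Const (a - b) = Const a - Const b"
  using rhom_Const by (simp_all add: rhom_simps)

lemma Const_eq_iff [simp]: "Const a = Const b \<longleftrightarrow> a = b"
  by (metis Const_def lookup_single_eq)

lemma Const_eq_0_iff [simp]: "Const a = 0 \<longleftrightarrow> a = 0"
  using Const_eq_iff[of a 0] by simp

lemma mon_Var: "mon Var m = Poly_Mapping.single m 1"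
proof -
  have pw: "Poly_Mapping.single (Poly_Mapping.single i (1::nat)) (1::complex) ^ k = Poly_Mapping.single (Poly_Mapping.single i k) 1" for i k
    by (induction k) (simp_all add: mult_single single_add[symmetric])
  have "mon Var m = (\<Prod>i\<in>Poly_Mapping.keys m. Poly_Mapping.single (Poly_Mapping.single i (Poly_Mapping.lookup m i)) 1)"
    by (simp add: mon_def Var_def pw[simplified])
  also have "\<dots> = Poly_Mapping.single (\<Sum>i\<in>Poly_Mapping.keys m. Poly_Mapping.single i (Poly_Mapping.lookup m i)) 1"
  proof -
    have "(\<Prod>i\<in>A. Poly_Mapping.single (Poly_Mapping.single i (Poly_Mapping.lookup m i)) (1::complex)) =
      Poly_Mapping.single (\<Sum>i\<in>A. Poly_Mapping.single i (Poly_Mapping.lookup m i)) 1" if "finite A" for A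
      using that by (induction A) (simp_all add: mult_single)
    then show ?thesis by simp
  qed
  also have "\<dots> = Poly_Mapping.single m 1"
    using mpoly_sum_singles[of m] by simp
  finally show ?thesis .
qed

lemma single_eq_mon: "Poly_Mapping.single m c = Const c * mon Var m"
  by (simp add: mon_Var Const_def mult_single)

lemma psub_Const_Var [simp]: "psub Const Var p = p"
  using mpoly_sum_singles[of p] by (simp add: psub_def single_eq_mon[symmetric])

lemma poly_in_Const [simp]: "poly_in V (Const c)"
  by (cases "c = 0") (simp_all add: poly_in_def Const_def)

lemma poly_in_0 [simp]: "poly_in V 0" and poly_in_1 [simp]: "poly_in V 1"
  using poly_in_Const[of V 0] poly_in_Const[of V 1] by simp_all

lemma poly_in_Var [simp]: "poly_in V (Var i) \<longleftrightarrow> i \<in> V"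
  by (simp add: poly_in_def Var_def)

lemma poly_in_add [intro, simp]: "poly_in V p \<Longrightarrow> poly_in V q \<Longrightarrow> poly_in V (p + q)"
  using keys_add[of p q] by (auto simp: poly_in_def)

lemma poly_in_mult [intro, simp]: assumes "poly_in V p" "poly_in V q" shows "poly_in V (p * q)"
  unfolding poly_in_def
proof (intro ballI subsetI)
  fix m i assume "m \<in> Poly_Mapping.keys (p * q)" and i: "i \<in> Poly_Mapping.keys m"
  then obtain a b where "m = a + b" "a \<in> Poly_Mapping.keys p" "b \<in> Poly_Mapping.keys q"
    using keys_mult[of p q] by auto
  then show "i \<in> V" using i keys_add[of a b] assms by (auto simp: poly_in_def)
qed

lemma poly_in_uminus [intro, simp]: "poly_in V p \<Longrightarrow> poly_in V (- p)"
  by (simp add: poly_in_def)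

lemma poly_in_diff [intro, simp]: "poly_in V p \<Longrightarrow> poly_in V q \<Longrightarrow> poly_in V (p - q)"
  using poly_in_add[of V p "- q"] by simp

lemma poly_in_power [intro, simp]: "poly_in V p \<Longrightarrow> poly_in V (p ^ n)"
  by (induction n) simp_all

lemma poly_in_sum [intro]: "(\<And>x. x \<in> A \<Longrightarrow> poly_in V (f x)) \<Longrightarrow> poly_in V (sum f A)"
  by (induction A rule: infinite_finite_induct) simp_all

lemma poly_in_prod: "(\<And>x. x \<in> A \<Longrightarrow> poly_in V (f x)) \<Longrightarrow> poly_in V (prod f A)"
  by (induction A rule: infinite_finite_induct) simp_all

lemma poly_in_psub:
  assumes "poly_in V p" "\<And>c. poly_in W (e c)" "\<And>i. i \<in> V \<Longrightarrow> poly_in W (\<rho> i)"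
  shows "poly_in W (psub e \<rho> p)"
  unfolding psub_def mon_def
  by (intro poly_in_sum poly_in_mult poly_in_prod poly_in_power assms) (use assms(1) in \<open>auto simp: poly_in_def\<close>)

text \<open>Constants and variables generate the ring, so compatibilities of derivations and
  homomorphisms need only be checked on them; the chain rule in a chart is obtained this
  way.\<close>

lemma poly_in_induct [consumes 1, case_names Const Var add mult]:
  assumes "poly_in V p"
    and C: "\<And>c. P (Const c)" and X: "\<And>i. i \<in> V \<Longrightarrow> P (Var i)"
    and A: "\<And>p q. poly_in V p \<Longrightarrow> poly_in V q \<Longrightarrow> P p \<Longrightarrow> P q \<Longrightarrow> P (p + q)"
    and M: "\<And>p q. poly_in V p \<Longrightarrow> poly_in V q \<Longrightarrow> P p \<Longrightarrow> P q \<Longrightarrow> P (p * q)"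
  shows "P p"
proof -
  have pw: "poly_in V q \<Longrightarrow> P q \<Longrightarrow> P (q ^ k)" for q k
    using C[of 1] by (induction k) (simp_all add: M)
  have pr: "finite B \<Longrightarrow> (\<And>x. x \<in> B \<Longrightarrow> poly_in V (f x) \<and> P (f x)) \<Longrightarrow> P (prod f B)" for B and f :: "nat \<Rightarrow> mpoly"
  proof (induction B rule: finite_induct)
    case empty then show ?case using C[of 1] by simp
  next
    case (insert x B) then show ?case by (auto intro!: M poly_in_prod)
  qed
  have mo: "poly_in V (mon Var m) \<and> P (mon Var m)" if "Poly_Mapping.keys m \<subseteq> V" for m
    unfolding mon_def using that by (auto intro!: pr pw X poly_in_prod)
  have sm: "finite B \<Longrightarrow> (\<And>x. x \<in> B \<Longrightarrow> poly_in V (f x) \<and> P (f x)) \<Longrightarrow> P (sum f B)" for B and f :: "(nat \<Rightarrow>\<^sub>0 nat) \<Rightarrow> mpoly"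

  proof (induction B rule: finite_induct)
    case empty then show ?case using C[of 0] by simp
  next
    case (insert x B) then show ?case by (auto intro!: A poly_in_sum)
  qed
  have "P (psub Const Var p)"
    unfolding psub_def
  proof (rule sm)
    fix m assume "m \<in> Poly_Mapping.keys p"
    then have "Poly_Mapping.keys m \<subseteq> V" using assms(1) by (auto simp: poly_in_def)
    then show "poly_in V (Const (Poly_Mapping.lookup p m) * mon Var m) \<and> P (Const (Poly_Mapping.lookup p m) * mon Var m)"
      using mo[of m] by (auto intro: M C)
  qed simp
  then show ?thesis by simp
qed

lemma poly_in_UNIV [simp]: "poly_in UNIV p"
  by (simp add: poly_in_def)

lemma rhom_mpoly_unique:
  assumes "rhom f" "rhom g" "poly_in V p" "\<And>c. f (Const c) = g (Const c)" "\<And>i. i \<in> V \<Longrightarrow> f (Var i) = g (Var i)"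
  shows "f p = g p"
  using assms(3) by (induction rule: poly_in_induct) (simp_all add: assms rhom_add rhom_mult)

section \<open>Partial derivatives and dehomogenisation\<close>

lemma pder_superset:
  assumes "finite A" "Poly_Mapping.keys p \<subseteq> A"
  shows "pder i p = (\<Sum>m\<in>A. Poly_Mapping.single (m - Poly_Mapping.single i 1)
                               (of_nat (Poly_Mapping.lookup m i) * Poly_Mapping.lookup p m))"
  unfolding pder_def by (rule sum.mono_neutral_left[OF assms]) (auto simp: in_keys_iff)

lemma pder_add: "pder i (p + q) = pder i p + pder i q"
proof -
  let ?A = "Poly_Mapping.keys p \<union> Poly_Mapping.keys q"
  have "pder i (p + q) = (\<Sum>m\<in>?A. Poly_Mapping.single (m - Poly_Mapping.single i 1)
                               (of_nat (Poly_Mapping.lookup m i) * Poly_Mapping.lookup (p + q) m))"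
    by (rule pder_superset) (auto dest: keys_addD)
  also have "\<dots> = (\<Sum>m\<in>?A. Poly_Mapping.single (m - Poly_Mapping.single i 1) (of_nat (Poly_Mapping.lookup m i) * Poly_Mapping.lookup p m))
     + (\<Sum>m\<in>?A. Poly_Mapping.single (m - Poly_Mapping.single i 1) (of_nat (Poly_Mapping.lookup m i) * Poly_Mapping.lookup q m))"
    by (simp add: lookup_add single_add distrib_left sum.distrib)
  also have "\<dots> = pder i p + pder i q"
    by (subst (1 2) pder_superset[of ?A]) auto
  finally show ?thesis .
qed

lemma pder_0 [simp]: "pder i 0 = 0"
  by (simp add: pder_def)

lemma pder_sum: "pder i (sum f A) = (\<Sum>x\<in>A. pder i (f x))"
  by (induction A rule: infinite_finite_induct) (simp_all add: pder_add)

lemma pder_single: "pder i (Poly_Mapping.single m c) =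
   Poly_Mapping.single (m - Poly_Mapping.single i 1) (of_nat (Poly_Mapping.lookup m i) * c)"
  by (cases "c = 0") (simp_all add: pder_def)

lemma pder_mult_single:
  "pder i (Poly_Mapping.single m c * Poly_Mapping.single n d) =
     pder i (Poly_Mapping.single m c) * Poly_Mapping.single n d + Poly_Mapping.single m c * pder i (Poly_Mapping.single n d)"
proof -
  \<comment> \<open>Subtraction of exponents is truncated: if x_i does not occur in
    \<open>m\<close>, the exponents on the two sides may differ, but then the coefficient is
    0.\<close>
  have a: "Poly_Mapping.single (m - Poly_Mapping.single i (1::nat) + n) (of_nat (Poly_Mapping.lookup m i) * c * d) =
     Poly_Mapping.single (m + n - Poly_Mapping.single i 1) (of_nat (Poly_Mapping.lookup m i) * c * d)" for m n :: "nat \<Rightarrow>\<^sub>0 nat" and c d :: complex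
  proof (cases "Poly_Mapping.lookup m i = 0")
    case False
    then have "m - Poly_Mapping.single i (1::nat) + n = m + n - Poly_Mapping.single i 1"
      by (intro poly_mapping_eqI) (auto simp: lookup_add lookup_minus lookup_single when_def)
    then show ?thesis by simp
  qed simp
  show ?thesis
    using a[of m n c d] a[of n m d c]
    by (simp add: mult_single pder_single lookup_add algebra_simps single_add[symmetric])
qed

lemma pder_mult: "pder i (p * q) = pder i p * q + p * pder i q"
proof -
  let ?p = "\<lambda>m. Poly_Mapping.single m (Poly_Mapping.lookup p m)"
  let ?q = "\<lambda>m. Poly_Mapping.single m (Poly_Mapping.lookup q m)"
  have p: "p = (\<Sum>m\<in>Poly_Mapping.keys p. ?p m)" and q: "q = (\<Sum>m\<in>Poly_Mapping.keys q. ?q m)"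
    by (rule mpoly_sum_singles)+
  have "pder i ((\<Sum>m\<in>Poly_Mapping.keys p. ?p m) * (\<Sum>m\<in>Poly_Mapping.keys q. ?q m)) =
    (\<Sum>m\<in>Poly_Mapping.keys p. pder i (?p m)) * (\<Sum>m\<in>Poly_Mapping.keys q. ?q m) +
    (\<Sum>m\<in>Poly_Mapping.keys p. ?p m) * (\<Sum>m\<in>Poly_Mapping.keys q. pder i (?q m))"
    by (simp only: sum_product pder_sum pder_mult_single sum.distrib)
  then show ?thesis by (simp only: pder_sum[symmetric] p[symmetric] q[symmetric])
qed

lemma pder_Const [simp]: "pder i (Const c) = 0"
  by (simp add: Const_def pder_single)

lemma pder_Var: "pder i (Var j) = (if i = j then 1 else 0)"
  by (simp add: Var_def pder_single lookup_single)

lemma poly_in_pder: "poly_in V p \<Longrightarrow> poly_in V (pder i p)"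
  by (induction rule: poly_in_induct) (auto simp: pder_add pder_mult pder_Var)

text \<open>Deleting the exponent of x_k is the substitution x_k \<mapsto> 1; in this form
  multiplicativity comes for free.\<close>

lemma dehom_eq: "dehom k p = psub Const (\<lambda>i. if i = k then 1 else Var i) p"
proof -
  have "Const c * mon (\<lambda>i. if i = k then 1 else Var i) m = Poly_Mapping.single (m - Poly_Mapping.single k (Poly_Mapping.lookup m k)) c" for m c
  proof -
    let ?m = "m - Poly_Mapping.single k (Poly_Mapping.lookup m k)"
    have "mon (\<lambda>i. if i = k then 1 else Var i) m = (\<Prod>i\<in>Poly_Mapping.keys m. Var i ^ Poly_Mapping.lookup ?m i)"
      unfolding mon_def by (rule prod.cong) (auto simp: lookup_minus lookup_single)
    also have "\<dots> = mon Var ?m"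
      by (rule mon_superset[symmetric]) (auto simp: in_keys_iff lookup_minus)
    finally show ?thesis by (simp add: single_eq_mon)
  qed
  then show ?thesis by (simp add: dehom_def psub_def)
qed

lemma rhom_dehom: "rhom (dehom k)"
  unfolding dehom_eq by (rule rhom_psub[OF rhom_Const])

lemma dehom_Const [simp]: "dehom k (Const c) = Const c"
  and dehom_Var: "dehom k (Var i) = (if i = k then 1 else Var i)"
  by (simp_all add: dehom_eq rhom_Const)

lemma poly_in_dehom: "poly_in V p \<Longrightarrow> poly_in (V - {k}) (dehom k p)"
  unfolding dehom_eq by (rule poly_in_psub) auto

lemma pder_dehom: "i \<noteq> k \<Longrightarrow> pder i (dehom k p) = dehom k (pder i p)"
proof -
  assume ik: "i \<noteq> k"
  have "poly_in UNIV p" by simp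
  then show ?thesis
    by (induction rule: poly_in_induct)
      (use ik in \<open>auto simp: dehom_Var pder_Var rhom_simps[OF rhom_dehom] pder_add pder_mult pder_Const[of _ 1, simplified]\<close>)
qed

lemma psub_dehom: "rhom e \<Longrightarrow> \<rho> k = 1 \<Longrightarrow> psub e \<rho> (dehom k p) = psub e \<rho> p"
  by (rule rhom_mpoly_unique[of "\<lambda>p. psub e \<rho> (dehom k p)" _ UNIV])
    (auto intro: rhom_comp rhom_psub rhom_dehom simp: dehom_Var rhom_1[OF rhom_psub])

lemma psub_homog: assumes "homog d p" shows "psub e (\<lambda>i. c * \<rho> i) p = c ^ d * psub e \<rho> p"
  using assms by (simp add: psub_def mon_scale homog_def sum_distrib_left mult_ac)

section \<open>Homogeneous polynomials and Euler's formula\<close>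

lemma mdeg_add: "mdeg (m + n) = mdeg m + mdeg n"
proof -
  have s: "mdeg m = (\<Sum>i\<in>A. Poly_Mapping.lookup m i)" if "finite A" "Poly_Mapping.keys m \<subseteq> A" for m A
    unfolding mdeg_def by (rule sum.mono_neutral_left) (use that in \<open>auto simp: in_keys_iff\<close>)
  let ?A = "Poly_Mapping.keys m \<union> Poly_Mapping.keys n"
  have "mdeg (m + n) = (\<Sum>i\<in>?A. Poly_Mapping.lookup (m + n) i)"
    by (rule s) (auto dest: keys_addD)
  then show ?thesis using s[of ?A m] s[of ?A n] by (simp add: lookup_add sum.distrib)
qed

lemma homog_0 [simp]: "homog d 0"
  by (simp add: homog_def)

lemma homog_Const [simp]: "homog 0 (Const c)"
  by (cases "c = 0") (simp_all add: homog_def Const_def mdeg_def)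

lemma homog_1 [simp]: "homog 0 1"
  using homog_Const[of 1] by simp

lemma homog_Var [simp]: "homog 1 (Var i)" "homog (Suc 0) (Var i)"
  by (simp_all add: homog_def Var_def mdeg_def)

lemma homog_add: "homog d p \<Longrightarrow> homog d q \<Longrightarrow> homog d (p + q)"
  using keys_add[of p q] by (auto simp: homog_def)

lemma homog_uminus: "homog d p \<Longrightarrow> homog d (- p)"
  by (simp add: homog_def)

lemma homog_diff: "homog d p \<Longrightarrow> homog d q \<Longrightarrow> homog d (p - q)"
  using homog_add[of d p "-q"] by (simp add: homog_uminus)

lemma homog_mult: assumes "homog d p" "homog d' q" shows "homog (d + d') (p * q)"
  unfolding homog_def
proof
  fix m assume "m \<in> Poly_Mapping.keys (p * q)"
  then obtain a b where "m = a + b" "a \<in> Poly_Mapping.keys p" "b \<in> Poly_Mapping.keys q"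
    using keys_mult[of p q] by auto
  then show "mdeg m = d + d'" using assms by (simp add: homog_def mdeg_add)
qed

lemma homog_mult': "homog d p \<Longrightarrow> homog d' q \<Longrightarrow> e = d + d' \<Longrightarrow> homog e (p * q)"
  using homog_mult by blast

lemma homog_Const_mult: "homog d p \<Longrightarrow> homog d (Const c * p)"
  using homog_mult[of 0 "Const c" d p] by simp

lemma homog_power: "homog d p \<Longrightarrow> homog (n * d) (p ^ n)"
  by (induction n) (auto intro: homog_mult')

lemma homog_sum: "(\<And>x. x \<in> A \<Longrightarrow> homog d (f x)) \<Longrightarrow> homog d (sum f A)"
  by (induction A rule: infinite_finite_induct) (auto intro: homog_add)

lemma homog_unique: assumes "homog d p" "homog d' p" "p \<noteq> 0" shows "d = d'"
  using assms by (metis homog_def keys_eq_empty ex_in_conv)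

lemma homog_pder: assumes "homog (Suc d) p" shows "homog d (pder i p)"
  unfolding pder_def
proof (rule homog_sum)
  fix m assume m: "m \<in> Poly_Mapping.keys p"
  show "homog d (Poly_Mapping.single (m - Poly_Mapping.single i 1) (of_nat (Poly_Mapping.lookup m i) * Poly_Mapping.lookup p m))"
  proof (cases "Poly_Mapping.lookup m i = 0")
    case False
    then have "m = (m - Poly_Mapping.single i 1) + Poly_Mapping.single i 1"
      by (intro poly_mapping_eqI) (auto simp: lookup_add lookup_minus lookup_single when_def)
    then have "mdeg m = mdeg (m - Poly_Mapping.single i 1) + mdeg (Poly_Mapping.single i 1)"
      by (metis mdeg_add)
    then have "mdeg (m - Poly_Mapping.single i 1) = d"
      using m assms by (simp add: homog_def mdeg_def)
    then show ?thesis using keys_single by (auto simp: homog_def split: if_splits)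
  qed simp
qed

lemma euler_formula:
  assumes "homog d p" "inS p"
  shows "Var 0 * pder 0 p + Var 1 * pder 1 p + Var 2 * pder 2 p = of_nat d * p"
proof -
  have e: "Var i * Poly_Mapping.single (m - Poly_Mapping.single i 1) (of_nat (Poly_Mapping.lookup m i) * c)
     = Poly_Mapping.single m (of_nat (Poly_Mapping.lookup m i) * c)" for i m c
  proof (cases "Poly_Mapping.lookup m i = 0")
    case False
    then have "Poly_Mapping.single i 1 + (m - Poly_Mapping.single i 1) = m"
      by (intro poly_mapping_eqI) (auto simp: lookup_add lookup_minus lookup_single when_def)
    then show ?thesis by (simp add: Var_def mult_single)
  qed simp
  have "Var 0 * pder 0 p + Var 1 * pder 1 p + Var 2 * pder 2 p =
    (\<Sum>m\<in>Poly_Mapping.keys p. Poly_Mapping.single m (of_nat (Poly_Mapping.lookup m 0) * Poly_Mapping.lookup p m)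
      + Poly_Mapping.single m (of_nat (Poly_Mapping.lookup m 1) * Poly_Mapping.lookup p m)
      + Poly_Mapping.single m (of_nat (Poly_Mapping.lookup m 2) * Poly_Mapping.lookup p m))"
    unfolding pder_def sum_distrib_left e by (simp add: sum.distrib)
  also have "\<dots> = (\<Sum>m\<in>Poly_Mapping.keys p. of_nat d * Poly_Mapping.single m (Poly_Mapping.lookup p m))"
  proof (rule sum.cong[OF refl])
    fix m assume m: "m \<in> Poly_Mapping.keys p"
    have "mdeg m = (\<Sum>i\<in>{0,1,2}. Poly_Mapping.lookup m i)"
      unfolding mdeg_def by (rule sum.mono_neutral_left) (use m assms(2) in \<open>auto simp: in_keys_iff poly_in_def\<close>)
    then have d: "d = Poly_Mapping.lookup m 0 + Poly_Mapping.lookup m 1 + Poly_Mapping.lookup m 2"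
      using assms(1) m by (simp add: homog_def)
    have "(of_nat d :: mpoly) = Const (of_nat d)"
      by (simp add: rhom_of_nat[OF rhom_Const])
    then have "of_nat d * Poly_Mapping.single m (Poly_Mapping.lookup p m) = Poly_Mapping.single m (of_nat d * Poly_Mapping.lookup p m)"
      by (simp only: Const_def mult_single add_0_left)
    then show "Poly_Mapping.single m (of_nat (Poly_Mapping.lookup m 0) * Poly_Mapping.lookup p m)
      + Poly_Mapping.single m (of_nat (Poly_Mapping.lookup m 1) * Poly_Mapping.lookup p m)
      + Poly_Mapping.single m (of_nat (Poly_Mapping.lookup m 2) * Poly_Mapping.lookup p m) = of_nat d * Poly_Mapping.single m (Poly_Mapping.lookup p m)"
      by (simp add: d single_add[symmetric] algebra_simps)
  qed
  also have "\<dots> = of_nat d * p"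
    using mpoly_sum_singles[of p] by (simp add: sum_distrib_left[symmetric])
  finally show ?thesis .
qed

unbundle fps_syntax

section \<open>Colength of ideals\<close>

text \<open>Gaussian elimination: a vector with nonzero last coordinate clears that coordinate in
  all the others, and induction applies to these. This is the linear algebra behind the uniqueness
  of colengths.\<close>

lemma nontrivial_relation:
  fixes a :: "'j \<Rightarrow> nat \<Rightarrow> 'f::field"
  assumes "finite J" "card J > n"
  shows "\<exists>x. (\<exists>j\<in>J. x j \<noteq> 0) \<and> (\<forall>i<n. (\<Sum>j\<in>J. x j * a j i) = 0)"
  using assms
proof (induction n arbitrary: J a)
  case 0
  then have "J \<noteq> {}" by auto
  then show ?case by (intro exI[of _ "\<lambda>_. 1"]) auto
next
  case (Suc n)
  show ?case
  proof (cases "\<forall>j\<in>J. a j n = 0")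
    case True
    obtain x where "\<exists>j\<in>J. x j \<noteq> 0" "\<forall>i<n. (\<Sum>j\<in>J. x j * a j i) = 0"
      using Suc.IH[of J a] Suc.prems by auto
    then show ?thesis using True by (intro exI[of _ x]) (auto simp: less_Suc_eq)
  next
    case False
    then obtain k where k: "k \<in> J" "a k n \<noteq> 0" by auto
    define b where "b j i = a j i - a j n / a k n * a k i" for j i
    have "card (J - {k}) > n" using Suc.prems k by simp
    then obtain x where x: "\<exists>j\<in>J - {k}. x j \<noteq> 0" "\<forall>i<n. (\<Sum>j\<in>J - {k}. x j * b j i) = 0"
      using Suc.IH[of "J - {k}" b] Suc.prems by auto
    define y where "y = x(k := - (\<Sum>j\<in>J - {k}. x j * a j n / a k n))"
    have "(\<Sum>j\<in>J. y j * a j i) = (\<Sum>j\<in>J - {k}. x j * b j i)" for i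
    proof -
      have "(\<Sum>j\<in>J. y j * a j i) = y k * a k i + (\<Sum>j\<in>J - {k}. x j * a j i)"
        using Suc.prems k by (subst sum.remove[of J k]) (auto simp: y_def intro!: sum.cong)
      also have "\<dots> = (\<Sum>j\<in>J - {k}. x j * b j i)"
        by (simp add: y_def b_def sum_distrib_right right_diff_distrib sum_subtractf mult.assoc)
      finally show ?thesis .
    qed
    moreover have "(\<Sum>j\<in>J - {k}. x j * b j n) = 0"
      using k by (intro sum.neutral) (auto simp: b_def)
    ultimately show ?thesis using x k by (intro exI[of _ y]) (auto simp: less_Suc_eq y_def)
  qed
qed

section \<open>Ideals with two or three generators, colons and sums\<close>

definition ideal :: "'r::comm_ring_1 set \<Rightarrow> bool" where
  "ideal W \<longleftrightarrow> 0 \<in> W \<and> (\<forall>x\<in>W. \<forall>y\<in>W. x + y \<in> W) \<and> (\<forall>r. \<forall>x\<in>W. r * x \<in> W)"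

definition colon :: "'r::comm_ring_1 set \<Rightarrow> 'r \<Rightarrow> 'r set" where
  "colon W c = {x. c * x \<in> W}"

definition iplus :: "'r::comm_ring_1 set \<Rightarrow> 'r \<Rightarrow> 'r set" where
  "iplus W c = {x. \<exists>r. x - c * r \<in> W}"

definition id2 :: "'r::comm_ring_1 \<Rightarrow> 'r \<Rightarrow> 'r set" where
  "id2 a b = {x. \<exists>\<alpha> \<beta>. x = \<alpha> * a + \<beta> * b}"

definition id3 :: "'r::comm_ring_1 \<Rightarrow> 'r \<Rightarrow> 'r \<Rightarrow> 'r set" where
  "id3 a b c = {x. \<exists>\<alpha> \<beta> \<gamma>. x = \<alpha> * a + \<beta> * b + \<gamma> * c}"

lemma ideal_0: "ideal W \<Longrightarrow> 0 \<in> W"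
  and ideal_add: "ideal W \<Longrightarrow> x \<in> W \<Longrightarrow> y \<in> W \<Longrightarrow> x + y \<in> W"
  and ideal_mult: "ideal W \<Longrightarrow> x \<in> W \<Longrightarrow> r * x \<in> W"
  by (simp_all add: ideal_def)

lemma ideal_mult2: "ideal W \<Longrightarrow> x \<in> W \<Longrightarrow> x * r \<in> W"
  using ideal_mult[of W x r] by (simp add: mult.commute)

lemma ideal_sum: "ideal W \<Longrightarrow> (\<And>i. i \<in> A \<Longrightarrow> f i \<in> W) \<Longrightarrow> sum f A \<in> W"
  by (induction A rule: infinite_finite_induct) (auto intro: ideal_0 ideal_add)

lemma ideal_id2: "ideal (id2 a b)"
  unfolding ideal_def
proof (intro conjI ballI allI)
  show "0 \<in> id2 a b" unfolding id2_def by (rule CollectI, rule exI[of _ 0], rule exI[of _ 0]) simp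
next
  fix x y assume "x \<in> id2 a b" "y \<in> id2 a b"
  then obtain p q p' q' where "x = p * a + q * b" "y = p' * a + q' * b" by (auto simp: id2_def)
  then have "x + y = (p + p') * a + (q + q') * b" by (simp add: algebra_simps)
  then show "x + y \<in> id2 a b" unfolding id2_def by blast
next
  fix r x assume "x \<in> id2 a b"
  then obtain p q where "x = p * a + q * b" by (auto simp: id2_def)
  then have "r * x = (r * p) * a + (r * q) * b" by (simp add: algebra_simps)
  then show "r * x \<in> id2 a b" unfolding id2_def by blast
qed

lemma ideal_id3: "ideal (id3 a b c)"
  unfolding ideal_def
proof (intro conjI ballI allI)
  show "0 \<in> id3 a b c" unfolding id3_def by (rule CollectI, rule exI[of _ 0], rule exI[of _ 0], rule exI[of _ 0]) simp
next
  fix x y assume "x \<in> id3 a b c" "y \<in> id3 a b c"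
  then obtain p q s p' q' s' where "x = p * a + q * b + s * c" "y = p' * a + q' * b + s' * c" by (auto simp: id3_def)
  then have "x + y = (p + p') * a + (q + q') * b + (s + s') * c" by (simp add: algebra_simps)
  then show "x + y \<in> id3 a b c" unfolding id3_def by blast
next
  fix r x assume "x \<in> id3 a b c"
  then obtain p q s where "x = p * a + q * b + s * c" by (auto simp: id3_def)
  then have "r * x = (r * p) * a + (r * q) * b + (r * s) * c" by (simp add: algebra_simps)
  then show "r * x \<in> id3 a b c" unfolding id3_def by blast
qed

lemma id2I: "x = \<alpha> * a + \<beta> * b \<Longrightarrow> x \<in> id2 a b"
  unfolding id2_def by blast

lemma id3I: "x = \<alpha> * a + \<beta> * b + \<gamma> * c \<Longrightarrow> x \<in> id3 a b c"
  unfolding id3_def by blast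

lemma id2_gen: "a \<in> id2 a b" "b \<in> id2 a b"
  by (rule id2I[of _ 1 _ 0], simp, rule id2I[of _ 0 _ 1], simp)

lemma id3_gen: "a \<in> id3 a b c" "b \<in> id3 a b c" "c \<in> id3 a b c"
  by (rule id3I[of _ 1 _ 0 _ 0], simp, rule id3I[of _ 0 _ 1 _ 0], simp, rule id3I[of _ 0 _ 0 _ 1], simp)

lemma id2_least: "ideal W \<Longrightarrow> a \<in> W \<Longrightarrow> b \<in> W \<Longrightarrow> id2 a b \<subseteq> W"
  by (auto simp: id2_def intro: ideal_add ideal_mult)

lemma id3_least: "ideal W \<Longrightarrow> a \<in> W \<Longrightarrow> b \<in> W \<Longrightarrow> c \<in> W \<Longrightarrow> id3 a b c \<subseteq> W"
  by (auto simp: id3_def intro: ideal_add ideal_mult)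

text \<open>Complex dimensions of quotients without forming the quotient: independence and spanning
  are tested modulo \<open>W\<close>, and scalars act through \<open>e\<close>.\<close>

locale calg =
  fixes e :: "complex \<Rightarrow> 'r::comm_ring_1"
  assumes rhom_e: "rhom e"
begin

definition ind :: "'r set \<Rightarrow> nat \<Rightarrow> (nat \<Rightarrow> 'r) \<Rightarrow> bool" where
  "ind W n b \<longleftrightarrow> (\<forall>c. (\<Sum>i<n. e (c i) * b i) \<in> W \<longrightarrow> (\<forall>i<n. c i = 0))"

definition spans :: "'r set \<Rightarrow> nat \<Rightarrow> (nat \<Rightarrow> 'r) \<Rightarrow> bool" where
  "spans W n b \<longleftrightarrow> (\<forall>u. \<exists>c. u - (\<Sum>i<n. e (c i) * b i) \<in> W)"

definition codim :: "'r set \<Rightarrow> nat \<Rightarrow> bool" where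
  "codim W n \<longleftrightarrow> (\<exists>b. ind W n b \<and> spans W n b)"

lemma ind_le_spans:
  assumes W: "ideal W" and "spans W n b" "ind W k p"
  shows "k \<le> n"
proof (rule ccontr)
  assume "\<not> k \<le> n"
  from assms(2) have "\<forall>j. \<exists>c. p j - (\<Sum>i<n. e (c i) * b i) \<in> W" by (simp add: spans_def)
  then obtain a where a: "p j - (\<Sum>i<n. e (a j i) * b i) \<in> W" for j by metis
  obtain x where x: "\<exists>j\<in>{..<k}. x j \<noteq> 0" "\<forall>i<n. (\<Sum>j\<in>{..<k}. x j * a j i) = 0"
    using nontrivial_relation[of "{..<k}" n a] \<open>\<not> k \<le> n\<close> by auto
  have "(\<Sum>j<k. e (x j) * (p j - (\<Sum>i<n. e (a j i) * b i))) \<in> W"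
    by (intro ideal_sum W ideal_mult a)
  also have "(\<Sum>j<k. e (x j) * (p j - (\<Sum>i<n. e (a j i) * b i))) =
     (\<Sum>j<k. e (x j) * p j) - (\<Sum>j<k. \<Sum>i<n. e (x j * a j i) * b i)"
    by (simp add: right_diff_distrib sum_subtractf sum_distrib_left rhom_mult[OF rhom_e] mult.assoc)
  also have "(\<Sum>j<k. \<Sum>i<n. e (x j * a j i) * b i) = (\<Sum>i<n. e (\<Sum>j<k. x j * a j i) * b i)"
    by (subst sum.swap) (simp add: rhom_sum[OF rhom_e] sum_distrib_right)
  also have "\<dots> = 0" using x(2) by (simp add: rhom_0[OF rhom_e])
  finally show False using assms(3) x(1) by (auto simp: ind_def)
qed

lemma codim_unique: "ideal W \<Longrightarrow> codim W n \<Longrightarrow> codim W m \<Longrightarrow> n = m"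
  unfolding codim_def using ind_le_spans by (meson le_antisym)

text \<open>An independent family of maximal length spans, because a vector outside its span could
  be appended to it.\<close>

lemma codim_of_bounded:
  assumes W: "ideal W" and bd: "\<And>k p. ind W k p \<Longrightarrow> k \<le> N"
  shows "\<exists>n\<le>N. codim W n"
proof -
  define n where "n = Max {k. \<exists>p. ind W k p}"
  have fin: "finite {k. \<exists>p. ind W k p}"
  proof (rule finite_subset[of _ "{..N}"])
    show "{k. \<exists>p. ind W k p} \<subseteq> {..N}" using bd by blast
  qed simp
  have "ind W 0 undefined" by (simp add: ind_def)
  then have "{k. \<exists>p. ind W k p} \<noteq> {}" by blast
  from Max_in[OF fin this] obtain p where p: "ind W n p" unfolding n_def by blast
  have "spans W n p" unfolding spans_def
  proof (rule allI, rule ccontr)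
    fix u assume no: "\<nexists>c. u - (\<Sum>i<n. e (c i) * p i) \<in> W"
    have "ind W (Suc n) (p(n := u))"
      unfolding ind_def
    proof (intro allI impI)
      fix c i assume c: "(\<Sum>i<Suc n. e (c i) * (p(n := u)) i) \<in> W" and i: "i < Suc n"
      then have c: "(\<Sum>i<n. e (c i) * p i) + e (c n) * u \<in> W" by simp
      have "c n = 0"
      proof (rule ccontr)
        assume cn: "c n \<noteq> 0"
        have "e (1 / c n) * ((\<Sum>i<n. e (c i) * p i) + e (c n) * u) \<in> W" using c W by (rule ideal_mult[rotated])
        also have "e (1 / c n) * ((\<Sum>i<n. e (c i) * p i) + e (c n) * u) =
          e (1 / c n * c n) * u + (\<Sum>i<n. e (1 / c n * c i) * p i)"
          unfolding rhom_mult[OF rhom_e] by (simp add: distrib_left sum_distrib_left mult_ac add.commute)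
        also have "\<dots> = u - (\<Sum>i<n. e (- (1 / c n * c i)) * p i)"
          using cn by (simp add: rhom_simps[OF rhom_e] sum_negf)
        finally have "\<exists>c. u - (\<Sum>i<n. e (c i) * p i) \<in> W"
          by (rule exI[where x = "\<lambda>i. - (1 / c n * c i)"])
        then show False using no by blast
      qed
      then show "c i = 0" using c p i by (auto simp: ind_def less_Suc_eq rhom_0[OF rhom_e])
    qed
    then have "Suc n \<in> {k. \<exists>p. ind W k p}" by blast
    from Max_ge[OF fin this] show False unfolding n_def[symmetric] by simp
  qed
  then show ?thesis using p bd[OF p] unfolding codim_def by blast
qed

lemma codim_mono:
  assumes "ideal W" "ideal U" "W \<subseteq> U" "codim W n"
  shows "\<exists>m\<le>n. codim U m"
proof (rule codim_of_bounded[OF assms(2)])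
  fix k p assume "ind U k p"
  then have "ind W k p" using assms(3) by (auto simp: ind_def)
  then show "k \<le> n" using assms(1,4) ind_le_spans by (auto simp: codim_def)
qed

lemma sum_lessThan_split: "(\<Sum>i<n + (m::nat). f i) = (\<Sum>i<n. f i) + (\<Sum>i<m. (f (n + i) :: 'r))"
  by (induction m) (simp_all add: add_ac)

text \<open>Multiplication by \<open>c\<close> gives an exact sequence from R/(W : c) through R/W to
  R/(W + (c)). A basis of the middle term consists of \<open>c\<close> times a basis of the first
  and a lift of a basis of the last.\<close>

lemma codim_colon:
  assumes W: "ideal W" and "codim (colon W c) n" "codim (iplus W c) m"
  shows "codim W (n + m)"
proof -
  obtain b where b: "ind (colon W c) n b" "spans (colon W c) n b" using assms(2) by (auto simp: codim_def)
  obtain d where d: "ind (iplus W c) m d" "spans (iplus W c) m d" using assms(3) by (auto simp: codim_def)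
  define f where "f i = (if i < n then c * b i else d (i - n))" for i
  have S: "(\<Sum>i<n + m. e (a i) * f i) = c * (\<Sum>i<n. e (a i) * b i) + (\<Sum>i<m. e (a (n + i)) * d i)" for a
    by (simp add: sum_lessThan_split f_def sum_distrib_left mult_ac)
  have "ind W (n + m) f"
    unfolding ind_def
  proof (intro allI impI)
    fix a i assume a: "(\<Sum>i<n + m. e (a i) * f i) \<in> W" and i: "i < n + m"
    then have *: "c * (\<Sum>i<n. e (a i) * b i) + (\<Sum>i<m. e (a (n + i)) * d i) \<in> W" by (simp add: S)
    then have "(\<Sum>i<m. e (a (n + i)) * d i) \<in> iplus W c"
      unfolding iplus_def by (intro CollectI exI[of _ "- (\<Sum>i<n. e (a i) * b i)"]) (simp add: add.commute)
    then have d0: "a (n + i) = 0" if "i < m" for i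
      using d(1)[unfolded ind_def, rule_format, of "\<lambda>i. a (n + i)"] that by simp
    then have "(\<Sum>i<n. e (a i) * b i) \<in> colon W c"
      using * by (simp add: colon_def rhom_0[OF rhom_e])
    then have b0: "a i = 0" if "i < n" for i
      using b(1)[unfolded ind_def, rule_format, of a] that by simp
    show "a i = 0" using d0[of "i - n"] b0[of i] i by (cases "i < n") auto
  qed
  moreover have "spans W (n + m) f"
    unfolding spans_def
  proof
    fix u
    obtain x where "u - (\<Sum>i<m. e (x i) * d i) \<in> iplus W c" using d(2) by (auto simp: spans_def)
    then obtain r where r: "u - (\<Sum>i<m. e (x i) * d i) - c * r \<in> W" by (auto simp: iplus_def)
    obtain y where "r - (\<Sum>i<n. e (y i) * b i) \<in> colon W c" using b(2) by (auto simp: spans_def)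
    then have y: "c * (r - (\<Sum>i<n. e (y i) * b i)) \<in> W" by (simp add: colon_def)
    have "(u - (\<Sum>i<m. e (x i) * d i) - c * r) + c * (r - (\<Sum>i<n. e (y i) * b i)) \<in> W"
      using r y by (rule ideal_add[OF W])
    also have "(u - (\<Sum>i<m. e (x i) * d i) - c * r) + c * (r - (\<Sum>i<n. e (y i) * b i)) =
        u - (c * (\<Sum>i<n. e (y i) * b i) + (\<Sum>i<m. e (x i) * d i))"
      by (simp add: right_diff_distrib)
    also have "\<dots> = u - (\<Sum>i<n + m. e (if i < n then y i else x (i - n)) * f i)"
      unfolding S by simp
    finally have "u - (\<Sum>i<n + m. e (if i < n then y i else x (i - n)) * f i) \<in> W" .
    then show "\<exists>c. u - (\<Sum>i<n + m. e (c i) * f i) \<in> W"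
      by (rule exI[where x = "\<lambda>i. if i < n then y i else x (i - n)"])
  qed
  ultimately show ?thesis unfolding codim_def by blast
qed

lemma codim_UNIV: "codim UNIV 0"
  by (simp add: codim_def ind_def spans_def)

text \<open>Among the powers of \<open>s\<close> up to the n-th there is a relation modulo
  \<open>W\<close>; the lowest power occurring in it is factored out. If \<open>s\<close> is a
  non-unit of a local ring, the other factor is a unit and \<open>W\<close> contains a power of
  \<open>s\<close>.\<close>

lemma codim_power:
  assumes W: "ideal W" and "codim W n"
  shows "\<exists>k r c. c \<noteq> 0 \<and> s ^ k * (e c + s * r) \<in> W"
proof -
  have "\<not> ind W (Suc n) (\<lambda>i. s ^ i)"
  proof
    assume i: "ind W (Suc n) (\<lambda>i. s ^ i)"
    obtain b where "spans W n b" using assms(2) by (auto simp: codim_def)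
    from ind_le_spans[OF W this i] show False by simp
  qed
  then obtain c where c: "(\<Sum>i<Suc n. e (c i) * s ^ i) \<in> W" and ex: "\<exists>i. i < Suc n \<and> c i \<noteq> 0"
    unfolding ind_def by blast
  define k where "k = (LEAST i. i < Suc n \<and> c i \<noteq> 0)"
  have k: "k < Suc n" "c k \<noteq> 0" using LeastI_ex[OF ex] unfolding k_def by blast+
  have z: "c i = 0" if "i < k" for i
  proof (rule ccontr)
    assume "c i \<noteq> 0"
    then have "i < Suc n \<and> c i \<noteq> 0" using that k(1) by simp
    then have "k \<le> i" unfolding k_def by (rule Least_le)
    then show False using that by simp
  qed
  define r where "r = (\<Sum>i\<in>{Suc k..<Suc n}. e (c i) * s ^ (i - Suc k))"
  have 1: "(\<Sum>i<Suc n. e (c i) * s ^ i) = (\<Sum>i\<in>{k..<Suc n}. e (c i) * s ^ i)"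
    by (rule sum.mono_neutral_right) (auto simp: z rhom_0[OF rhom_e])
  have 2: "(\<Sum>i\<in>{k..<Suc n}. e (c i) * s ^ i) = e (c k) * s ^ k + (\<Sum>i\<in>{Suc k..<Suc n}. e (c i) * s ^ i)"
    using k by (subst sum.atLeast_Suc_lessThan) auto
  have 3: "(\<Sum>i\<in>{Suc k..<Suc n}. e (c i) * s ^ i) = s ^ k * (s * r)"
    unfolding r_def sum_distrib_left
  proof (rule sum.cong[OF refl])
    fix i assume "i \<in> {Suc k..<Suc n}"
    then have "s ^ i = s ^ (k + Suc (i - Suc k))" by simp
    then have *: "s ^ i = s ^ k * (s * s ^ (i - Suc k))" by (simp only: power_add power_Suc)
    show "e (c i) * s ^ i = s ^ k * (s * (e (c i) * s ^ (i - Suc k)))" unfolding * by (simp only: mult_ac)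
  qed
  have "s ^ k * (e (c k) + s * r) \<in> W"
    using c unfolding 1 2 3 by (simp only: distrib_left mult.commute[of "e (c k)"])
  then show ?thesis using k(2) by blast
qed

end

section \<open>Newton--Puiseux factorisation\<close>

lemma rhom_map_poly: assumes "rhom h" shows "rhom (map_poly h)"
proof -
  have h0: "h 0 = 0" by (rule rhom_0[OF assms])
  show ?thesis
    unfolding rhom_def
    by (auto intro!: poly_eqI simp: coeff_map_poly h0 rhom_simps[OF assms] map_poly_1' coeff_mult)
qed

lemma map_poly_pcompose: assumes "rhom h"
  shows "map_poly h (pcompose p q) = pcompose (map_poly h p) (map_poly h q)"
  using rhom_map_poly[OF assms]
  by (induction p) (simp_all add: map_poly_pCons rhom_simps[OF assms] pcompose_pCons rhom_add rhom_mult)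

lemma map_poly_linear: assumes "rhom h" shows "map_poly h [:a, b:] = [:h a, h b:]"
  by (simp add: map_poly_pCons rhom_0[OF assms])

text \<open>Base change \<open>s \<mapsto> s^n\<close>. Elements of \<open>complex fps poly\<close> are polynomials in \<open>t\<close> over \<open>C[[s]]\<close>,
  and \<open>slice0\<close> sets \<open>s = 0\<close>.\<close>

definition bc :: "nat \<Rightarrow> complex fps \<Rightarrow> complex fps" where
  "bc n a = a oo fps_X ^ n"

lemma rhom_bc: "n \<ge> 1 \<Longrightarrow> rhom (bc n)"
  by (simp add: rhom_def bc_def fps_compose_add_distrib fps_compose_mult_distrib)

lemma bc_nth_0 [simp]: "bc n a $ 0 = a $ 0"
  by (simp add: bc_def)

lemma bc_1 [simp]: "bc 1 a = a" "bc (Suc 0) a = a"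
  by (simp_all add: bc_def)

lemma bc_bc: "n \<ge> 1 \<Longrightarrow> m \<ge> 1 \<Longrightarrow> bc m (bc n a) = bc (n * m) a"
proof -
  assume nm: "n \<ge> 1" "m \<ge> 1"
  have "bc m (bc n a) = a oo (fps_X ^ n oo fps_X ^ m)"
    unfolding bc_def using nm by (subst fps_compose_assoc) auto
  also have "fps_X ^ n oo fps_X ^ m = (fps_X oo fps_X ^ m :: complex fps) ^ n"
    using nm by (subst fps_compose_power) auto
  also have "\<dots> = fps_X ^ (n * m)" using nm by (simp add: power_mult[symmetric] mult.commute)
  finally show ?thesis by (simp add: bc_def)
qed

lemma bc_X: "n \<ge> 1 \<Longrightarrow> bc n fps_X = fps_X ^ n"
  by (simp add: bc_def)

lemma bc_const [simp]: "bc n (fps_const c) = fps_const c"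
  by (simp add: bc_def)

lemma subdegree_bc: "n \<ge> 1 \<Longrightarrow> subdegree (bc n a) = subdegree a * n"
  by (simp add: bc_def)

lemma bc_eq_0_iff: "n \<ge> 1 \<Longrightarrow> bc n a = 0 \<longleftrightarrow> a = 0"
  by (simp add: bc_def fps_compose_eq_0_iff)

lemma bc_deriv: "n \<ge> 1 \<Longrightarrow> fps_deriv (bc n a) = bc n (fps_deriv a) * (of_nat n * fps_X ^ (n - 1))"
  by (simp add: bc_def fps_compose_deriv fps_deriv_power fps_of_nat mult_ac)

definition bcp :: "nat \<Rightarrow> complex fps poly \<Rightarrow> complex fps poly" where
  "bcp n = map_poly (bc n)"

lemma rhom_bcp: "n \<ge> 1 \<Longrightarrow> rhom (bcp n)"
  unfolding bcp_def by (intro rhom_map_poly rhom_bc)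

lemma coeff_bcp: "n \<ge> 1 \<Longrightarrow> coeff (bcp n P) j = bc n (coeff P j)"
  by (simp add: bcp_def coeff_map_poly rhom_0[OF rhom_bc])

lemma bcp_bcp: "n \<ge> 1 \<Longrightarrow> m \<ge> 1 \<Longrightarrow> bcp m (bcp n P) = bcp (n * m) P"
  by (rule poly_eqI) (simp add: coeff_bcp bc_bc)

lemma bcp_1 [simp]: "bcp 1 P = P" "bcp (Suc 0) P = P"
  by (rule poly_eqI, simp add: coeff_bcp)+

definition slice0 :: "complex fps poly \<Rightarrow> complex poly" where
  "slice0 = map_poly (\<lambda>a. a $ 0)"

lemma rhom_nth0: "rhom (\<lambda>a::'a::comm_ring_1 fps. a $ 0)"
  by (simp add: rhom_def)

lemma coeff_slice0 [simp]: "coeff (slice0 P) j = coeff P j $ 0"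
  by (simp add: slice0_def coeff_map_poly)

lemma rhom_slice0: "rhom slice0"
  unfolding slice0_def by (intro rhom_map_poly rhom_nth0)

lemma slice0_bcp [simp]: "n \<ge> 1 \<Longrightarrow> slice0 (bcp n P) = slice0 P"
  by (rule poly_eqI) (simp add: coeff_bcp)

lemma slice0_pcompose: "slice0 (pcompose P [:a, 1:]) = pcompose (slice0 P) [:a $ 0, 1:]"
  unfolding slice0_def by (simp add: map_poly_pcompose[OF rhom_nth0] map_poly_linear[OF rhom_nth0])

lemma bcp_pcompose: "n \<ge> 1 \<Longrightarrow> bcp n (pcompose P [:a, 1:]) = pcompose (bcp n P) [:bc n a, 1:]"
  unfolding bcp_def by (simp add: map_poly_pcompose[OF rhom_bc] map_poly_linear[OF rhom_bc] rhom_1[OF rhom_bc])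

lemma poly_at_small: "x $ 0 = 0 \<Longrightarrow> poly P x $ 0 = coeff P 0 $ 0" for P :: "complex fps poly"
  by (cases P) simp

text \<open>For \<open>p = slice0 P\<close> this order is the Weierstrass degree of
  \<open>P\<close>: the number of roots \<eta> with \<eta>(0) = 0 after base change, as
  \<open>puiseux_factorization\<close> shows.\<close>

definition ordm :: "complex poly \<Rightarrow> nat \<Rightarrow> bool" where
  "ordm p m \<longleftrightarrow> (\<forall>j<m. coeff p j = 0) \<and> coeff p m \<noteq> 0"

lemma poly_taylor2: "\<exists>r. poly P (x + h) = poly P x + h * poly (pderiv P) x + h\<^sup>2 * r" for P :: "'a::idom poly"
proof (induction P)
  case 0
  then show ?case by (intro exI[of _ 0]) simp
next
  case (pCons a P)
  then obtain r where r: "poly P (x + h) = poly P x + h * poly (pderiv P) x + h\<^sup>2 * r" by blast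
  show ?case
    by (rule exI[of _ "poly (pderiv P) x + (x + h) * r"])
      (simp only: r poly_pCons pderiv_pCons poly_add, simp add: algebra_simps power2_eq_square)
qed

lemma fps_X_power_dvd_iff: "fps_X ^ n dvd a \<longleftrightarrow> (\<forall>j<n. a $ j = 0)" for a :: "'a::comm_ring_1 fps"
proof
  assume a: "\<forall>j<n. a $ j = 0"
  have "a = fps_shift n a * fps_X ^ n"
    by (intro fps_ext) (simp add: a fps_X_power_mult_right_nth)
  then show "fps_X ^ n dvd a" by (rule dvdI[OF trans]) (simp add: mult.commute)
qed (auto elim!: dvdE simp: fps_X_power_mult_nth)

lemma fps_X_dvd_iff': "fps_X dvd a \<longleftrightarrow> a $ 0 = 0" for a :: "'a::comm_ring_1 fps"
  using fps_X_power_dvd_iff[of 1 a] by simp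

text \<open>Newton iteration, one power of s at a time: the correction c s^(n+1) is determined by a
  linear equation whose coefficient is the t-derivative at the origin, nonzero because the root at s
  = 0 is simple.\<close>

lemma hensel_root:
  assumes "ordm (slice0 P) 1"
  shows "\<exists>\<eta>. \<eta> $ 0 = 0 \<and> poly P \<eta> = 0"
proof -
  have c0: "coeff P 0 $ 0 = 0" and c1: "coeff P 1 $ 0 \<noteq> 0" using assms by (auto simp: ordm_def)
  define A where "A n x \<longleftrightarrow> x $ 0 = 0 \<and> fps_X ^ (n + 1) dvd poly P x" for n x
  define B where "B n x y \<longleftrightarrow> fps_X ^ (n + 1) dvd (y - x :: complex fps)" for n :: nat and x y
  have step: "\<exists>y. A (Suc n) y \<and> B n x y" if "A n x" for n x
  proof -
    from that obtain u where x0: "x $ 0 = 0" and u: "poly P x = fps_X ^ (n + 1) * u" by (auto simp: A_def)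
    define d where "d = poly (pderiv P) x"
    have d0: "d $ 0 \<noteq> 0" unfolding d_def using poly_at_small[OF x0] c1 by (simp add: coeff_pderiv)
    define c where "c = - (u $ 0) / d $ 0"
    define h where "h = fps_X ^ (n + 1) * fps_const c"
    obtain r where r: "poly P (x + h) = poly P x + h * d + h\<^sup>2 * r"
      using poly_taylor2[of P x h] unfolding d_def by blast
    define v where "v = u + fps_const c * d + fps_X ^ (n + 1) * (fps_const c)\<^sup>2 * r"
    have "poly P (x + h) = fps_X ^ (n + 1) * v"
      unfolding r u unfolding h_def v_def by (simp add: algebra_simps power2_eq_square)
    moreover have "v $ 0 = 0" using d0 by (simp add: v_def c_def)
    then have "fps_X dvd v" by (simp add: fps_X_dvd_iff')
    then have "fps_X ^ (n + 1) * fps_X dvd fps_X ^ (n + 1) * v" by (intro mult_dvd_mono) auto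
    ultimately have "fps_X ^ (Suc n + 1) dvd poly P (x + h)"
      by (simp add: mult_ac)
    then show ?thesis
      by (intro exI[of _ "x + h"]) (simp add: A_def B_def x0 h_def)
  qed
  have "A 0 0"
    using c0 by (simp add: A_def poly_0_coeff_0 fps_X_dvd_iff')
  then obtain f where f: "\<And>n. A n (f n)" "\<And>n. B n (f n) (f (Suc n))"
    using dependent_nat_choice[of A B] step by metis
  have st: "f (j + i) $ j = f j $ j" for i j
  proof (induction i)
    case (Suc i)
    have "fps_X ^ (j + i + 1) dvd f (Suc (j + i)) - f (j + i)" using f(2)[of "j + i"] by (simp add: B_def)
    then have "(f (Suc (j + i)) - f (j + i)) $ j = 0"
      unfolding fps_X_power_dvd_iff by simp
    then show ?case using Suc by simp
  qed simp
  \<comment> \<open>Diagonal limit: by \<open>st\<close>, the coefficient of s^j is constant from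
    the j-th approximation on.\<close>
  define \<eta> where "\<eta> = Abs_fps (\<lambda>j. f j $ j)"
  have cl: "fps_X ^ (n + 1) dvd \<eta> - f n" for n
  proof -
    have "(\<eta> - f n) $ j = 0" if "j < n + 1" for j
      using st[of j "n - j"] that by (simp add: \<eta>_def)
    then show ?thesis unfolding fps_X_power_dvd_iff by blast
  qed
  have dv: "fps_X ^ (n + 1) dvd poly P \<eta>" for n
  proof -
    obtain r where r: "poly P (f n + (\<eta> - f n)) = poly P (f n) + (\<eta> - f n) * poly (pderiv P) (f n) + (\<eta> - f n)\<^sup>2 * r"
      using poly_taylor2 by blast
    have "fps_X ^ (n + 1) dvd poly P (f n)" using f(1)[of n] by (simp add: A_def)
    then have "fps_X ^ (n + 1) dvd poly P (f n + (\<eta> - f n))"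
      unfolding r power2_eq_square using cl[of n] by (intro dvd_add dvd_mult2) auto
    then show ?thesis by simp
  qed
  have "poly P \<eta> = 0"
  proof (rule fps_ext)
    fix n show "poly P \<eta> $ n = 0 $ n"
      using dv[of n] unfolding fps_X_power_dvd_iff by simp
  qed
  moreover have "\<eta> $ 0 = 0" using f(1)[of 0] by (simp add: \<eta>_def A_def)
  ultimately show ?thesis by blast
qed

text \<open>A root w of full multiplicity would give p = c (t - w)^m. The vanishing coefficient
  below the top then forces w = 0, so p = c t^m, which contradicts the nonzero lower
  coefficient.\<close>

lemma complex_poly_root_multiplicity:
  fixes p :: "complex poly"
  assumes deg: "degree p = m" "m \<ge> 2" and z: "coeff p (m - 1) = 0" and nz: "j < m" "coeff p j \<noteq> 0"
  shows "\<exists>w. order w p \<ge> 1 \<and> order w p < m"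
proof -
  have p0: "p \<noteq> 0" using deg by auto
  have "\<not> constant (poly p)" using deg by (simp add: constant_degree)
  then obtain w where w: "poly p w = 0" using fundamental_theorem_of_algebra by blast
  have "order w p < m"
  proof (rule ccontr)
    assume "\<not> order w p < m"
    then have "[:- w, 1:] ^ m dvd p" using p0 by (auto simp: order_divides)
    then obtain q where q: "p = [:- w, 1:] ^ m * q" by auto
    have "degree p = m + degree q" using p0 q
      by (subst q, subst degree_mult_eq) (auto simp: degree_power_eq)
    then have "degree q = 0" using deg by simp
    then obtain c where "q = [:c:]" by (rule degree_eq_zeroE)
    then have p: "p = smult c ([:- w, 1:] ^ m)" using q by simp
    then have c: "c \<noteq> 0" using p0 by auto
    have pc: "coeff p i = c * (of_nat (m choose i) * (- w) ^ (m - i))" if "i \<le> m" for i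
      unfolding p using that by (simp add: coeff_linear_poly_power)
    have "m choose (m - 1) = m" using deg(2) binomial_symmetric[of 1 m] by simp
    then have "w = 0" using pc[of "m - 1"] z c deg(2) by auto
    then show False using pc[of j] nz by simp
  qed
  moreover have "order w p \<ge> 1" using w p0 by (metis order_root One_nat_def Suc_leI neq0_conv)
  ultimately show ?thesis by blast
qed

lemma pcompose_power: "pcompose (p ^ n) q = pcompose p q ^ n"
  by (induction n) (simp_all add: pcompose_mult pcompose_1)

lemma ordm_shift:
  fixes w :: complex
  assumes "p \<noteq> 0"
  shows "ordm (pcompose p [:w, 1:]) (order w p)"
proof -
  obtain q where q: "p = [:- w, 1:] ^ order w p * q" "\<not> [:- w, 1:] dvd q"
    using order_decomp[OF assms, of w] by blast
  have "pcompose p [:w, 1:] = monom 1 (order w p) * pcompose q [:w, 1:]"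
    by (subst q(1)) (simp add: pcompose_mult pcompose_power pcompose_pCons monom_altdef)
  moreover have "coeff (pcompose q [:w, 1:]) 0 \<noteq> 0"
    using q(2) by (simp add: poly_eq_0_iff_dvd)
  ultimately show ?thesis by (simp add: ordm_def coeff_monom_mult)
qed

lemma higher_pderiv_shift: "(pderiv ^^ k) (pcompose P [:a, 1:]) = pcompose ((pderiv ^^ k) P) [:a, 1:]"
  for P :: "'a::idom poly"
  by (induction k) (simp_all add: pderiv_pcompose pderiv_pCons)

lemma pochhammer_nat_fps: "pochhammer (of_nat (Suc n)) m = (of_nat (pochhammer (Suc n) m) :: 'a::comm_semiring_1)"
  using pochhammer_of_nat[of "Suc n" m, where 'a = 'a] by simp

text \<open>\<open>P\<close> may have degree larger than m and is not monic, so the shift is not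
  read off from two coefficients. Instead the (m-1)-st t-derivative has a simple root at the origin;
  Hensel lifts it, and translating by the lift kills the coefficient of t^(m-1).\<close>

lemma tschirnhaus:
  fixes P :: "complex fps poly"
  assumes "ordm (slice0 P) m" "m \<ge> 1"
  shows "\<exists>\<eta>. \<eta> $ 0 = 0 \<and> coeff (pcompose P [:\<eta>, 1:]) (m - 1) = 0"
proof -
  define D where "D = (pderiv ^^ (m - 1)) P"
  have cD: "coeff D j = of_nat (pochhammer (Suc j) (m - 1)) * coeff P (j + (m - 1))" for j
    unfolding D_def coeff_higher_pderiv pochhammer_nat_fps ..
  have "ordm (slice0 D) 1"
    using assms pochhammer_pos[of "2::nat" "m - 1"] by (auto simp: ordm_def cD numeral_2_eq_2)
  then obtain \<eta> where \<eta>: "\<eta> $ 0 = 0" "poly D \<eta> = 0" using hensel_root by blast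
  have "coeff ((pderiv ^^ (m - 1)) (pcompose P [:\<eta>, 1:])) 0 = 0"
    unfolding higher_pderiv_shift D_def[symmetric] using \<eta>(2) by simp
  then have "of_nat (pochhammer (Suc 0) (m - 1)) * coeff (pcompose P [:\<eta>, 1:]) (m - 1) = 0"
    unfolding coeff_higher_pderiv pochhammer_nat_fps by simp
  then have "coeff (pcompose P [:\<eta>, 1:]) (m - 1) = 0"
    using pochhammer_pos[of "1::nat" "m - 1"] by auto
  then show ?thesis using \<eta>(1) by blast
qed

text \<open>Substitute s \<mapsto> s^q, t \<mapsto> s^p t along an edge of the Newton polygon and
  divide by s^(p m). At s = 0 the result has degree exactly m, no term t^(m-1) and some lower term,
  so it has a root \<open>w\<close> of multiplicity less than m.\<close>

lemma newton_step:
  fixes Q :: "complex fps poly"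
  assumes Q: "ordm (slice0 Q) m" and m: "m \<ge> 2" and z: "coeff Q (m - 1) = 0" and nz: "coeff Q 0 \<noteq> 0"
  shows "\<exists>p q R w m'. p \<ge> 1 \<and> q \<ge> 1 \<and> 1 \<le> m' \<and> m' < m \<and> ordm (slice0 (pcompose R [:fps_const w, 1:])) m' \<and>
     smult (fps_X ^ (p * m)) R = pcompose (bcp q Q) [:0, fps_X ^ p:]"
proof -
  have Qlt: "coeff Q j $ 0 = 0" if "j < m" for j using Q that by (simp add: ordm_def)
  have Qm: "coeff Q m $ 0 \<noteq> 0" using Q by (simp add: ordm_def)
  define J where "J = {j. j < m \<and> coeff Q j \<noteq> 0}"
  have J: "finite J" "J \<noteq> {}" using nz m by (auto simp: J_def intro!: exI[of _ 0])
  \<comment> \<open>Slope of the segment joining (j, order of the j-th coefficient) to (m, 0). The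
    least slope belongs to the edge of the Newton polygon that ends at (m, 0); p/q need not be in
    lowest terms.\<close>
  define rt where "rt j = real (subdegree (coeff Q j)) / real (m - j)" for j
  obtain j1 where j1: "j1 \<in> J" "\<And>j. j \<in> J \<Longrightarrow> rt j1 \<le> rt j"
    using ex_min_if_finite[of "rt ` J"] J by (metis finite_imageI image_is_empty imageE imageI leI)
  define p where "p = subdegree (coeff Q j1)"
  define q where "q = m - j1"
  have q1: "q \<ge> 1" and j1m: "j1 < m" using j1 by (auto simp: q_def J_def)
  have p1: "p \<ge> 1"
    using Qlt[OF j1m] j1(1) unfolding p_def J_def
    by (metis (mono_tags) One_nat_def Suc_leI mem_Collect_eq neq0_conv nth_subdegree_nonzero)
  have ge: "subdegree (coeff Q j) * q \<ge> p * (m - j)" if "j \<in> J" for j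
  proof -
    have jm: "j < m" using that by (simp add: J_def)
    have "real p / real q \<le> real (subdegree (coeff Q j)) / real (m - j)"
      using j1(2)[OF that] by (simp add: rt_def p_def q_def)
    then have "real p * real (m - j) \<le> real (subdegree (coeff Q j)) * real q"
      using q1 jm by (simp add: field_simps)
    then show ?thesis by (metis of_nat_mult of_nat_le_iff)
  qed
  \<comment> \<open>For j < m the shift is an exact division, by \<open>ge\<close>. For j > m a
    positive power of s remains, so these terms disappear at s = 0 and the degree drops to
    m.\<close>
  define b where "b j = (if j < m then fps_shift (p * (m - j)) (bc q (coeff Q j)) else bc q (coeff Q j) * fps_X ^ (p * (j - m)))" for j
  define R where "R = (\<Sum>j\<le>degree Q. monom (b j) j)"
  have b0: "b j = 0" if "j > degree Q" for j
    using that by (simp add: b_def coeff_eq_0 rhom_0[OF rhom_bc[OF q1]])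
  have cR: "coeff R j = b j" for j
    using b0[of j] by (simp add: R_def coeff_sum)
  have bX: "fps_X ^ (p * m) * b j = fps_X ^ (p * j) * bc q (coeff Q j)" for j
  proof (cases "j < m")
    case True
    then have "p * m = p * j + p * (m - j)" by (metis add_mult_distrib2 le_add_diff_inverse less_imp_le)
    moreover have "fps_X ^ (p * (m - j)) * fps_shift (p * (m - j)) (bc q (coeff Q j)) = bc q (coeff Q j)"
    proof (cases "coeff Q j = 0")
      case False
      then have "j \<in> J" using True by (simp add: J_def)
      then have "p * (m - j) \<le> subdegree (bc q (coeff Q j))" using ge subdegree_bc[OF q1] by simp
      then show ?thesis by (metis fps_shift_times_fps_X_power mult.commute)
    qed (simp add: rhom_0[OF rhom_bc[OF q1]])
    ultimately show ?thesis using True by (simp add: b_def power_add mult.assoc)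
  next
    case False
    then have "p * m + p * (j - m) = p * j" by (metis add_mult_distrib2 le_add_diff_inverse not_less)
    then have "fps_X ^ (p * j) = fps_X ^ (p * m) * (fps_X ^ (p * (j - m)) :: complex fps)" by (metis power_add)
    then show ?thesis using False by (simp add: b_def mult_ac)
  qed
  have rel: "smult (fps_X ^ (p * m)) R = pcompose (bcp q Q) [:0, fps_X ^ p:]"
    by (rule poly_eqI) (simp add: cR bX coeff_pcompose_linear coeff_bcp[OF q1] flip: power_mult)
  define R0 where "R0 = slice0 R"
  have cR0: "coeff R0 j = b j $ 0" for j by (simp add: R0_def cR)
  have "coeff R0 j = 0" if "j > m" for j
    using that p1 by (simp add: cR0 b_def)
  moreover have R0m: "coeff R0 m \<noteq> 0" using Qm by (simp add: cR0 b_def)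
  ultimately have deg: "degree R0 = m" by (metis le_degree le_antisym degree_le)
  have z0: "coeff R0 (m - 1) = 0" using z m by (simp add: cR0 b_def rhom_0[OF rhom_bc[OF q1]])
  \<comment> \<open>At the index attaining the minimal slope the order after base change is exactly
    the amount shifted away, so this term survives at s = 0.\<close>
  have "bc q (coeff Q j1) \<noteq> 0" using j1(1) bc_eq_0_iff[OF q1] by (simp add: J_def)
  then have "bc q (coeff Q j1) $ subdegree (bc q (coeff Q j1)) \<noteq> 0" by (rule nth_subdegree_nonzero)
  then have "bc q (coeff Q j1) $ (p * q) \<noteq> 0" unfolding subdegree_bc[OF q1] p_def .
  then have nz1: "coeff R0 j1 \<noteq> 0" using j1m by (simp add: cR0 b_def q_def)
  obtain w where w: "order w R0 \<ge> 1" "order w R0 < m"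
    using complex_poly_root_multiplicity[OF deg m z0 j1m nz1] by blast
  have "ordm (slice0 (pcompose R [:fps_const w, 1:])) (order w R0)"
    unfolding slice0_pcompose R0_def[symmetric] using R0m ordm_shift[of R0 w] coeff_0[of m] by fastforce
  then show ?thesis using p1 q1 w rel by blast
qed

text \<open>Induction on m: after the Tschirnhaus shift either 0 is a root or
  \<open>newton_step\<close> leads to a smaller multiplicity.\<close>

lemma puiseux_root:
  fixes P :: "complex fps poly"
  assumes "ordm (slice0 P) m" "m \<ge> 1"
  shows "\<exists>n\<ge>1. \<exists>\<eta>. \<eta> $ 0 = 0 \<and> poly (bcp n P) \<eta> = 0"
  using assms
proof (induction m arbitrary: P rule: less_induct)
  case (less m)
  show ?case
  proof (cases "m = 1")
    case True
    then show ?thesis using hensel_root less.prems by (intro exI[of _ 1]) auto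
  next
    case False
    then have m: "m \<ge> 2" using less.prems by simp
    obtain \<eta>0 where \<eta>0: "\<eta>0 $ 0 = 0" and z: "coeff (pcompose P [:\<eta>0, 1:]) (m - 1) = 0"
      using tschirnhaus less.prems by blast
    define Q where "Q = pcompose P [:\<eta>0, 1:]"
    have Q: "ordm (slice0 Q) m" using less.prems by (simp add: Q_def slice0_pcompose \<eta>0)
    have bk: "poly (bcp n P) (bc n \<eta>0 + y) = poly (bcp n Q) y" if "n \<ge> 1" for n y
      unfolding Q_def using that by (simp add: bcp_pcompose poly_pcompose add.commute)
    show ?thesis
    proof (cases "coeff Q 0 = 0")
      case True
      then have "poly (bcp 1 Q) 0 = 0" by (simp add: poly_0_coeff_0)
      then have "poly (bcp 1 P) (bc 1 \<eta>0 + 0) = 0" using bk[of 1 0] by simp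
      then show ?thesis using \<eta>0 by (intro exI[of _ 1]) auto
    next
      case nz: False
      obtain p q R w m' where N: "p \<ge> 1" "q \<ge> 1" "1 \<le> m'" "m' < m" "ordm (slice0 (pcompose R [:fps_const w, 1:])) m'"
        "smult (fps_X ^ (p * m)) R = pcompose (bcp q Q) [:0, fps_X ^ p:]"
        using newton_step[OF Q m] z nz unfolding Q_def[symmetric] by blast
      obtain n \<eta> where n: "n \<ge> 1" "\<eta> $ 0 = 0" "poly (bcp n (pcompose R [:fps_const w, 1:])) \<eta> = 0"
        using less.IH[OF N(4,5,3)] by blast
      \<comment> \<open>Undoes the translation by \<open>w\<close> and the scaling t \<mapsto> s^p
        t; the further base change s \<mapsto> s^n turns s^p into s^(n p).\<close>
      define y where "y = fps_X ^ (n * p) * (fps_const w + \<eta>)"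
      have bX: "bc n (fps_X ^ p) = fps_X ^ (n * p)"
        by (simp add: rhom_power[OF rhom_bc[OF n(1)]] bc_X[OF n(1)] power_mult)
      have R0: "poly (bcp n R) (fps_const w + \<eta>) = 0"
        using n by (simp add: bcp_pcompose poly_pcompose add.commute)
      have "bcp n (smult (fps_X ^ (p * m)) R) = bcp n (pcompose (bcp q Q) [:0, fps_X ^ p:])"
        using N(6) by simp
      also have "bcp n (pcompose (bcp q Q) [:0, fps_X ^ p:]) = pcompose (bcp (q * n) Q) [:0, fps_X ^ (n * p):]"
        using bcp_bcp[OF N(2) n(1), of Q] unfolding bcp_def
        by (simp add: map_poly_pcompose[OF rhom_bc[OF n(1)]] map_poly_linear[OF rhom_bc[OF n(1)]] bX rhom_0[OF rhom_bc[OF n(1)]])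
      finally have "poly (bcp (q * n) Q) y = poly (bcp n (smult (fps_X ^ (p * m)) R)) (fps_const w + \<eta>)"
        by (simp add: poly_pcompose y_def mult.commute)
      also have "bcp n (smult (fps_X ^ (p * m)) R) = smult (bc n (fps_X ^ (p * m))) (bcp n R)"
        by (rule poly_eqI) (simp add: coeff_bcp[OF n(1)] rhom_mult[OF rhom_bc[OF n(1)]])
      finally have "poly (bcp (q * n) Q) y = 0" using R0 by simp
      then have "poly (bcp (q * n) P) (bc (q * n) \<eta>0 + y) = 0"
        using bk[of "q * n" y] N(2) n(1) by simp
      moreover have "(bc (q * n) \<eta>0 + y) $ 0 = 0" using \<eta>0 N(1) n by (simp add: y_def)
      moreover have "q * n \<ge> 1" using N(2) n(1) by simp
      ultimately show ?thesis by blast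
    qed
  qed
qed

text \<open>Roots are split off one by one. Each may require a further base change, so the exponents
  multiply and the earlier roots are transported by \<open>bc\<close>; what is left is a unit at the
  origin.\<close>

theorem puiseux_factorization:
  fixes P :: "complex fps poly"
  assumes "ordm (slice0 P) m"
  shows "\<exists>n\<ge>1. \<exists>\<eta>s U. length \<eta>s = m \<and> (\<forall>\<eta>\<in>set \<eta>s. \<eta> $ 0 = 0) \<and> coeff U 0 $ 0 \<noteq> 0 \<and>
    bcp n P = U * (\<Prod>\<eta>\<leftarrow>\<eta>s. [:- \<eta>, 1:])"
  using assms
proof (induction m arbitrary: P)
  case 0
  then show ?case by (intro exI[of _ 1] conjI exI[of _ "[]"] exI[of _ P]) (auto simp: ordm_def)
next
  case (Suc m)
  obtain n1 \<eta> where n1: "n1 \<ge> 1" "\<eta> $ 0 = 0" "poly (bcp n1 P) \<eta> = 0"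
    using puiseux_root[OF Suc.prems] by auto
  define P1 where "P1 = synthetic_div (bcp n1 P) \<eta>"
  have P1: "bcp n1 P = [:- \<eta>, 1:] * P1"
    using synthetic_div_correct'[of \<eta> "bcp n1 P"] n1(3) by (simp add: P1_def)
  have "slice0 P = slice0 (bcp n1 P)" using n1 by simp
  also have "\<dots> = slice0 [:- \<eta>, 1:] * slice0 P1" unfolding P1 by (rule rhom_mult[OF rhom_slice0])
  also have "slice0 [:- \<eta>, 1:] = [:0, 1:]"
    unfolding slice0_def using map_poly_linear[OF rhom_nth0, of "- \<eta>" 1] n1(2) by simp
  finally have "slice0 P = pCons 0 (slice0 P1)" by simp
  then have "ordm (slice0 P1) m" using Suc.prems by (auto simp: ordm_def coeff_pCons)
  then obtain n2 \<eta>s U where n2: "n2 \<ge> 1" "length \<eta>s = m" "\<forall>\<eta>\<in>set \<eta>s. \<eta> $ 0 = 0" "coeff U 0 $ 0 \<noteq> 0"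
    "bcp n2 P1 = U * (\<Prod>\<eta>\<leftarrow>\<eta>s. [:- \<eta>, 1:])" using Suc.IH by blast
  have "bcp (n1 * n2) P = bcp n2 (bcp n1 P)" using bcp_bcp n1(1) n2(1) by simp
  also have "\<dots> = bcp n2 [:- \<eta>, 1:] * bcp n2 P1" unfolding P1 by (rule rhom_mult[OF rhom_bcp[OF n2(1)]])
  also have "bcp n2 [:- \<eta>, 1:] = [:- bc n2 \<eta>, 1:]"
    unfolding bcp_def using map_poly_linear[OF rhom_bc[OF n2(1)], of "- \<eta>" 1]
    by (simp add: rhom_uminus[OF rhom_bc[OF n2(1)]] rhom_1[OF rhom_bc[OF n2(1)]])
  finally have "bcp (n1 * n2) P = U * (\<Prod>\<eta>\<leftarrow>bc n2 \<eta> # \<eta>s. [:- \<eta>, 1:])"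
    by (simp only: n2(5) list.map prod_list.Cons mult_ac)
  then show ?case using n1 n2
    by (intro exI[of _ "n1 * n2"] conjI exI[of _ "bc n2 \<eta> # \<eta>s"] exI[of _ U]) auto
qed

lemma deriv_poly_chain:
  "fps_deriv (poly A \<eta>) = poly (map_poly fps_deriv A) \<eta> + fps_deriv \<eta> * poly (pderiv A) \<eta>"
  for A :: "complex fps poly"
  by (induction A) (simp_all add: map_poly_pCons pderiv_pCons algebra_simps)

text \<open>Along a branch \<open>t = \<eta>(\<sigma>)\<close>, \<open>s = \<sigma>^n\<close> of the polar \<open>g_t = 0\<close>, the restriction \<open>\<phi>\<close> of \<open>g\<close> satisfies
  \<open>\<sigma> \<phi>' = n s g_s\<close>, so that \<open>s g_s\<close> and \<open>g + s g_s\<close> vanish there to the order of \<open>\<phi>\<close>.\<close>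

lemma ord_on_polar_branch:
  fixes g :: "complex fps poly"
  assumes n: "n \<ge> 1" and \<eta>: "\<eta> $ 0 = 0" and g0: "coeff g 0 $ 0 = 0"
    and polar: "poly (bcp n (pderiv g)) \<eta> = 0"
    and bez: "\<alpha> * g + \<beta> * pderiv g = [:r:]" "r \<noteq> 0"
  defines "u \<equiv> poly (bcp n (smult fps_X (map_poly fps_deriv g))) \<eta>"
    and "v \<equiv> poly (bcp n (g + smult fps_X (map_poly fps_deriv g))) \<eta>"
  shows "u \<noteq> 0" "v \<noteq> 0" "subdegree u = subdegree v"
proof -
  note hom = rhom_bcp[OF n] rhom_bc[OF n]
  define \<phi> where "\<phi> = poly (bcp n g) \<eta>"
  have \<phi>0: "\<phi> \<noteq> 0"
  proof
    assume "\<phi> = 0"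
    have "poly (bcp n [:r:]) \<eta> = 0"
      unfolding bez(1)[symmetric] using \<open>\<phi> = 0\<close> polar by (simp add: rhom_simps[OF hom(1)] \<phi>_def)
    then show False using bez(2) bc_eq_0_iff[OF n] by (simp add: bcp_def map_poly_pCons rhom_0[OF hom(2)])
  qed
  have "pderiv (bcp n g) = bcp n (pderiv g)"
    by (rule poly_eqI) (simp add: coeff_pderiv coeff_bcp[OF n] rhom_simps[OF hom(2)] rhom_of_nat[OF hom(2), of "Suc _", simplified])
  then have "fps_deriv \<phi> = poly (map_poly fps_deriv (bcp n g)) \<eta>"
    unfolding \<phi>_def deriv_poly_chain using polar by simp
  also have "map_poly fps_deriv (bcp n g) = smult (of_nat n * fps_X ^ (n - 1)) (bcp n (map_poly fps_deriv g))"
    by (rule poly_eqI) (simp add: coeff_bcp[OF n] coeff_map_poly bc_deriv[OF n] mult_ac)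
  finally have d: "fps_deriv \<phi> = of_nat n * fps_X ^ (n - 1) * poly (bcp n (map_poly fps_deriv g)) \<eta>"
    by simp
  have "bcp n (smult fps_X (map_poly fps_deriv g)) = smult (fps_X ^ n) (bcp n (map_poly fps_deriv g))"
    by (rule poly_eqI) (simp add: coeff_bcp[OF n] rhom_mult[OF hom(2)] bc_X[OF n])
  then have u: "u = fps_X ^ n * poly (bcp n (map_poly fps_deriv g)) \<eta>" by (simp add: u_def)
  have v: "v = \<phi> + u" unfolding v_def u_def \<phi>_def by (simp add: rhom_add[OF hom(1)])
  have "fps_X * fps_X ^ (n - 1) = (fps_X ^ n :: complex fps)" using n by (simp add: power_eq_if)
  then have "of_nat n * u = fps_X * fps_deriv \<phi>" unfolding u d by (metis mult.assoc mult.left_commute)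
  then have "(of_nat n * u) $ k = (fps_X * fps_deriv \<phi>) $ k" for k by simp
  then have uk: "of_nat n * u $ k = of_nat k * \<phi> $ k" for k
    by (cases k) (simp_all add: fps_deriv_nth)
  \<comment> \<open>The k-th coefficients of \<open>u\<close> and \<open>v\<close> are those of
    \<open>\<phi>\<close> times k/n and (n + k)/n. Both factors are nonzero for k \<ge> 1, and
    \<open>\<phi>\<close> has no constant term because g vanishes at the origin.\<close>
  have uk': "u $ k = of_nat k / of_nat n * \<phi> $ k" for k
    using uk[of k] n by (simp add: field_simps)
  have vk': "v $ k = of_nat (n + k) / of_nat n * \<phi> $ k" for k
    using n by (simp add: v uk' add_divide_distrib distrib_right)
  define k where "k = subdegree \<phi>"
  have "\<phi> $ 0 = 0" unfolding \<phi>_def using poly_at_small[OF \<eta>] g0 by (simp add: coeff_bcp[OF n])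
  then have k1: "k \<ge> 1" using \<phi>0 unfolding k_def by (metis One_nat_def Suc_leI neq0_conv nth_subdegree_nonzero)
  have \<phi>k: "\<phi> $ k \<noteq> 0" "\<And>j. j < k \<Longrightarrow> \<phi> $ j = 0" using \<phi>0 by (auto simp: k_def)
  have "u $ k \<noteq> 0" "v $ k \<noteq> 0" using \<phi>k(1) n k1 unfolding uk' vk' by (simp_all del: of_nat_add)
  moreover have "subdegree u = k" "subdegree v = k"
    using calculation \<phi>k(2) by (auto intro!: subdegreeI simp: uk' vk')
  ultimately show "u \<noteq> 0" "v \<noteq> 0" "subdegree u = subdegree v" by auto
qed

section \<open>Colengths in the power series ring\<close>

text \<open>The outer variable of \<open>complex fps fps\<close> is \<open>t\<close>, the inner one is \<open>s\<close>; the line is \<open>s = 0\<close>.\<close>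

type_synonym cps = "complex fps fps"

definition ec :: "complex \<Rightarrow> cps" where
  "ec c = fps_const (fps_const c)"

lemma rhom_ec: "rhom ec"
  by (simp add: rhom_def ec_def)

interpretation Ser: calg ec
  by unfold_locales (rule rhom_ec)

definition sv :: cps where "sv = fps_const fps_X"
definition tv :: cps where "tv = fps_X"

lemma rhom_fps_const: "rhom (fps_const :: 'a::comm_ring_1 \<Rightarrow> 'a fps)"
  by (simp add: rhom_def)

lemma cps_unit: assumes "F $ 0 $ 0 \<noteq> 0" shows "\<exists>G. F * G = (1::cps)"
proof -
  have "F $ 0 * inverse (F $ 0) = 1" using assms by (simp add: inverse_mult_eq_1')
  then show ?thesis using fps_right_inverse by blast
qed

text \<open>Restriction to the line s = 0, as a power series in t.\<close>

definition sl :: "cps \<Rightarrow> complex fps" where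
  "sl F = Abs_fps (\<lambda>j. F $ j $ 0)"

lemma sl_nth [simp]: "sl F $ j = F $ j $ 0"
  by (simp add: sl_def)

lemma rhom_sl: "rhom sl"
  unfolding rhom_def
proof (intro conjI allI)
  fix x y :: cps
  show "sl (x * y) = sl x * sl y" by (rule fps_ext) (simp add: fps_mult_nth fps_sum_nth)
qed (auto intro!: fps_ext)

lemma sl_sv [simp]: "sl sv = 0" and sl_tv [simp]: "sl tv = fps_X"
  by (auto intro!: fps_ext simp: sv_def tv_def fps_X_def)

lemma sv_dvd_iff: "sv dvd F \<longleftrightarrow> sl F = 0"
proof
  assume z: "sl F = 0"
  have "F = sv * Abs_fps (\<lambda>j. fps_shift 1 (F $ j))"
  proof (rule fps_ext)
    fix j
    have "F $ j $ 0 = 0" using z by (metis sl_nth fps_zero_nth)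
    then have "F $ j = fps_X * fps_shift 1 (F $ j)"
      by (intro fps_ext) (auto simp: fps_X_mult_nth)
    then show "F $ j = (sv * Abs_fps (\<lambda>j. fps_shift 1 (F $ j))) $ j" by (simp add: sv_def)
  qed
  then show "sv dvd F" by (rule dvdI)
next
  assume "sv dvd F"
  then show "sl F = 0" by (auto elim!: dvdE simp: rhom_mult[OF rhom_sl])
qed

lemma sv_nz [simp]: "sv \<noteq> 0"
  by (simp add: sv_def)

lemma sv_prime: "sl h \<noteq> 0 \<Longrightarrow> sv dvd h * x \<Longrightarrow> sv dvd x"
  by (simp add: sv_dvd_iff rhom_mult[OF rhom_sl])

lemma sv_power_prime: "sl h \<noteq> 0 \<Longrightarrow> sv ^ k dvd h * x \<Longrightarrow> sv ^ k dvd x"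
proof (induction k arbitrary: x)
  case (Suc k)
  have "sv dvd sv ^ Suc k" by simp
  then have "sv dvd h * x" using Suc.prems(2) by (rule dvd_trans)
  then have "sv dvd x" by (rule sv_prime[OF Suc.prems(1)])
  then obtain y where y: "x = sv * y" by (rule dvdE)
  obtain z where "h * x = sv ^ Suc k * z" using Suc.prems(2) by (rule dvdE)
  then have "sv * (h * y) = sv * (sv ^ k * z)" unfolding y by (simp add: mult_ac)
  then have "h * y = sv ^ k * z" by simp
  then have "sv ^ k dvd h * y" by simp
  then have "sv ^ k dvd y" by (rule Suc.IH[OF Suc.prems(1)])
  then show ?case unfolding y power_Suc by (rule mult_dvd_mono[OF dvd_refl])
qed simp

lemma fps_split: "F = (\<Sum>j<k. fps_const (F $ j) * fps_X ^ j) + fps_X ^ k * fps_shift k F"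
  for F :: "'a::comm_ring_1 fps"
proof (rule fps_ext)
  fix n
  have "(\<Sum>j<k. (fps_const (F $ j) * fps_X ^ j) $ n) = (\<Sum>j<k. if j = n then F $ n else 0)"
    by (intro sum.cong) auto
  then show "F $ n = ((\<Sum>j<k. fps_const (F $ j) * fps_X ^ j) + fps_X ^ k * fps_shift k F) $ n"
    by (simp add: fps_sum_nth fps_X_power_mult_nth)
qed

lemma sl_ec [simp]: "sl (ec c) = fps_const c"
  by (rule fps_ext) (simp add: ec_def)

lemma id2_sv_iff:
  assumes "sl F \<noteq> 0"
  shows "x \<in> id2 sv F \<longleftrightarrow> sl F dvd sl x"
proof
  assume "x \<in> id2 sv F"
  then show "sl F dvd sl x" by (auto simp: id2_def rhom_simps[OF rhom_sl])
next
  assume "sl F dvd sl x"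
  then obtain a where a: "sl x = sl F * a" by auto
  define A where "A = Abs_fps (\<lambda>j. fps_const (a $ j))"
  have "sl A = a" by (rule fps_ext) (simp add: A_def)
  then have "sl (x - F * A) = 0" using a by (simp add: rhom_simps[OF rhom_sl])
  then obtain y where "x - F * A = sv * y" unfolding sv_dvd_iff[symmetric] by (rule dvdE)
  then have "x = y * sv + A * F" by (simp add: algebra_simps)
  then show "x \<in> id2 sv F" by (rule id2I)
qed

lemma fps_unit_part:
  assumes "r \<noteq> (0 :: complex fps)"
  obtains r' where "r = fps_X ^ subdegree r * r'" "r' * inverse r' = 1"
proof -
  define r' where "r' = fps_shift (subdegree r) r"
  have "r = fps_X ^ subdegree r * r'" using subdegree_decompose[of r] by (simp add: r'_def mult.commute)
  moreover have "r' $ 0 \<noteq> 0" using assms by (simp add: r'_def)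
  then have "r' * inverse r' = 1" by (rule inverse_mult_eq_1')
  ultimately show thesis by (rule that)
qed

lemma subdegree_dvd:
  assumes "f \<noteq> 0" shows "f dvd (g :: complex fps) \<longleftrightarrow> fps_X ^ subdegree f dvd g"
proof -
  obtain r where r: "f = fps_X ^ subdegree f * r" "r * inverse r = 1" using fps_unit_part[OF assms] .
  have "fps_X ^ subdegree f = f * inverse r" using r by (metis mult.assoc mult.right_neutral)
  then have "f dvd fps_X ^ subdegree f" by (rule dvdI)
  moreover have "fps_X ^ subdegree f dvd f" using r(1) by (rule dvdI)
  ultimately show ?thesis using dvd_trans by blast
qed

text \<open>This is the intersection number with the line: modulo s the ring is C[[t]], and the
  powers of t below the order of F(0, t) are a basis.\<close>

lemma codim_sv:
  assumes "sl F \<noteq> 0"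
  shows "Ser.codim (id2 sv F) (subdegree (sl F))"
proof -
  define k where "k = subdegree (sl F)"
  have mem: "x \<in> id2 sv F \<longleftrightarrow> (\<forall>j<k. sl x $ j = 0)" for x
    unfolding id2_sv_iff[OF assms] subdegree_dvd[OF assms] fps_X_power_dvd_iff k_def ..
  have S: "sl (\<Sum>i<k. ec (c i) * tv ^ i) $ j = c j" if "j < k" for c j
  proof -
    have "sl (\<Sum>i<k. ec (c i) * tv ^ i) $ j = (\<Sum>i<k. if i = j then c j else 0)"
      unfolding rhom_simps[OF rhom_sl] sl_ec sl_tv fps_sum_nth by (intro sum.cong) auto
    then show ?thesis using that by simp
  qed
  have "Ser.ind (id2 sv F) k (\<lambda>i. tv ^ i)"
    unfolding Ser.ind_def mem using S by simp
  moreover have "Ser.spans (id2 sv F) k (\<lambda>i. tv ^ i)"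
    unfolding Ser.spans_def
  proof
    fix u
    have "u - (\<Sum>i<k. ec (sl u $ i) * tv ^ i) \<in> id2 sv F"
      unfolding mem rhom_diff[OF rhom_sl] fps_sub_nth using S[of _ "\<lambda>i. sl u $ i"] by simp
    then show "\<exists>c. u - (\<Sum>i<k. ec (c i) * tv ^ i) \<in> id2 sv F"
      by (rule exI[where x = "\<lambda>i. sl u $ i"])
  qed
  ultimately show ?thesis unfolding k_def Ser.codim_def by blast
qed

section \<open>Colength along a product of smooth branches\<close>

abbreviation emb :: "complex fps poly \<Rightarrow> cps" where "emb \<equiv> fps_of_poly"

lemma rhom_emb: "rhom emb"
  by (simp add: rhom_def fps_of_poly_add fps_of_poly_mult)

lemma emb_linear: "emb [:- \<eta>, 1:] = tv - fps_const \<eta>"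
  by (rule fps_ext) (simp add: tv_def fps_X_def coeff_pCons split: nat.split)

lemma power_sub_in_ideal: "ideal W \<Longrightarrow> x - y \<in> W \<Longrightarrow> x ^ j - y ^ j \<in> W"
proof (induction j)
  case (Suc j)
  have "x ^ Suc j - y ^ Suc j = x * (x ^ j - y ^ j) + y ^ j * (x - y)" by (simp add: algebra_simps)
  then show ?case using Suc by (auto intro: ideal_add ideal_mult)
qed (simp add: ideal_0)

text \<open>Setting t = \<eta>(s) identifies the quotient by t - \<eta> with C[[s]], so the powers
  of s below the order of \<open>r\<close> are a basis. Since t^k and s^k lie in the ideal, finite
  sums replace the substitution.\<close>

lemma codim_branch:
  assumes \<eta>: "\<eta> $ 0 = 0" and r: "r \<noteq> 0"
  shows "Ser.codim (id2 (fps_const r) (emb [:- \<eta>, 1:])) (subdegree r)"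
proof -
  define k where "k = subdegree r"
  define h where "h = emb [:- \<eta>, 1:]"
  define W where "W = id2 (fps_const r) h"
  have W: "ideal W" unfolding W_def by (rule ideal_id2)
  obtain r' where r': "r = fps_X ^ k * r'" "r' * inverse r' = 1"
    using fps_unit_part[OF r] unfolding k_def .
  have h: "h = tv - fps_const \<eta>" unfolding h_def emb_linear ..
  have "fps_const r * fps_const (inverse r') \<in> W"
    unfolding W_def by (intro ideal_mult2 ideal_id2 id2_gen)
  also have "fps_const r * fps_const (inverse r') = sv ^ k"
  proof -
    have "r * inverse r' = fps_X ^ k" using r' by (metis mult.assoc mult.right_neutral)
    then show ?thesis unfolding sv_def by (simp only: fps_const_power fps_const_mult)
  qed
  finally have sk: "sv ^ k \<in> W" .
  have S1: "fps_const a \<in> W" if d: "fps_X ^ k dvd a" for a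
  proof -
    obtain b where "a = fps_X ^ k * b" using d by (rule dvdE)
    then have "fps_const a = sv ^ k * fps_const b" unfolding sv_def by (simp only: fps_const_power fps_const_mult)
    then show ?thesis using ideal_mult2[OF W sk] by simp
  qed
  have S2: "tv ^ j - fps_const (\<eta> ^ j) \<in> W" for j
  proof -
    have "tv - fps_const \<eta> \<in> W" unfolding W_def h[symmetric] by (rule id2_gen)
    from power_sub_in_ideal[OF W this, of j] show ?thesis by simp
  qed
  have "fps_X dvd \<eta>" using \<eta> by (simp add: fps_X_dvd_iff')
  then have dk: "fps_X ^ k dvd \<eta> ^ k" by (rule dvd_power_same)
  have S3: "tv ^ k \<in> W" using ideal_add[OF W S2[of k] S1[OF dk]] by simp
  have S4: "F - fps_const (\<Sum>j<k. F $ j * \<eta> ^ j) \<in> W" for F :: cps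
  proof -
    have "F - fps_const (\<Sum>j<k. F $ j * \<eta> ^ j) = (\<Sum>j<k. fps_const (F $ j) * (tv ^ j - fps_const (\<eta> ^ j))) + tv ^ k * fps_shift k F"
      by (subst fps_split[of F k]) (simp add: rhom_sum[OF rhom_fps_const] right_diff_distrib sum_subtractf tv_def)
    also have "\<dots> \<in> W" by (intro ideal_add ideal_sum ideal_mult S2 W ideal_mult2 S3)
    finally show ?thesis .
  qed
  have sp: "fps_const (\<Sum>i<k. fps_const (c i) * fps_X ^ i) = (\<Sum>i<k. ec (c i) * sv ^ i)" for c :: "nat \<Rightarrow> complex"
    by (simp only: rhom_sum[OF rhom_fps_const] sv_def ec_def fps_const_power fps_const_mult)
  have "Ser.spans W k (\<lambda>i. sv ^ i)"
    unfolding Ser.spans_def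
  proof
    fix F
    define a where "a = (\<Sum>j<k. F $ j * \<eta> ^ j)"
    have "fps_const (a - (\<Sum>i<k. fps_const (a $ i) * fps_X ^ i)) \<in> W"
    proof (rule S1)
      have "a - (\<Sum>i<k. fps_const (a $ i) * fps_X ^ i) = fps_X ^ k * fps_shift k a"
        using fps_split[of a k] by (simp add: algebra_simps)
      then show "fps_X ^ k dvd a - (\<Sum>i<k. fps_const (a $ i) * fps_X ^ i)" by simp
    qed
    then have "fps_const a - (\<Sum>i<k. ec (a $ i) * sv ^ i) \<in> W"
      by (simp only: rhom_diff[OF rhom_fps_const] sp)
    from ideal_add[OF W S4[of F] this] have "F - (\<Sum>i<k. ec (a $ i) * sv ^ i) \<in> W"
      by (simp add: a_def)
    then show "\<exists>c. F - (\<Sum>i<k. ec (c i) * sv ^ i) \<in> W" by (rule exI[where x = "\<lambda>i. a $ i"])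
  qed
  moreover have "Ser.ind W k (\<lambda>i. sv ^ i)"
    unfolding Ser.ind_def
  proof (intro allI impI)
    fix c :: "nat \<Rightarrow> complex" and i
    assume c: "(\<Sum>i<k. ec (c i) * sv ^ i) \<in> W" and i: "i < k"
    define \<rho> where "\<rho> = (\<Sum>i<k. fps_const (c i) * (fps_X::complex fps) ^ i)"
    have "fps_const \<rho> \<in> W" using c by (simp add: \<rho>_def sp)
    then obtain \<alpha> \<beta> where ab: "fps_const \<rho> = \<alpha> * fps_const r + \<beta> * h" unfolding W_def id2_def by blast
    \<comment> \<open>\<open>Z\<close> is (t^k - \<eta>^k)/(t - \<eta>). Multiplying by it and
      comparing coefficients of t^(k-1) recovers \<rho> modulo s^k, which stands in for evaluation
      at t = \<eta>.\<close>
    define Z where "Z = (\<Sum>i<k. fps_const (\<eta> ^ (k - Suc i)) * tv ^ i)"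
    have "tv ^ k - fps_const \<eta> ^ k = h * Z"
      unfolding h Z_def by (subst power_diff_sumr2) simp
    then have "fps_const \<rho> * Z = \<alpha> * Z * fps_const r + \<beta> * (tv ^ k - fps_const (\<eta> ^ k))"
      unfolding ab by (simp add: algebra_simps)
    then have "(fps_const \<rho> * Z) $ (k - 1) = (\<alpha> * Z * fps_const r + \<beta> * (tv ^ k - fps_const (\<eta> ^ k))) $ (k - 1)"
      by simp
    moreover have "Z $ (k - 1) = 1"
    proof -
      have "Z $ (k - 1) = (\<Sum>i<k. if i = k - 1 then 1 else 0)"
        unfolding Z_def fps_sum_nth by (intro sum.cong) (auto simp: tv_def)
      then show ?thesis using i by simp
    qed
    moreover have "(\<beta> * (tv ^ k - fps_const (\<eta> ^ k))) $ (k - 1) = - (\<beta> $ (k - 1) * \<eta> ^ k)"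
      using i by (simp add: right_diff_distrib tv_def fps_X_power_mult_right_nth)
    ultimately have "\<rho> = (\<alpha> * Z) $ (k - 1) * r - \<beta> $ (k - 1) * \<eta> ^ k" by simp
    moreover have "fps_X ^ k dvd r" using r'(1) by simp
    ultimately have "fps_X ^ k dvd \<rho>" using dk by (simp add: dvd_diff)
    then have "\<rho> $ i = 0" using i by (simp add: fps_X_power_dvd_iff)
    moreover have "\<rho> $ i = (\<Sum>j<k. if j = i then c i else 0)"
      unfolding \<rho>_def fps_sum_nth by (intro sum.cong) auto
    ultimately show "c i = 0" using i by simp
  qed
  ultimately show ?thesis unfolding Ser.codim_def W_def h_def k_def by blast
qed

text \<open>Write P = c + h q with c = P(\<eta>). If h w lies in (P, h h'), then h times something
  equals \<alpha> c. Up to a unit c is a power of s, which is prime to h, so h divides \<alpha> and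
  can be cancelled.\<close>

lemma colon_branch:
  fixes P :: "complex fps poly"
  assumes \<eta>: "\<eta> $ 0 = 0" and r: "poly P \<eta> \<noteq> 0"
  defines "h \<equiv> emb [:- \<eta>, 1:]"
  shows "colon (id2 (emb P) (h * h')) h = id2 (emb P) h'"
    and "iplus (id2 (emb P) (h * h')) h = id2 (fps_const (poly P \<eta>)) h"
proof -
  define q where "q = emb (synthetic_div P \<eta>)"
  define c where "c = poly P \<eta>"
  have u: "emb P = fps_const c + h * q"
    unfolding h_def q_def c_def fps_of_poly_const[symmetric] fps_of_poly_mult[symmetric] fps_of_poly_add[symmetric]
    using synthetic_div_correct'[of \<eta> P] by (simp add: add.commute)
  have h: "h = tv - fps_const \<eta>" unfolding h_def emb_linear ..
  have slh: "sl h \<noteq> 0"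
  proof -
    have "sl h $ 1 = 1" by (simp add: h tv_def)
    then show ?thesis by (metis fps_zero_nth zero_neq_one)
  qed
  then have hnz: "h \<noteq> 0" using rhom_0[OF rhom_sl] by metis
  obtain c' where c': "c = fps_X ^ subdegree c * c'" "c' * inverse c' = 1"
    using fps_unit_part[of c] r unfolding c_def by blast
  define k where "k = subdegree c"
  show "colon (id2 (emb P) (h * h')) h = id2 (emb P) h'"
  proof (intro set_eqI iffI)
    fix w assume "w \<in> id2 (emb P) h'"
    then obtain \<alpha> \<beta> where "w = \<alpha> * emb P + \<beta> * h'" unfolding id2_def by blast
    then have "h * w = (h * \<alpha>) * emb P + \<beta> * (h * h')" by (simp add: algebra_simps)
    then show "w \<in> colon (id2 (emb P) (h * h')) h" unfolding colon_def by (auto intro: id2I)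
  next
    fix w assume "w \<in> colon (id2 (emb P) (h * h')) h"
    then obtain \<alpha> \<beta> where ab: "h * w = \<alpha> * emb P + \<beta> * (h * h')" unfolding colon_def id2_def by blast
    have 1: "h * (w - \<beta> * h' - \<alpha> * q) = \<alpha> * fps_const c"
      using ab unfolding u by (simp add: algebra_simps)
    have c2: "fps_const c = sv ^ k * fps_const c'"
      using c'(1) unfolding sv_def k_def by (simp only: fps_const_power fps_const_mult)
    have "sv ^ k dvd h * (w - \<beta> * h' - \<alpha> * q)" unfolding 1 c2 by simp
    then have "sv ^ k dvd w - \<beta> * h' - \<alpha> * q" by (rule sv_power_prime[OF slh])
    then obtain \<gamma> where "w - \<beta> * h' - \<alpha> * q = sv ^ k * \<gamma>" by (rule dvdE)
    then have "sv ^ k * (h * \<gamma>) = sv ^ k * (\<alpha> * fps_const c')" using 1 c2 by (simp add: mult_ac)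
    then have "h * \<gamma> = \<alpha> * fps_const c'" by simp
    then have "h * \<gamma> * fps_const (inverse c') = \<alpha> * fps_const (c' * inverse c')"
      by (simp only: fps_const_mult[symmetric] mult.assoc)
    then have "\<alpha> = h * \<gamma> * fps_const (inverse c')" using c'(2) by simp
    then have "h * w = h * ((\<gamma> * fps_const (inverse c')) * emb P + \<beta> * h')"
      using ab by (simp add: algebra_simps)
    then have "w = (\<gamma> * fps_const (inverse c')) * emb P + \<beta> * h'" using hnz by simp
    then show "w \<in> id2 (emb P) h'" by (rule id2I)
  qed
  show "iplus (id2 (emb P) (h * h')) h = id2 (fps_const (poly P \<eta>)) h"
    unfolding c_def[symmetric]
  proof (intro set_eqI iffI)
    fix w assume "w \<in> iplus (id2 (emb P) (h * h')) h"
    then obtain x \<alpha> \<beta> where "w - h * x = \<alpha> * emb P + \<beta> * (h * h')" unfolding iplus_def id2_def by blast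
    then have "w = \<alpha> * fps_const c + (x + \<alpha> * q + \<beta> * h') * h" unfolding u by (simp add: algebra_simps)
    then show "w \<in> id2 (fps_const c) h" by (rule id2I)
  next
    fix w assume "w \<in> id2 (fps_const c) h"
    then obtain \<alpha> \<beta> where "w = \<alpha> * fps_const c + \<beta> * h" unfolding id2_def by blast
    then have "w - h * (\<beta> - \<alpha> * q) = \<alpha> * emb P + 0 * (h * h')" unfolding u by (simp add: algebra_simps)
    then show "w \<in> iplus (id2 (emb P) (h * h')) h" unfolding iplus_def using id2I by blast
  qed
qed

text \<open>Colength is additive over the factors: by \<open>colon_branch\<close> each factor t -
  \<eta> splits off a quotient of colength the order of P(\<eta>), and the unit \<open>U\<close>
  contributes nothing.\<close>

lemma codim_branches:
  fixes P :: "complex fps poly"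
  assumes "\<And>\<eta>. \<eta> \<in> set \<eta>s \<Longrightarrow> \<eta> $ 0 = 0 \<and> poly P \<eta> \<noteq> 0" "coeff U 0 $ 0 \<noteq> 0"
  shows "Ser.codim (id2 (emb P) (emb (U * (\<Prod>\<eta>\<leftarrow>\<eta>s. [:- \<eta>, 1:])))) (\<Sum>\<eta>\<leftarrow>\<eta>s. subdegree (poly P \<eta>))"
  using assms
proof (induction \<eta>s)
  case Nil
  obtain G where G: "emb U * G = 1" using cps_unit[of "emb U"] assms(2) by auto
  have "w \<in> id2 (emb P) (emb U)" for w
    using G by (intro id2I[of _ 0 _ "w * G"]) (simp add: mult_ac)
  then have "id2 (emb P) (emb U) = UNIV" by blast
  then show ?case using Ser.codim_UNIV by simp
next
  case (Cons \<eta> \<eta>s)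
  let ?h = "emb [:- \<eta>, 1:]" and ?h' = "emb (U * (\<Prod>\<eta>\<leftarrow>\<eta>s. [:- \<eta>, 1:]))"
  have e: "emb (U * (\<Prod>\<eta>\<leftarrow>\<eta> # \<eta>s. [:- \<eta>, 1:])) = ?h * ?h'"
    unfolding fps_of_poly_mult[symmetric] by (simp only: list.map prod_list.Cons mult_ac)
  have \<eta>: "\<eta> $ 0 = 0" "poly P \<eta> \<noteq> 0" using Cons.prems by auto
  have "Ser.codim (id2 (emb P) (?h * ?h')) ((\<Sum>\<eta>\<leftarrow>\<eta>s. subdegree (poly P \<eta>)) + subdegree (poly P \<eta>))"
  proof (rule Ser.codim_colon[OF ideal_id2, where c = ?h])
    show "Ser.codim (colon (id2 (emb P) (?h * ?h')) ?h) (\<Sum>\<eta>\<leftarrow>\<eta>s. subdegree (poly P \<eta>))"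
      unfolding colon_branch[OF \<eta>] using Cons by simp
    show "Ser.codim (iplus (id2 (emb P) (?h * ?h')) ?h) (subdegree (poly P \<eta>))"
      unfolding colon_branch[OF \<eta>] by (rule codim_branch[OF \<eta>])
  qed
  then show ?case unfolding e by (simp only: list.map sum_list.Cons add.commute)
qed

section \<open>Base change of colengths under s \<mapsto> s^n\<close>

definition iota :: "nat \<Rightarrow> cps \<Rightarrow> cps" where
  "iota n F = Abs_fps (\<lambda>j. bc n (F $ j))"

text \<open>The ring is free over the series in s^n with basis 1, s, ..., s^(n-1);
  \<open>part n r\<close> is the r-th coordinate.\<close>

definition part :: "nat \<Rightarrow> nat \<Rightarrow> cps \<Rightarrow> cps" where
  "part n r F = Abs_fps (\<lambda>j. Abs_fps (\<lambda>k. F $ j $ (n * k + r)))"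

lemma iota_nth [simp]: "iota n F $ j = bc n (F $ j)"
  by (simp add: iota_def)

lemma part_nth [simp]: "part n r F $ j $ k = F $ j $ (n * k + r)"
  by (simp add: part_def)

lemma rhom_iota: assumes "n \<ge> 1" shows "rhom (iota n)"
  unfolding rhom_def
proof (intro conjI allI)
  note b = rhom_bc[OF assms]
  show "iota n 1 = 1" by (rule fps_ext) (simp add: rhom_simps[OF b])
  show "iota n (x + y) = iota n x + iota n y" for x y
    by (rule fps_ext) (simp add: rhom_simps[OF b])
  show "iota n (x * y) = iota n x * iota n y" for x y
    by (rule fps_ext) (simp add: rhom_simps[OF b] fps_mult_nth)
qed

lemma bc_nth: assumes "n \<ge> 1" shows "bc n a $ k = (if n dvd k then a $ (k div n) else 0)"
proof -
  have "bc n a $ k = (\<Sum>i=0..k. a $ i * ((fps_X ^ (n * i)) $ k))"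
    by (simp add: bc_def fps_compose_nth power_mult)
  also have "\<dots> = (\<Sum>i=0..k. if i = k div n \<and> n dvd k then a $ (k div n) else 0)"
    using assms by (intro sum.cong) auto
  also have "\<dots> = (if n dvd k then a $ (k div n) else 0)"
    by (auto simp: sum.delta)
  finally show ?thesis .
qed

lemma sv_power_iota_nth:
  assumes "r < n"
  shows "(sv ^ r * iota n H) $ j $ k = (if k mod n = r then H $ j $ (k div n) else 0)"
proof -
  have n: "n \<ge> 1" using assms by simp
  have "sv ^ r = fps_const (fps_X ^ r)" by (simp add: sv_def)
  then have "(sv ^ r * iota n H) $ j $ k = (fps_X ^ r * bc n (H $ j)) $ k" by simp
  also have "\<dots> = (if k < r then 0 else if n dvd (k - r) then H $ j $ ((k - r) div n) else 0)"
    by (simp add: fps_X_power_mult_nth bc_nth[OF n])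
  also have "\<dots> = (if k mod n = r then H $ j $ (k div n) else 0)"
  proof (cases "k mod n = r")
    case True
    then have k: "k = k div n * n + r" by (metis div_mult_mod_eq)
    then have "k - r = k div n * n" by (metis add_diff_cancel_right')
    moreover have "\<not> k < r" using k by (metis le_add2 not_le)
    ultimately show ?thesis using True n by simp
  next
    case False
    have "\<not> n dvd (k - r)" if "r \<le> k"
    proof
      assume "n dvd k - r"
      then obtain q where "k - r = n * q" by (rule dvdE)
      then have "k = n * q + r" using that by simp
      then show False using False assms by simp
    qed
    then show ?thesis using False by auto
  qed
  finally show ?thesis .
qed

lemma iota_decomp: assumes "n \<ge> 1" shows "F = (\<Sum>r<n. sv ^ r * iota n (part n r F))"
proof (rule fps_ext, rule fps_ext)
  fix j k
  have "(\<Sum>r<n. sv ^ r * iota n (part n r F)) $ j $ k = (\<Sum>r<n. if r = k mod n then F $ j $ (n * (k div n) + k mod n) else 0)"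
    unfolding fps_sum_nth by (intro sum.cong) (auto simp: sv_power_iota_nth simp del: mult_div_mod_eq)
  then show "F $ j $ k = (\<Sum>r<n. sv ^ r * iota n (part n r F)) $ j $ k"
    using assms by simp
qed

lemma part_sum: assumes "r < n" shows "part n r (\<Sum>q<n. sv ^ q * iota n (H q)) = H r"
proof (rule fps_ext, rule fps_ext)
  fix j k
  have "(\<Sum>q<n. sv ^ q * iota n (H q)) $ j $ (n * k + r) = (\<Sum>q<n. if q = r then H r $ j $ k else 0)"
    unfolding fps_sum_nth using assms by (intro sum.cong) (auto simp: sv_power_iota_nth)
  then show "part n r (\<Sum>q<n. sv ^ q * iota n (H q)) $ j $ k = H r $ j $ k"
    using assms by simp
qed

text \<open>By freeness, an ideal generated over the subring extends to the direct sum of n copies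
  of itself, one for each coordinate.\<close>

lemma id2_iota_iff:
  assumes n: "n \<ge> 1"
  shows "F \<in> id2 (iota n a) (iota n b) \<longleftrightarrow> (\<forall>r<n. part n r F \<in> id2 a b)"
proof
  note h = rhom_iota[OF n]
  assume "F \<in> id2 (iota n a) (iota n b)"
  then obtain \<alpha> \<beta> where F: "F = \<alpha> * iota n a + \<beta> * iota n b" unfolding id2_def by blast
  have "F = (\<Sum>r<n. sv ^ r * iota n (part n r \<alpha>)) * iota n a + (\<Sum>r<n. sv ^ r * iota n (part n r \<beta>)) * iota n b"
    unfolding F using iota_decomp[OF n, of \<alpha>] iota_decomp[OF n, of \<beta>] by simp
  also have "\<dots> = (\<Sum>r<n. sv ^ r * iota n (part n r \<alpha> * a + part n r \<beta> * b))"
    by (simp only: rhom_add[OF h] rhom_mult[OF h] sum_distrib_right sum.distrib distrib_left mult.assoc)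
  finally have F': "F = (\<Sum>r<n. sv ^ r * iota n (part n r \<alpha> * a + part n r \<beta> * b))" .
  have "part n r F = part n r \<alpha> * a + part n r \<beta> * b" if "r < n" for r
    by (subst F') (rule part_sum[OF that])
  then show "\<forall>r<n. part n r F \<in> id2 a b" by (blast intro: id2I)
next
  note h = rhom_iota[OF n]
  assume p: "\<forall>r<n. part n r F \<in> id2 a b"
  have "iota n x \<in> id2 (iota n a) (iota n b)" if x: "x \<in> id2 a b" for x
  proof -
    from x obtain \<alpha> \<beta> where "x = \<alpha> * a + \<beta> * b" unfolding id2_def by blast
    then have "iota n x = iota n \<alpha> * iota n a + iota n \<beta> * iota n b" by (simp only: rhom_add[OF h] rhom_mult[OF h])
    then show ?thesis by (rule id2I)
  qed
  then have "(\<Sum>r<n. sv ^ r * iota n (part n r F)) \<in> id2 (iota n a) (iota n b)"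
    using p by (intro ideal_sum ideal_mult ideal_id2) auto
  then show "F \<in> id2 (iota n a) (iota n b)" using iota_decomp[OF n, of F] by simp
qed

lemma sum_lessThan_times:
  fixes n k :: nat
  shows "(\<Sum>j<n * k. f j) = (\<Sum>r<n. \<Sum>i<k. (f (r * k + i) :: 'a::comm_monoid_add))"
proof (induction n)
  case (Suc n)
  have s: "(\<Sum>i<a + (b::nat). f i) = (\<Sum>i<a. f i) + (\<Sum>i<b. f (a + i))" for a b
    by (induction b) (simp_all add: add_ac)
  have "(\<Sum>j<Suc n * k. f j) = (\<Sum>j<n * k + k. f j)" by (simp add: add.commute)
  then show ?case using Suc s by simp
qed simp

text \<open>The quotient after base change is n copies of the original one, with basis s^r times a
  basis below. Finiteness descends because \<open>iota\<close> preserves independence.\<close>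

lemma codim_base_change:
  assumes n: "n \<ge> 1" and N: "Ser.codim (id2 (iota n a) (iota n b)) N"
  shows "\<exists>k. Ser.codim (id2 a b) k \<and> N = n * k"
proof -
  note h = rhom_iota[OF n]
  let ?W = "id2 a b" and ?W' = "id2 (iota n a) (iota n b)"
  have iec: "iota n (ec c) = ec c" for c
  proof (rule fps_ext)
    fix j show "iota n (ec c) $ j = ec c $ j"
      by (cases j) (simp_all add: ec_def rhom_0[OF rhom_bc[OF n]])
  qed
  have pint: "part n 0 (iota n x) = x" for x
    using n by (intro fps_ext) (simp add: bc_nth[OF n])
  have bd: "k \<le> N" if p: "Ser.ind ?W k p" for k p
  proof -
    have "Ser.ind ?W' k (\<lambda>i. iota n (p i))"
      unfolding Ser.ind_def
    proof (intro allI impI)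
      fix c i assume "(\<Sum>i<k. ec (c i) * iota n (p i)) \<in> ?W'" and i: "i < k"
      then have "iota n (\<Sum>i<k. ec (c i) * p i) \<in> ?W'"
        by (simp only: rhom_sum[OF h] rhom_mult[OF h] iec)
      then have "(\<Sum>i<k. ec (c i) * p i) \<in> ?W"
        unfolding id2_iota_iff[OF n] using n pint[of "\<Sum>i<k. ec (c i) * p i"] by force
      then show "c i = 0" using p i unfolding Ser.ind_def by blast
    qed
    moreover obtain d where "Ser.spans ?W' N d" using N unfolding Ser.codim_def by blast
    ultimately show "k \<le> N" by (rule Ser.ind_le_spans[OF ideal_id2, rotated])
  qed
  obtain k where k: "Ser.codim ?W k" using Ser.codim_of_bounded[OF ideal_id2, of a b N] bd by blast
  then obtain d where d: "Ser.ind ?W k d" "Ser.spans ?W k d" unfolding Ser.codim_def by blast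
  define f where "f j = sv ^ (j div k) * iota n (d (j mod k))" for j
  have S: "(\<Sum>j<n * k. ec (c j) * f j) = (\<Sum>r<n. sv ^ r * iota n (\<Sum>i<k. ec (c (r * k + i)) * d i))" for c
    unfolding sum_lessThan_times
  proof (rule sum.cong[OF refl])
    fix r
    have "(\<Sum>i<k. ec (c (r * k + i)) * f (r * k + i)) = (\<Sum>i<k. sv ^ r * (ec (c (r * k + i)) * iota n (d i)))"
      by (rule sum.cong) (auto simp: f_def mult_ac)
    then show "(\<Sum>i<k. ec (c (r * k + i)) * f (r * k + i)) = sv ^ r * iota n (\<Sum>i<k. ec (c (r * k + i)) * d i)"
      by (simp only: rhom_sum[OF h] rhom_mult[OF h] iec sum_distrib_left)
  qed
  have "Ser.ind ?W' (n * k) f"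
    unfolding Ser.ind_def
  proof (intro allI impI)
    fix c j assume "(\<Sum>j<n * k. ec (c j) * f j) \<in> ?W'" and j: "j < n * k"
    then have N1: "(\<Sum>i<k. ec (c (r * k + i)) * d i) \<in> ?W" if "r < n" for r
      unfolding S id2_iota_iff[OF n] using part_sum[OF that, of "\<lambda>r. \<Sum>i<k. ec (c (r * k + i)) * d i"] that by force
    have kp: "k > 0" using j by (cases k) auto
    have "j div k < n" using j by (simp add: less_mult_imp_div_less)
    from N1[OF this] have "c (j div k * k + j mod k) = 0"
      using d(1)[unfolded Ser.ind_def, rule_format, of "\<lambda>i. c (j div k * k + i)" "j mod k"] kp by simp
    then show "c j = 0" by simp
  qed
  moreover have "Ser.spans ?W' (n * k) f"
    unfolding Ser.spans_def
  proof
    fix F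
    have "\<forall>r. \<exists>c. part n r F - (\<Sum>i<k. ec (c i) * d i) \<in> ?W" using d(2) unfolding Ser.spans_def by blast
    then obtain c where c: "\<And>r. part n r F - (\<Sum>i<k. ec (c r i) * d i) \<in> ?W" by metis
    define x where "x j = c (j div k) (j mod k)" for j
    have e: "(\<Sum>i<k. ec (x (r * k + i)) * d i) = (\<Sum>i<k. ec (c r i) * d i)" for r
      by (rule sum.cong) (auto simp: x_def)
    have "F - (\<Sum>j<n * k. ec (x j) * f j) = (\<Sum>r<n. sv ^ r * iota n (part n r F)) - (\<Sum>r<n. sv ^ r * iota n (\<Sum>i<k. ec (c r i) * d i))"
      unfolding S e using iota_decomp[OF n, of F] by simp
    also have "\<dots> = (\<Sum>r<n. sv ^ r * iota n (part n r F - (\<Sum>i<k. ec (c r i) * d i)))"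
      by (simp only: rhom_diff[OF h] right_diff_distrib sum_subtractf)
    also have "\<dots> \<in> ?W'"
      unfolding id2_iota_iff[OF n] using part_sum[of _ n "\<lambda>r. part n r F - (\<Sum>i<k. ec (c r i) * d i)"] c by simp
    finally show "\<exists>c. F - (\<Sum>j<n * k. ec (c j) * f j) \<in> ?W'" by (rule exI[where x = x])
  qed
  ultimately have "Ser.codim ?W' (n * k)" unfolding Ser.codim_def by blast
  then have "N = n * k" using Ser.codim_unique[OF ideal_id2 N] by blast
  then show ?thesis using k by blast
qed

lemma iota_emb: assumes "n \<ge> 1" shows "iota n (emb P) = emb (bcp n P)"
  by (rule fps_ext) (simp add: coeff_bcp[OF assms])

text \<open>After base change g_t is a unit times linear factors, so both colengths are sums of
  orders along the same branches. These agree term by term by \<open>ord_on_polar_branch\<close>,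
  and the common factor n cancels.\<close>

lemma codim_polar_eq:
  fixes g :: "complex fps poly"
  assumes g0: "coeff g 0 $ 0 = 0" and ord: "ordm (slice0 (pderiv g)) m"
    and bez: "\<alpha> * g + \<beta> * pderiv g = [:r:]" "r \<noteq> 0"
  shows "\<exists>k. Ser.codim (id2 (emb (smult fps_X (map_poly fps_deriv g))) (emb (pderiv g))) k \<and>
             Ser.codim (id2 (emb (g + smult fps_X (map_poly fps_deriv g))) (emb (pderiv g))) k"
proof -
  define u where "u = smult fps_X (map_poly fps_deriv g)"
  define v where "v = g + u"
  obtain n \<eta>s U where n: "n \<ge> 1" and \<eta>s: "\<forall>\<eta>\<in>set \<eta>s. \<eta> $ 0 = 0" and U: "coeff U 0 $ 0 \<noteq> 0"
    and fac: "bcp n (pderiv g) = U * (\<Prod>\<eta>\<leftarrow>\<eta>s. [:- \<eta>, 1:])"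
    using puiseux_factorization[OF ord] by blast
  have rt: "poly (bcp n (pderiv g)) \<eta> = 0" if "\<eta> \<in> set \<eta>s" for \<eta>
  proof -
    have "poly (\<Prod>\<eta>\<leftarrow>\<eta>s. [:- \<eta>, 1:]) \<eta> = 0" using that by (induction \<eta>s) auto
    then show ?thesis unfolding fac poly_mult by simp
  qed
  have o: "poly (bcp n u) \<eta> \<noteq> 0" "poly (bcp n v) \<eta> \<noteq> 0"
    "subdegree (poly (bcp n u) \<eta>) = subdegree (poly (bcp n v) \<eta>)" if "\<eta> \<in> set \<eta>s" for \<eta>
    unfolding u_def v_def using ord_on_polar_branch[OF n _ g0 rt[OF that] bez] \<eta>s that by blast+
  define N where "N = (\<Sum>\<eta>\<leftarrow>\<eta>s. subdegree (poly (bcp n u) \<eta>))"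
  have "Ser.codim (id2 (emb (bcp n u)) (emb (bcp n (pderiv g)))) N"
    unfolding fac N_def using o \<eta>s U by (intro codim_branches) auto
  then obtain k where k: "Ser.codim (id2 (emb u) (emb (pderiv g))) k" "N = n * k"
    unfolding iota_emb[OF n, symmetric] using codim_base_change[OF n] by blast
  have "map (\<lambda>\<eta>. subdegree (poly (bcp n u) \<eta>)) \<eta>s = map (\<lambda>\<eta>. subdegree (poly (bcp n v) \<eta>)) \<eta>s"
    using o(3) by (intro map_cong refl)
  then have N': "N = (\<Sum>\<eta>\<leftarrow>\<eta>s. subdegree (poly (bcp n v) \<eta>))" by (simp only: N_def)
  have "Ser.codim (id2 (emb (bcp n v)) (emb (bcp n (pderiv g)))) N"
    unfolding fac N' using o \<eta>s U by (intro codim_branches) auto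
  then obtain k' where k': "Ser.codim (id2 (emb v) (emb (pderiv g))) k'" "N = n * k'"
    unfolding iota_emb[OF n, symmetric] using codim_base_change[OF n] by blast
  have "k = k'" using k(2) k'(2) n by simp
  then show ?thesis using k k' unfolding u_def v_def by blast
qed

text \<open>If p w = \<alpha> p a + \<beta> b, then p divides \<beta> because it is a nonzerodivisor
  modulo b, and p cancels. It is applied with p = s and with b an element that does not vanish on
  the line.\<close>

lemma colon_prime2:
  fixes p :: "'r::idom"
  assumes prime: "\<And>x. p dvd b * x \<Longrightarrow> p dvd x" and "p \<noteq> 0"
  shows "colon (id2 (p * a) b) p = id2 a b" "iplus (id2 (p * a) b) p = id2 p b"
proof -
  show "colon (id2 (p * a) b) p = id2 a b"
  proof (intro set_eqI iffI)
    fix w assume "w \<in> id2 a b"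
    then obtain \<alpha> \<beta> where "w = \<alpha> * a + \<beta> * b" unfolding id2_def by blast
    then have "p * w = \<alpha> * (p * a) + (p * \<beta>) * b" by (simp add: algebra_simps)
    then show "w \<in> colon (id2 (p * a) b) p" unfolding colon_def mem_Collect_eq by (rule id2I)
  next
    fix w assume "w \<in> colon (id2 (p * a) b) p"
    then obtain \<alpha> \<beta> where w: "p * w = \<alpha> * (p * a) + \<beta> * b" unfolding colon_def id2_def by blast
    then have "b * \<beta> = p * (w - \<alpha> * a)" by (simp add: algebra_simps)
    then have "p dvd b * \<beta>" by (rule dvdI)
    then have "p dvd \<beta>" by (rule prime)
    then obtain \<beta>' where "\<beta> = p * \<beta>'" by (rule dvdE)
    then have "p * w = p * (\<alpha> * a + \<beta>' * b)" unfolding w by (simp add: algebra_simps)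
    then have "w = \<alpha> * a + \<beta>' * b" using assms(2) by simp
    then show "w \<in> id2 a b" by (rule id2I)
  qed
  show "iplus (id2 (p * a) b) p = id2 p b"
  proof (intro set_eqI iffI)
    fix w assume "w \<in> iplus (id2 (p * a) b) p"
    then obtain x \<alpha> \<beta> where "w - p * x = \<alpha> * (p * a) + \<beta> * b" unfolding iplus_def id2_def by blast
    then have "w = (x + \<alpha> * a) * p + \<beta> * b" by (simp add: algebra_simps)
    then show "w \<in> id2 p b" by (rule id2I)
  next
    fix w assume "w \<in> id2 p b"
    then obtain \<alpha> \<beta> where "w = \<alpha> * p + \<beta> * b" unfolding id2_def by blast
    then have "w - p * \<alpha> = 0 * (p * a) + \<beta> * b" by simp
    then show "w \<in> iplus (id2 (p * a) b) p" unfolding iplus_def mem_Collect_eq by (intro exI id2I)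
  qed
qed

lemma colon_prime3:
  fixes p :: "'r::idom"
  assumes prime: "\<And>x. p dvd b * x \<Longrightarrow> p dvd x" and "p \<noteq> 0"
  shows "colon (id3 b (p * a) (p * c)) p = id3 b a c" "iplus (id3 b (p * a) (p * c)) p = id2 p b"
proof -
  show "colon (id3 b (p * a) (p * c)) p = id3 b a c"
  proof (intro set_eqI iffI)
    fix w assume "w \<in> id3 b a c"
    then obtain \<alpha> \<beta> \<gamma> where "w = \<alpha> * b + \<beta> * a + \<gamma> * c" unfolding id3_def by blast
    then have "p * w = (p * \<alpha>) * b + \<beta> * (p * a) + \<gamma> * (p * c)" by (simp add: algebra_simps)
    then show "w \<in> colon (id3 b (p * a) (p * c)) p" unfolding colon_def mem_Collect_eq by (rule id3I)
  next
    fix w assume "w \<in> colon (id3 b (p * a) (p * c)) p"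
    then obtain \<alpha> \<beta> \<gamma> where w: "p * w = \<alpha> * b + \<beta> * (p * a) + \<gamma> * (p * c)" unfolding colon_def id3_def by blast
    then have "b * \<alpha> = p * (w - \<beta> * a - \<gamma> * c)" by (simp add: algebra_simps)
    then have "p dvd b * \<alpha>" by (rule dvdI)
    then have "p dvd \<alpha>" by (rule prime)
    then obtain \<alpha>' where "\<alpha> = p * \<alpha>'" by (rule dvdE)
    then have "p * w = p * (\<alpha>' * b + \<beta> * a + \<gamma> * c)" unfolding w by (simp add: algebra_simps)
    then have "w = \<alpha>' * b + \<beta> * a + \<gamma> * c" using assms(2) by simp
    then show "w \<in> id3 b a c" by (rule id3I)
  qed
  show "iplus (id3 b (p * a) (p * c)) p = id2 p b"
  proof (intro set_eqI iffI)
    fix w assume "w \<in> iplus (id3 b (p * a) (p * c)) p"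
    then obtain x \<alpha> \<beta> \<gamma> where "w - p * x = \<alpha> * b + \<beta> * (p * a) + \<gamma> * (p * c)" unfolding iplus_def id3_def by blast
    then have "w = (x + \<beta> * a + \<gamma> * c) * p + \<alpha> * b" by (simp add: algebra_simps)
    then show "w \<in> id2 p b" by (rule id2I)
  next
    fix w assume "w \<in> id2 p b"
    then obtain \<alpha> \<beta> where "w = \<alpha> * p + \<beta> * b" unfolding id2_def by blast
    then have "w - p * \<alpha> = \<beta> * b + 0 * (p * a) + 0 * (p * c)" by simp
    then show "w \<in> iplus (id3 b (p * a) (p * c)) p" unfolding iplus_def mem_Collect_eq by (intro exI id3I)
  qed
qed

lemma id2_commute: "id2 a b = id2 b a"
  by (rule equalityI) (rule id2_least[OF ideal_id2 id2_gen(2) id2_gen(1)])+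

lemma subdegree_sl_emb:
  assumes "ordm (slice0 P) m"
  shows "sl (emb P) \<noteq> 0" "subdegree (sl (emb P)) = m"
proof -
  have c: "sl (emb P) $ j = coeff (slice0 P) j" for j by simp
  show "subdegree (sl (emb P)) = m"
    using assms unfolding ordm_def by (intro subdegreeI) (simp_all add: c del: sl_nth coeff_slice0)
  show "sl (emb P) \<noteq> 0" using assms c[of m] unfolding ordm_def by (metis fps_zero_nth)
qed

text \<open>The numbers \<open>\<mu>, \<tau>\<close> belong to \<open>g\<close> and \<open>\<mu>', \<tau>'\<close> to \<open>s g\<close>. All colengths are compared through
  \<open>codim W = codim (W : c) + codim (W + (c))\<close>; the one relation this does not give is \<open>codim_polar_eq\<close>.\<close>

theorem local_line_formula:
  fixes g :: "complex fps poly"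
  assumes g0: "coeff g 0 $ 0 = 0" and sg: "slice0 g \<noteq> 0"
    and bez: "\<alpha> * g + \<beta> * pderiv g = [:r:]" "r \<noteq> 0"
  defines "G \<equiv> emb g" and "Gs \<equiv> emb (map_poly fps_deriv g)" and "Gt \<equiv> emb (pderiv g)"
  shows "\<exists>\<mu> \<tau> \<mu>' \<tau>' m n. Ser.codim (id2 Gs Gt) \<mu> \<and> Ser.codim (id3 G Gs Gt) \<tau> \<and>
     Ser.codim (id2 (G + sv * Gs) (sv * Gt)) \<mu>' \<and> Ser.codim (id3 (sv * G) (G + sv * Gs) (sv * Gt)) \<tau>' \<and>
     Ser.codim (id3 G (sv * Gs) (sv * Gt)) n \<and>
     (\<forall>F. F * Gt \<in> id3 G (sv * Gs) (sv * Gt) \<longleftrightarrow> fps_X ^ m dvd sl F) \<and> \<mu>' + \<tau> + 1 = \<mu> + \<tau>' + m"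
proof -
  define i where "i = (LEAST j. coeff (slice0 g) j \<noteq> 0)"
  have ex: "\<exists>j. coeff (slice0 g) j \<noteq> 0" using sg by (metis leading_coeff_0_iff)
  have og: "ordm (slice0 g) i"
    unfolding ordm_def i_def using LeastI_ex[OF ex] not_less_Least by blast
  have i1: "i \<ge> 1" using og g0 unfolding ordm_def by (cases i) auto
  \<comment> \<open>In characteristic 0, differentiation in t lowers a positive order along the line
    by exactly one.\<close>
  have ot: "ordm (slice0 (pderiv g)) (i - 1)"
    unfolding ordm_def coeff_slice0 coeff_pderiv
    using og i1 unfolding ordm_def by (auto simp del: of_nat_Suc)
  note sG = subdegree_sl_emb[OF og, folded G_def] and sGt = subdegree_sl_emb[OF ot, folded Gt_def]
  have slb: "sl (G + sv * Gs) = sl G" by (simp add: rhom_simps[OF rhom_sl])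
  have Eu: "emb (smult fps_X (map_poly fps_deriv g)) = sv * Gs"
    by (simp add: Gs_def fps_of_poly_smult sv_def)
  obtain K where K: "Ser.codim (id2 (sv * Gs) Gt) K" "Ser.codim (id2 (G + sv * Gs) Gt) K"
    using codim_polar_eq[OF g0 ot bez] unfolding fps_of_poly_add Eu G_def Gt_def by blast
  have ci: "Ser.codim (id2 sv G) i" using codim_sv[OF sG(1)] sG(2) by simp
  have ci': "Ser.codim (id2 sv Gt) (i - 1)" using codim_sv[OF sGt(1)] sGt(2) by simp

  have pt: "\<And>x. sv dvd Gt * x \<Longrightarrow> sv dvd x" using sv_prime[OF sGt(1)] .
  have pG: "\<And>x. sv dvd G * x \<Longrightarrow> sv dvd x" using sv_prime[OF sG(1)] .
  have pb: "\<And>x. sv dvd (G + sv * Gs) * x \<Longrightarrow> sv dvd x" by (rule sv_prime[of "G + sv * Gs", unfolded slb, OF sG(1)])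

  have "id2 (sv * Gs) Gt \<subseteq> id2 Gs Gt"
    by (rule id2_least[OF ideal_id2 ideal_mult[OF ideal_id2 id2_gen(1)] id2_gen(2)])
  then obtain \<mu> where \<mu>: "Ser.codim (id2 Gs Gt) \<mu>"
    using Ser.codim_mono[OF ideal_id2 ideal_id2 _ K(1)] by blast
  \<comment> \<open>The colon by s is the Jacobian ideal of g and the sum with (s) is (s, g_t),
    whence K = \<mu> + i - 1.\<close>
  have "Ser.codim (id2 (sv * Gs) Gt) (\<mu> + (i - 1))"
    by (rule Ser.codim_colon[OF ideal_id2, where c = sv]) (simp_all only: colon_prime2[OF pt sv_nz] \<mu> ci')
  then have K\<mu>: "K = \<mu> + (i - 1)" using Ser.codim_unique[OF ideal_id2 K(1)] by blast

  \<comment> \<open>For the Jacobian ideal of s g, the colon by s is the second polar ideal, again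
    of colength K, and the sum with (s) is (s, g). Hence \<mu>' = K + i = \<mu> + 2 i - 1.\<close>
  have \<mu>': "Ser.codim (id2 (G + sv * Gs) (sv * Gt)) (K + i)"
  proof (rule Ser.codim_colon[OF ideal_id2, where c = sv])
    have c1: "id2 (G + sv * Gs) (sv * Gt) = id2 (sv * Gt) (G + sv * Gs)" by (rule id2_commute)
    have c2: "id2 (G + sv * Gs) Gt = id2 Gt (G + sv * Gs)" by (rule id2_commute)
    have "Ser.codim (id2 Gt (G + sv * Gs)) K" using K(2) unfolding c2 .
    then show "Ser.codim (colon (id2 (G + sv * Gs) (sv * Gt)) sv) K"
      unfolding c1 by (subst colon_prime2(1)[OF pb sv_nz])
    show "Ser.codim (iplus (id2 (G + sv * Gs) (sv * Gt)) sv) i"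
      unfolding c1 using codim_sv[of "G + sv * Gs"] sG unfolding slb by (subst colon_prime2(2)[OF pb sv_nz]) simp_all
  qed

  have "id2 Gs Gt \<subseteq> id3 G Gs Gt"
    by (rule id2_least[OF ideal_id3 id3_gen(2,3)])
  then obtain \<tau> where \<tau>: "Ser.codim (id3 G Gs Gt) \<tau>"
    using Ser.codim_mono[OF ideal_id2 ideal_id3 _ \<mu>] by blast

  define M where "M = id3 G (sv * Gs) (sv * Gt)"
  have idM: "ideal M" unfolding M_def by (rule ideal_id3)
  \<comment> \<open>M : s is the Tjurina ideal of g, and M + (s) = (s, g).\<close>
  have M: "Ser.codim M (\<tau> + i)"
    by (rule Ser.codim_colon[OF idM, where c = sv]) (simp_all only: M_def colon_prime3[OF pG sv_nz] \<tau> ci)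
  obtain k0 R c where k0: "c \<noteq> 0" "tv ^ k0 * (ec c + tv * R) \<in> M"
    using Ser.codim_power[OF idM M, of tv] by blast
  have "(ec c + tv * R) $ 0 $ 0 \<noteq> 0" using k0(1) by (simp add: ec_def tv_def)
  then obtain Y where Y: "(ec c + tv * R) * Y = 1" using cps_unit by blast
  have "tv ^ k0 * (ec c + tv * R) * Y \<in> M" using k0(2) by (rule ideal_mult2[OF idM])
  then have tk0: "tv ^ k0 \<in> M" by (simp add: mult.assoc Y)
  define m where "m = (LEAST k. tv ^ k * Gt \<in> M)"
  have tm: "tv ^ m * Gt \<in> M"
    unfolding m_def by (rule LeastI[of _ k0]) (rule ideal_mult2[OF idM tk0])
  have svGt: "sv * Gt \<in> M" unfolding M_def by (rule id3_gen)
  have char: "F * Gt \<in> M \<longleftrightarrow> fps_X ^ m dvd sl F" for F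
  proof
    assume "fps_X ^ m dvd sl F"
    then have "sl (tv ^ m) dvd sl F" by (simp add: rhom_power[OF rhom_sl])
    then have "F \<in> id2 sv (tv ^ m)" by (subst id2_sv_iff) (simp_all add: rhom_power[OF rhom_sl])
    then obtain \<alpha> \<beta> where "F = \<alpha> * sv + \<beta> * tv ^ m" unfolding id2_def by blast
    then have "F * Gt = \<alpha> * (sv * Gt) + \<beta> * (tv ^ m * Gt)" by (simp add: algebra_simps)
    then show "F * Gt \<in> M" using idM svGt tm by (simp add: ideal_add ideal_mult)
  next
    assume F: "F * Gt \<in> M"
    show "fps_X ^ m dvd sl F"
    proof (cases "sl F = 0")
      case False
      define k where "k = subdegree (sl F)"
      have "sl F dvd sl (tv ^ k)"
        unfolding subdegree_dvd[OF False] k_def by (simp add: rhom_power[OF rhom_sl])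
      then have "tv ^ k \<in> id2 sv F" by (simp add: id2_sv_iff[OF False])
      then obtain \<alpha> \<beta> where "tv ^ k = \<alpha> * sv + \<beta> * F" unfolding id2_def by blast
      then have "tv ^ k * Gt = \<alpha> * (sv * Gt) + \<beta> * (F * Gt)" by (simp add: algebra_simps)
      then have "tv ^ k * Gt \<in> M" using idM svGt F by (simp add: ideal_add ideal_mult)
      then have "m \<le> k" unfolding m_def by (rule Least_le)
      then show ?thesis unfolding k_def fps_X_power_dvd_iff
        using nth_less_subdegree_zero less_le_trans by blast
    qed simp
  qed
  have cM: "colon M Gt = id2 sv (tv ^ m)"
  proof (rule set_eqI)
    fix x
    have "x \<in> colon M Gt \<longleftrightarrow> fps_X ^ m dvd sl x" using char[of x] by (simp add: colon_def mult.commute)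
    then show "x \<in> colon M Gt \<longleftrightarrow> x \<in> id2 sv (tv ^ m)"
      by (subst id2_sv_iff) (simp_all add: rhom_power[OF rhom_sl])
  qed
  have cm: "Ser.codim (id2 sv (tv ^ m)) m"
    using codim_sv[of "tv ^ m"] by (simp add: rhom_power[OF rhom_sl])
  \<comment> \<open>This is M + (g_t). It is written with the generator \<open>G + sv * Gs\<close>
    so that it also has the form of the colon by s of the Tjurina ideal of s g.\<close>
  define K' where "K' = id3 (G + sv * Gs) G Gt"
  have idK: "ideal K'" unfolding K'_def by (rule ideal_id3)
  have svGs: "sv * Gs \<in> K'" unfolding K'_def by (rule id3I[of _ 1 _ "-1" _ 0]) simp
  have ipM: "iplus M Gt = K'"
  proof (intro set_eqI iffI)
    fix w assume "w \<in> iplus M Gt"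
    then obtain x \<alpha> \<beta> \<gamma> where "w - Gt * x = \<alpha> * G + \<beta> * (sv * Gs) + \<gamma> * (sv * Gt)" unfolding iplus_def M_def id3_def by blast
    then have "w = \<beta> * (G + sv * Gs) + (\<alpha> - \<beta>) * G + (x + \<gamma> * sv) * Gt" by (simp add: algebra_simps)
    then show "w \<in> K'" unfolding K'_def by (rule id3I)
  next
    fix w assume "w \<in> K'"
    then obtain \<alpha> \<beta> \<gamma> where "w = \<alpha> * (G + sv * Gs) + \<beta> * G + \<gamma> * Gt" unfolding K'_def id3_def by blast
    then have "w - Gt * \<gamma> = (\<alpha> + \<beta>) * G + \<alpha> * (sv * Gs) + 0 * (sv * Gt)" by (simp add: algebra_simps)
    then show "w \<in> iplus M Gt" unfolding iplus_def M_def using id3I by blast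
  qed
  have "M \<subseteq> K'"
    unfolding M_def by (rule id3_least[OF idK _ svGs]) (auto simp: K'_def intro: id3_gen ideal_mult[OF ideal_id3])
  then obtain \<kappa> where \<kappa>: "Ser.codim K' \<kappa>"
    using Ser.codim_mono[OF idM idK _ M] by blast
  \<comment> \<open>A second computation of the colength of M, through g_t in place of s; comparison
    with the first determines \<kappa>.\<close>
  have "Ser.codim M (m + \<kappa>)"
    by (rule Ser.codim_colon[OF idM, where c = Gt]) (simp_all only: cM ipM cm \<kappa>)
  then have e1: "\<tau> + i = m + \<kappa>" using Ser.codim_unique[OF idM M] by blast
  have T: "id3 (sv * G) (G + sv * Gs) (sv * Gt) = id3 (G + sv * Gs) (sv * G) (sv * Gt)"
  proof
    show "id3 (sv * G) (G + sv * Gs) (sv * Gt) \<subseteq> id3 (G + sv * Gs) (sv * G) (sv * Gt)"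
      by (rule id3_least[OF ideal_id3]) (rule id3_gen)+
    show "id3 (G + sv * Gs) (sv * G) (sv * Gt) \<subseteq> id3 (sv * G) (G + sv * Gs) (sv * Gt)"
      by (rule id3_least[OF ideal_id3]) (rule id3_gen)+
  qed
  have \<tau>': "Ser.codim (id3 (sv * G) (G + sv * Gs) (sv * Gt)) (\<kappa> + i)"
    unfolding T
  proof (rule Ser.codim_colon[OF ideal_id3, where c = sv])
    show "Ser.codim (colon (id3 (G + sv * Gs) (sv * G) (sv * Gt)) sv) \<kappa>"
      by (subst colon_prime3(1)[OF pb sv_nz], assumption, rule \<kappa>[unfolded K'_def])
    show "Ser.codim (iplus (id3 (G + sv * Gs) (sv * G) (sv * Gt)) sv) i"
      using codim_sv[of "G + sv * Gs"] sG unfolding slb by (subst colon_prime3(2)[OF pb sv_nz]) simp_all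
  qed
  have "(K + i) + \<tau> + 1 = \<mu> + (\<kappa> + i) + m" using K\<mu> e1 i1 by simp
  then show ?thesis using \<mu> \<tau> \<mu>' \<tau>' M char unfolding M_def by blast
qed

section \<open>The local ring of the affine plane and its completion\<close>

text \<open>A nonzero combination of least degree divides every combination, since the remainder of
  a division by it is again a combination.\<close>

lemma field_poly_common_factor:
  fixes p q :: "'k::field poly"
  assumes "p \<noteq> 0"
  obtains d a b where "d \<noteq> 0" "d = a * p + b * q" "d dvd p" "d dvd q"
proof -
  define S where "S = {d. d \<noteq> 0 \<and> (\<exists>a b. d = a * p + b * q)}"
  have "p = 1 * p + 0 * q" by simp
  then have "p \<in> S" unfolding S_def using assms by blast
  define d where "d = arg_min degree (\<lambda>d. d \<in> S)"
  have dS: "d \<in> S" and dmin: "\<And>y. y \<in> S \<Longrightarrow> degree d \<le> degree y"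
    unfolding d_def using arg_min_nat_lemma[of "\<lambda>d. d \<in> S" p degree] \<open>p \<in> S\<close> by auto
  obtain a b where d: "d \<noteq> 0" "d = a * p + b * q" using dS unfolding S_def by blast
  have "d dvd x" if x: "x = a' * p + b' * q" for x a' b'
  proof (rule ccontr)
    assume "\<not> d dvd x"
    then have m: "x mod d \<noteq> 0" by (simp add: dvd_eq_mod_eq_0)
    have "x mod d = x - x div d * d" by (simp add: minus_div_mult_eq_mod)
    also have "\<dots> = (a' - x div d * a) * p + (b' - x div d * b) * q"
    proof -
      have "x - x div d * d = (a' * p + b' * q) - x div d * (a * p + b * q)" using x d(2) by simp
      then show ?thesis by (simp add: algebra_simps)
    qed
    finally have "x mod d \<in> S" unfolding S_def using m by blast
    then have "degree d \<le> degree (x mod d)" by (rule dmin)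
    moreover have "degree (x mod d) < degree d \<or> degree d = 0"
      using degree_mod_less[OF d(1), of x] m by auto
    ultimately have "degree d = 0" by simp
    then have "x mod d = 0" using d(1) by (metis mod_eq_0_iff_dvd is_unit_iff_degree unit_imp_dvd)
    then show False using m by simp
  qed
  from this[of p 1 0] this[of q 0 1] show thesis using that d by simp
qed

lemma fract_poly_clear: "\<exists>d p'. d \<noteq> 0 \<and> smult (to_fract d) p = fract_poly p'"
  for p :: "complex poly fract poly"
proof -
  obtain c p' where p: "p = smult c (fract_poly p')" using content_decompose_fract by blast
  obtain x y where xy: "c = Fract x y" "y \<noteq> 0" by (cases c)
  then have "to_fract y * c = to_fract x" by (simp add: Fract_conv_to_fract)
  then have "smult (to_fract y) p = fract_poly (smult x p')" unfolding p by simp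
  then show ?thesis using xy(2) by blast
qed

text \<open>Work over C(s). If g and g_t have a common factor of positive t-degree, Gauss's lemma
  makes it primitive, and a prime factor p of it divides g = p k and p_t k. For degree reasons p
  does not divide p_t, so p^2 divides g. Otherwise a Bezout relation exists, and clearing
  denominators leaves r(s).\<close>

lemma bivariate_bezout:
  fixes g :: "complex poly poly"
  assumes g: "g \<noteq> 0" and sqf: "\<And>q k. g = q * q * k \<Longrightarrow> degree q = 0"
  shows "\<exists>\<alpha> \<beta> r. r \<noteq> 0 \<and> \<alpha> * g + \<beta> * pderiv g = [:r:]"
proof -
  have "fract_poly g \<noteq> 0" using g by simp
  then obtain d a b where d: "d \<noteq> 0" "d = a * fract_poly g + b * fract_poly (pderiv g)"
    "d dvd fract_poly g" "d dvd fract_poly (pderiv g)"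
    by (rule field_poly_common_factor)
  obtain c d' where d': "d = smult c (fract_poly d')" "content d' = 1"
    by (rule content_decompose_fract)
  have dd: "fract_poly d' dvd d" unfolding d'(1) by (rule dvd_smult) simp
  have dg: "d' dvd g" using dvd_trans[OF dd d(3)] d'(2) by (rule fract_poly_dvdD)
  have dg': "d' dvd pderiv g" using dvd_trans[OF dd d(4)] d'(2) by (rule fract_poly_dvdD)
  show ?thesis
  proof (cases "degree d' = 0")
    case True
    then obtain e' where "d' = [:e':]" by (rule degree_eq_zeroE)
    then obtain e where e: "d = [:e:]" unfolding d'(1) by (auto simp: map_poly_pCons)
    have e0: "e \<noteq> 0" using d(1) e by simp
    obtain e1 e2 where e12: "e = Fract e1 e2" "e2 \<noteq> 0" by (cases e)
    then have ee: "to_fract e2 * e = to_fract e1" by (simp add: Fract_conv_to_fract)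
    then have e1: "e1 \<noteq> 0" using e0 e12(2) by (metis mult_eq_0_iff to_fract_eq_0_iff)
    obtain x A where x: "x \<noteq> 0" "smult (to_fract x) a = fract_poly A" using fract_poly_clear by blast
    obtain y B where y: "y \<noteq> 0" "smult (to_fract y) b = fract_poly B" using fract_poly_clear by blast
    have "fract_poly [:x * y * e1:] = smult (to_fract (x * y * e2)) d"
      unfolding e using ee by (simp add: map_poly_pCons mult_ac)
    also have "\<dots> = smult (to_fract (y * e2)) (smult (to_fract x) a) * fract_poly g + smult (to_fract (x * e2)) (smult (to_fract y) b) * fract_poly (pderiv g)"
      by (subst d(2)) (simp add: smult_add_right mult_ac)
    also have "\<dots> = fract_poly (smult (y * e2) A * g + smult (x * e2) B * pderiv g)"
      unfolding x(2) y(2) by simp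
    finally have "smult (y * e2) A * g + smult (x * e2) B * pderiv g = [:x * y * e1:]"
      by (simp only: fract_poly_eq_iff)
    then show ?thesis using x(1) y(1) e1 by (intro exI[of _ "smult (y * e2) A"] exI[of _ "smult (x * e2) B"] exI[of _ "x * y * e1"]) simp
  next
    case False
    have "\<not> is_unit d'" using False by (metis is_unit_polyE degree_pCons_0)
    moreover have "d' \<noteq> 0" using False by auto
    ultimately obtain p where p: "p dvd d'" "prime p" using prime_divisor_exists by blast
    have dp: "degree p \<noteq> 0"
    proof
      assume "degree p = 0"
      then obtain c where c: "p = [:c:]" by (rule degree_eq_zeroE)
      then have "c dvd content d'" using p(1) by (simp add: const_poly_dvd_iff_dvd_content)
      then have "is_unit p" unfolding d'(2) c by (simp add: is_unit_const_poly_iff)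
      then show False using p(2) by (metis not_prime_unit)
    qed
    obtain k where k: "g = p * k" using dvd_trans[OF p(1) dg] by (rule dvdE)
    have "p dvd pderiv g" using p(1) dg' by (rule dvd_trans)
    then have "p dvd pderiv p * k" unfolding k pderiv_mult by (simp add: dvd_add_right_iff mult.commute)
    moreover have "\<not> p dvd pderiv p"
    proof
      assume "p dvd pderiv p"
      moreover have "pderiv p \<noteq> 0" using dp by (simp add: pderiv_eq_0_iff)
      ultimately have "degree p \<le> degree (pderiv p)" by (rule dvd_imp_degree_le)
      then show False using dp by (simp add: degree_pderiv)
    qed
    ultimately have "p dvd k" using p(2) prime_dvd_multD by blast
    then obtain k' where "k = p * k'" by (rule dvdE)
    then have "g = p * p * k'" using k by (simp add: mult.assoc)
    then have "degree p = 0" by (rule sqf)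
    then show ?thesis using dp by simp
  qed
qed

text \<open>As in the power series ring, the outer variable of \<open>complex poly poly\<close> is \<open>t\<close> and the inner one is \<open>s\<close>.\<close>

type_synonym bpoly = "complex poly poly"

definition cc :: "complex \<Rightarrow> bpoly" where "cc c = [:[:c:]:]"
definition sp :: bpoly where "sp = [:[:0, 1:]:]"
definition tp :: bpoly where "tp = [:0, 1:]"
definition val0 :: "bpoly \<Rightarrow> complex" where "val0 F = coeff (coeff F 0) 0"
definition EP :: "bpoly \<Rightarrow> complex fps poly" where "EP = map_poly fps_of_poly"
definition bemb :: "bpoly \<Rightarrow> cps" where "bemb F = emb (EP F)"

lemma rhom_fps_of_poly: "rhom (fps_of_poly :: 'a::comm_ring_1 poly \<Rightarrow> 'a fps)"
  by (simp add: rhom_def fps_of_poly_add fps_of_poly_mult)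

lemma rhom_EP: "rhom EP"
  unfolding EP_def by (intro rhom_map_poly rhom_fps_of_poly)

lemma rhom_bemb: "rhom bemb"
  unfolding bemb_def by (rule rhom_comp[OF rhom_EP rhom_emb])

lemma rhom_cc: "rhom cc"
  by (simp add: rhom_def cc_def one_pCons)

lemma rhom_val0: "rhom val0"
  by (simp add: rhom_def val0_def coeff_mult)

lemma coeff_EP: "coeff (EP F) j = fps_of_poly (coeff F j)"
  by (simp add: EP_def coeff_map_poly)

lemma bemb_nth [simp]: "bemb F $ j $ i = coeff (coeff F j) i"
  by (simp add: bemb_def coeff_EP)

lemma bemb_cc [simp]: "bemb (cc c) = ec c" and bemb_sp [simp]: "bemb sp = sv" and bemb_tp [simp]: "bemb tp = tv"
proof -
  show "bemb (cc c) = ec c"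
    by (intro fps_ext) (auto simp: cc_def ec_def coeff_pCons split: nat.splits)
  show "bemb sp = sv"
    by (intro fps_ext) (auto simp: sp_def sv_def fps_X_def coeff_pCons split: nat.splits)
  show "bemb tp = tv"
    by (intro fps_ext) (auto simp: tp_def tv_def fps_X_def coeff_pCons split: nat.splits)
qed

section \<open>Polynomial approximation and passage to the completion\<close>

lemma bpoly_truncate:
  "\<exists>w R1 R2. W = bemb w + sv ^ a * R1 + tv ^ b * R2"
proof -
  define w where "w = (\<Sum>j<b. monom (truncate_fps a (W $ j)) j)"
  define R1 where "R1 = (\<Sum>j<b. fps_const (fps_shift a (W $ j)) * fps_X ^ j)"
  have "coeff w j = (if j < b then truncate_fps a (W $ j) else 0)" for j
    by (simp add: w_def coeff_sum)
  moreover have "(\<Sum>j<b. fps_const (fps_cutoff a (W $ j)) * fps_X ^ j) $ n = (if n < b then fps_cutoff a (W $ n) else 0)" for n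
  proof -
    have "(\<Sum>j<b. fps_const (fps_cutoff a (W $ j)) * fps_X ^ j) $ n = (\<Sum>j<b. if j = n then fps_cutoff a (W $ n) else 0)"
      unfolding fps_sum_nth by (rule sum.cong) auto
    then show ?thesis by simp
  qed
  ultimately have bemb: "bemb w = (\<Sum>j<b. fps_const (fps_cutoff a (W $ j)) * fps_X ^ j)"
    by (intro fps_ext) (simp add: coeff_truncate_fps)
  have "W = (\<Sum>j<b. fps_const (W $ j) * fps_X ^ j) + fps_X ^ b * fps_shift b W" by (rule fps_split)
  also have "(\<Sum>j<b. fps_const (W $ j) * fps_X ^ j) = bemb w + sv ^ a * R1"
  proof -
    have "W $ j = fps_cutoff a (W $ j) + fps_X ^ a * fps_shift a (W $ j)" for j
      by (intro fps_ext) (simp add: fps_X_power_mult_nth)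
    then have "fps_const (W $ j) * fps_X ^ j = fps_const (fps_cutoff a (W $ j)) * fps_X ^ j + sv ^ a * (fps_const (fps_shift a (W $ j)) * fps_X ^ j)" for j
      unfolding sv_def fps_const_power by (metis (no_types, lifting) distrib_right fps_const_add fps_const_mult mult.assoc)
    then show ?thesis unfolding bemb R1_def by (simp add: sum.distrib sum_distrib_left)
  qed
  finally show ?thesis unfolding tv_def by blast
qed

lemma bpoly_in_powers:
  assumes "bemb y = sv ^ a * R1 + tv ^ b * R2"
  shows "\<exists>r1 r2. y = sp ^ a * r1 + tp ^ b * r2"
proof -
  have z: "coeff (coeff y j) i = 0" if "j < b" "i < a" for i j
  proof -
    have "coeff (coeff y j) i = (sv ^ a * R1 + tv ^ b * R2) $ j $ i" using assms bemb_nth by metis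
    also have "\<dots> = 0" using that by (simp add: sv_def tv_def fps_X_power_mult_nth)
    finally show ?thesis .
  qed
  define r1 where "r1 = (\<Sum>j<b. monom (poly_shift a (coeff y j)) j)"
  have c1: "coeff r1 j = (if j < b then poly_shift a (coeff y j) else 0)" for j
    by (simp add: r1_def coeff_sum)
  have spa: "sp ^ a = [:monom 1 a:]"
    by (induction a) (simp_all add: sp_def monom_Suc one_pCons)
  have "y = sp ^ a * r1 + tp ^ b * poly_shift b y"
  proof (rule poly_eqI, rule poly_eqI)
    fix j i
    have "tp ^ b = monom 1 b" by (simp add: tp_def monom_altdef)
    then have "coeff (tp ^ b * poly_shift b y) j = (if j < b then 0 else coeff y j)"
      by (simp add: coeff_monom_mult coeff_poly_shift)
    then show "coeff (coeff y j) i = coeff (coeff (sp ^ a * r1 + tp ^ b * poly_shift b y) j) i"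
      using z[of j i] by (simp add: spa c1 coeff_monom_mult coeff_poly_shift)
  qed
  then show ?thesis by blast
qed

definition idl :: "'r::comm_ring_1 list \<Rightarrow> 'r set" where
  "idl G = {x. \<exists>w. x = (\<Sum>i<length G. w i * G ! i)}"

text \<open>Membership in the ideal generated in the local ring at the origin; \<open>s\<close> is
  the common denominator of the coefficients, not the coordinate.\<close>

definition lid :: "bpoly list \<Rightarrow> bpoly \<Rightarrow> bool" where
  "lid G u \<longleftrightarrow> (\<exists>s. val0 s \<noteq> 0 \<and> s * u \<in> idl G)"

lemma idlI: "x = (\<Sum>i<length G. w i * G ! i) \<Longrightarrow> x \<in> idl G"
  unfolding idl_def by blast

lemma ideal_idl: "ideal (idl G)"
  unfolding ideal_def
proof (intro conjI ballI allI)
  show "0 \<in> idl G" by (rule idlI[where w = "\<lambda>_. 0"]) simp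
next
  fix x y assume "x \<in> idl G" "y \<in> idl G"
  then obtain w w' where "x = (\<Sum>i<length G. w i * G ! i)" "y = (\<Sum>i<length G. w' i * G ! i)"
    unfolding idl_def by blast
  then have "x + y = (\<Sum>i<length G. (w i + w' i) * G ! i)" by (simp add: sum.distrib distrib_right)
  then show "x + y \<in> idl G" by (rule idlI)
next
  fix r x assume "x \<in> idl G"
  then obtain w where "x = (\<Sum>i<length G. w i * G ! i)" unfolding idl_def by blast
  then have "r * x = (\<Sum>i<length G. (r * w i) * G ! i)" by (simp add: sum_distrib_left mult.assoc)
  then show "r * x \<in> idl G" by (rule idlI)
qed

lemma idl_hom: "rhom h \<Longrightarrow> x \<in> idl G \<Longrightarrow> h x \<in> idl (map h G)"
proof -
  assume h: "rhom h" and "x \<in> idl G"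
  then obtain w where "x = (\<Sum>i<length G. w i * G ! i)" unfolding idl_def by blast
  then have "h x = (\<Sum>i<length (map h G). h (w i) * map h G ! i)"
    by (simp add: rhom_sum[OF h] rhom_mult[OF h])
  then show ?thesis by (rule idlI)
qed

lemma idl_2: "idl [a, b] = id2 a b"
proof (intro set_eqI iffI)
  fix x assume "x \<in> idl [a, b]"
  then obtain w where "x = (\<Sum>i<length [a, b]. w i * [a, b] ! i)" unfolding idl_def by blast
  then have "x = w 0 * a + w 1 * b" by (simp add: lessThan_Suc add.commute)
  then show "x \<in> id2 a b" by (rule id2I)
next
  fix x assume "x \<in> id2 a b"
  then obtain \<alpha> \<beta> where "x = \<alpha> * a + \<beta> * b" unfolding id2_def by blast
  then have "x = (\<Sum>i<length [a, b]. (if i = 0 then \<alpha> else \<beta>) * [a, b] ! i)" by (simp add: lessThan_Suc add.commute)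
  then show "x \<in> idl [a, b]" by (rule idlI)
qed

lemma idl_3: "idl [a, b, c] = id3 a b c"
proof (intro set_eqI iffI)
  fix x assume "x \<in> idl [a, b, c]"
  then obtain w where "x = (\<Sum>i<length [a, b, c]. w i * [a, b, c] ! i)" unfolding idl_def by blast
  then have "x = w 0 * a + w 1 * b + w 2 * c" by (simp add: lessThan_Suc add_ac numeral_2_eq_2)
  then show "x \<in> id3 a b c" by (rule id3I)
next
  fix x assume "x \<in> id3 a b c"
  then obtain \<alpha> \<beta> \<gamma> where "x = \<alpha> * a + \<beta> * b + \<gamma> * c" unfolding id3_def by blast
  then have "x = (\<Sum>i<length [a, b, c]. (if i = 0 then \<alpha> else if i = 1 then \<beta> else \<gamma>) * [a, b, c] ! i)"
    by (simp add: lessThan_Suc add_ac)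
  then show "x \<in> idl [a, b, c]" by (rule idlI)
qed

lemma idl_approx:
  assumes "bemb u \<in> idl (map bemb G)"
  shows "\<exists>x r1 r2. x \<in> idl G \<and> u = x + sp ^ a * r1 + tp ^ b * r2"
proof -
  obtain W where W: "bemb u = (\<Sum>i<length G. W i * bemb (G ! i))"
    using assms unfolding idl_def by auto
  have "\<forall>i. \<exists>w R1 R2. W i = bemb w + sv ^ a * R1 + tv ^ b * R2" using bpoly_truncate by blast
  then obtain w R1 R2 where w: "\<And>i. W i = bemb (w i) + sv ^ a * R1 i + tv ^ b * R2 i" by metis
  define x where "x = (\<Sum>i<length G. w i * G ! i)"
  have "bemb (u - x) = sv ^ a * (\<Sum>i<length G. R1 i * bemb (G ! i)) + tv ^ b * (\<Sum>i<length G. R2 i * bemb (G ! i))"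
    unfolding x_def rhom_diff[OF rhom_bemb] W w
    by (simp add: rhom_sum[OF rhom_bemb] rhom_mult[OF rhom_bemb] distrib_right sum.distrib sum_distrib_left mult.assoc)
  then obtain r1 r2 where "u - x = sp ^ a * r1 + tp ^ b * r2" using bpoly_in_powers by blast
  then have "u = x + sp ^ a * r1 + tp ^ b * r2" by (simp add: algebra_simps)
  then show ?thesis unfolding x_def using idlI by blast
qed

lemma codim_powers:
  assumes W: "ideal W" and "Ser.codim W n" and "u = sv \<or> u = tv"
  shows "\<exists>k. u ^ k \<in> W"
proof -
  obtain k R c where k: "c \<noteq> 0" "u ^ k * (ec c + u * R) \<in> W"
    using Ser.codim_power[OF W assms(2)] by blast
  have "(ec c + u * R) $ 0 $ 0 \<noteq> 0" using k(1) assms(3) by (auto simp: ec_def tv_def sv_def)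
  then obtain Y where Y: "(ec c + u * R) * Y = 1" using cps_unit by blast
  have "u ^ k * (ec c + u * R) * Y \<in> W" using k(2) by (rule ideal_mult2[OF W])
  then show ?thesis by (auto simp: mult.assoc Y)
qed

text \<open>For the hard direction, powers s^k and t^l lie in the completed ideal. Truncating the
  coefficients that express them shows that s^k and t^l satisfy a linear system over
  \<open>idl G\<close> whose matrix is the identity at the origin. Cramer's rule puts them into the
  local ideal, and any \<open>u\<close> is then approximated modulo s^k and t^l.\<close>

theorem lid_iff_completion:
  assumes fin: "Ser.codim (idl (map bemb G)) n"
  shows "lid G u \<longleftrightarrow> bemb u \<in> idl (map bemb G)"
proof
  assume "lid G u"
  then obtain s where s: "val0 s \<noteq> 0" "s * u \<in> idl G" unfolding lid_def by blast
  have "bemb s $ 0 $ 0 \<noteq> 0" using s(1) by (simp add: val0_def)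
  then obtain Y where Y: "bemb s * Y = 1" using cps_unit by blast
  have "bemb (s * u) * Y \<in> idl (map bemb G)"
    by (rule ideal_mult2[OF ideal_idl idl_hom[OF rhom_bemb s(2)]])
  also have "bemb (s * u) * Y = bemb u * (bemb s * Y)" by (simp add: rhom_mult[OF rhom_bemb] mult_ac)
  finally show "bemb u \<in> idl (map bemb G)" using Y by simp
next
  assume u: "bemb u \<in> idl (map bemb G)"
  obtain k where k: "sv ^ k \<in> idl (map bemb G)" using codim_powers[OF ideal_idl fin] by blast
  obtain l where l: "tv ^ l \<in> idl (map bemb G)" using codim_powers[OF ideal_idl fin] by blast
  have "bemb (sp ^ k) \<in> idl (map bemb G)" using k by (simp add: rhom_power[OF rhom_bemb])
  from idl_approx[OF this, of "k + 1" "l + 1"] obtain x a b where x: "x \<in> idl G"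
    "sp ^ k = x + sp ^ (k + 1) * a + tp ^ (l + 1) * b" by blast
  have "bemb (tp ^ l) \<in> idl (map bemb G)" using l by (simp add: rhom_power[OF rhom_bemb])
  from idl_approx[OF this, of "k + 1" "l + 1"] obtain y c d where y: "y \<in> idl G"
    "tp ^ l = y + sp ^ (k + 1) * c + tp ^ (l + 1) * d" by blast
  \<comment> \<open>Determinant of the 2 by 2 system for s^k and t^l; its value at the origin is
    1.\<close>
  define D where "D = (1 - sp * a) * (1 - tp * d) - (tp * b) * (sp * c)"
  have x': "x = sp ^ k * (1 - sp * a) - tp ^ l * (tp * b)" using x(2) by (simp add: algebra_simps)
  have y': "y = tp ^ l * (1 - tp * d) - sp ^ k * (sp * c)" using y(2) by (simp add: algebra_simps)
  have "D * sp ^ k = (1 - tp * d) * x + (tp * b) * y"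
    unfolding D_def x' y' by (simp add: algebra_simps)
  then have Dk: "D * sp ^ k \<in> idl G" using x(1) y(1) by (simp add: ideal_add ideal_mult ideal_idl)
  have "D * tp ^ l = (sp * c) * x + (1 - sp * a) * y"
    unfolding D_def x' y' by (simp add: algebra_simps)
  then have Dl: "D * tp ^ l \<in> idl G" using x(1) y(1) by (simp add: ideal_add ideal_mult ideal_idl)
  have D0: "val0 D \<noteq> 0"
  proof -
    have "val0 sp = 0" "val0 tp = 0" by (simp_all add: val0_def sp_def tp_def)
    then show ?thesis by (simp add: D_def rhom_simps[OF rhom_val0])
  qed
  from idl_approx[OF u, of k l] obtain z r1 r2 where z: "z \<in> idl G" "u = z + sp ^ k * r1 + tp ^ l * r2" by blast
  have "D * u = D * z + r1 * (D * sp ^ k) + r2 * (D * tp ^ l)" unfolding z(2) by (simp add: algebra_simps)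
  also have "\<dots> \<in> idl G"
    by (rule ideal_add[OF ideal_idl ideal_add[OF ideal_idl ideal_mult[OF ideal_idl z(1)] ideal_mult[OF ideal_idl Dk]] ideal_mult[OF ideal_idl Dl]])
  finally show "lid G u" unfolding lid_def using D0 by blast
qed

text \<open>As the ideal contains powers of s and t, the members of a basis may be truncated to
  polynomials. This lets dimensions defined by polynomial families reach the formal
  colength.\<close>

lemma codim_poly_basis:
  assumes fin: "Ser.codim (idl (map bemb G)) n"
  shows "\<exists>w. Ser.ind (idl (map bemb G)) n (\<lambda>i. bemb (w i))"
proof -
  let ?W = "idl (map bemb G)"
  note W = ideal_idl[of "map bemb G"]
  obtain k where k: "sv ^ k \<in> ?W" using codim_powers[OF ideal_idl fin] by blast
  obtain l where l: "tv ^ l \<in> ?W" using codim_powers[OF ideal_idl fin] by blast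
  obtain b where b: "Ser.ind ?W n b" using fin unfolding Ser.codim_def by blast
  have "\<forall>i. \<exists>w. b i - bemb w \<in> ?W"
  proof
    fix i
    obtain w R1 R2 where w: "b i = bemb w + sv ^ k * R1 + tv ^ l * R2" using bpoly_truncate by blast
    have "b i - bemb w = sv ^ k * R1 + tv ^ l * R2" unfolding w by simp
    also have "\<dots> \<in> ?W" using k l by (intro ideal_add[OF W] ideal_mult2[OF W])
    finally show "\<exists>w. b i - bemb w \<in> ?W" by blast
  qed
  then obtain w where w: "\<And>i. b i - bemb (w i) \<in> ?W" by metis
  have "Ser.ind ?W n (\<lambda>i. bemb (w i))"
    unfolding Ser.ind_def
  proof (intro allI impI)
    fix c i assume c: "(\<Sum>i<n. ec (c i) * bemb (w i)) \<in> ?W" and i: "i < n"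
    have "(\<Sum>i<n. ec (c i) * (b i - bemb (w i))) \<in> ?W"
      by (intro ideal_sum[OF W] ideal_mult[OF W] w)
    from ideal_add[OF W this c] have "(\<Sum>i<n. ec (c i) * b i) \<in> ?W"
      by (simp add: right_diff_distrib sum_subtractf)
    then show "c i = 0" using b i unfolding Ser.ind_def by blast
  qed
  then show ?thesis by blast
qed

section \<open>Linear forms and dehomogenisation\<close>

definition lf :: "(nat \<Rightarrow> complex) \<Rightarrow> mpoly" where
  "lf a = Const (a 0) * Var 0 + Const (a 1) * Var 1 + Const (a 2) * Var 2"

lemma inS_Var: "n < 3 \<Longrightarrow> inS (Var n)"
  by auto

lemma inS_lf [simp]: "inS (lf a)"
  by (simp add: lf_def)

lemma homog_lf: "homog 1 (lf a)"
  unfolding lf_def by (intro homog_add homog_Const_mult homog_Var)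

lemma psub_lf: "rhom e \<Longrightarrow> psub e \<rho> (lf a) = e (a 0) * \<rho> 0 + e (a 1) * \<rho> 1 + e (a 2) * \<rho> 2"
  by (simp add: lf_def psub_add psub_mult)

text \<open>Reduction modulo a linear form: the substitution \<open>x \<mapsto> x - l(x) N\<close> with \<open>l(N) = 1\<close>.\<close>

lemma lf_dvd_diff:
  assumes "poly_in UNIV F"
  shows "l dvd F - psub Const (\<lambda>n. Var n - Const (N n) * l) F"
  using assms
proof (induction rule: poly_in_induct)
  case (add p q)
  have "p + q - psub Const (\<lambda>n. Var n - Const (N n) * l) (p + q) =
    (p - psub Const (\<lambda>n. Var n - Const (N n) * l) p) + (q - psub Const (\<lambda>n. Var n - Const (N n) * l) q)"
    by (simp add: psub_add[OF rhom_Const])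
  then show ?case using dvd_add[OF add(3,4)] by (simp only:)
next
  case (mult p q)
  let ?r = "psub Const (\<lambda>n. Var n - Const (N n) * l)"
  have "p * q - ?r (p * q) = (p - ?r p) * q + ?r p * (q - ?r q)"
    by (simp add: psub_mult[OF rhom_Const] algebra_simps)
  then show ?case using dvd_add[OF dvd_mult2[OF mult(3)] dvd_mult[OF mult(4)]] by (simp only:)
qed (simp_all add: rhom_Const)

lemma lf_dvd_iff:
  assumes N: "a 0 * N 0 + a 1 * N 1 + a 2 * N 2 = 1"
  shows "lf a dvd F \<longleftrightarrow> psub Const (\<lambda>n. Var n - Const (N n) * lf a) F = 0"
proof
  let ?r = "psub Const (\<lambda>n. Var n - Const (N n) * lf a)"
  assume "?r F = 0"
  then show "lf a dvd F" using lf_dvd_diff[of F "lf a" N] by simp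
next
  let ?r = "psub Const (\<lambda>n. Var n - Const (N n) * lf a)"
  assume "lf a dvd F"
  then obtain H where F: "F = lf a * H" by (rule dvdE)
  have "?r (lf a) = lf a - Const (a 0 * N 0 + a 1 * N 1 + a 2 * N 2) * lf a"
    unfolding psub_lf[OF rhom_Const] Const_add Const_mult by (simp add: lf_def algebra_simps)
  then have "?r (lf a) = 0" using N by simp
  then show "?r F = 0" unfolding F by (simp add: psub_mult[OF rhom_Const])
qed

lemma lf_normal_exists:
  assumes "(a 0, a 1, a 2) \<noteq> (0, 0, 0 :: complex)"
  shows "\<exists>N. a 0 * N 0 + a 1 * N 1 + a 2 * N (2::nat) = 1 \<and> (\<forall>n\<ge>3. N n = 0)"
proof -
  consider "a 0 \<noteq> 0" | "a 1 \<noteq> 0" | "a 2 \<noteq> 0" using assms by auto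
  then show ?thesis
  proof cases
    case 1 then show ?thesis by (intro exI[of _ "(\<lambda>_. 0)(0 := 1 / a 0)"]) simp
  next
    case 2 then show ?thesis by (intro exI[of _ "(\<lambda>_. 0)(1 := 1 / a 1)"]) simp
  next
    case 3 then show ?thesis by (intro exI[of _ "(\<lambda>_. 0)(2 := 1 / a 2)"]) simp
  qed
qed

text \<open>The reduction is a homomorphism into a domain, with kernel generated by the linear
  form.\<close>

lemma lf_prime:
  assumes "(a 0, a 1, a 2) \<noteq> (0, 0, 0)"
  shows "lf a dvd F * G \<longleftrightarrow> lf a dvd F \<or> lf a dvd G"
proof -
  obtain N :: "nat \<Rightarrow> complex" where "a 0 * N 0 + a 1 * N 1 + a 2 * N 2 = 1" using lf_normal_exists[OF assms] by blast
  from lf_dvd_iff[OF this] show ?thesis by (simp add: psub_mult[OF rhom_Const])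
qed

lemma lf_nz: assumes "(a 0, a 1, a 2) \<noteq> (0, 0, 0)" shows "lf a \<noteq> 0"
proof
  assume "lf a = 0"
  obtain N :: "nat \<Rightarrow> complex" where N: "a 0 * N 0 + a 1 * N 1 + a 2 * N 2 = 1" using lf_normal_exists[OF assms] by blast
  have "meval (lf a) N = 1" using N unfolding meval_eq_psub psub_lf[OF rhom_id] by simp
  then show False using \<open>lf a = 0\<close> by (simp add: meval_eq_psub)
qed

text \<open>The ambient ring has infinitely many variables. Setting all but the first three to 0 is
  a retraction onto S, and it must fix the quotient because it fixes the product and
  \<open>p\<close>.\<close>

lemma inS_cancel:
  assumes "inS (p * q)" "inS p" "p \<noteq> 0"
  shows "inS q"
proof -
  define \<sigma> where "\<sigma> = psub Const (\<lambda>n. if n < 3 then Var n else 0)"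
  have \<sigma>id: "\<sigma> x = x" if "inS x" for x
  proof -
    have "\<sigma> x = psub Const Var x" unfolding \<sigma>_def by (rule psub_cong[OF that]) auto
    then show ?thesis by simp
  qed
  have \<sigma>in: "inS (\<sigma> x)" for x
    unfolding \<sigma>_def by (rule poly_in_psub[of UNIV]) auto
  have "p * q = \<sigma> (p * q)" using \<sigma>id assms(1) by simp
  also have "\<dots> = p * \<sigma> q" using \<sigma>id[OF assms(2)] by (simp add: \<sigma>_def psub_mult[OF rhom_Const])
  finally have "q = \<sigma> q" using assms(3) by simp
  then show ?thesis using \<sigma>in by metis
qed

text \<open>Homogeneity as F(\<lambda> x) = \<lambda>^D F(x) with an indeterminate \<lambda>; in
  this multiplicative form it passes to cofactors, as \<open>homog_cancel\<close> requires.\<close>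

lemma homog_iff_scale:
  "homog D F \<longleftrightarrow> psub (\<lambda>c. [:Const c:]) (\<lambda>n. [:0, Var n:]) F = monom F D"
proof -
  let ?h = "psub (\<lambda>c. [:Const c:]) (\<lambda>n. [:0, Var n:])"
  have h: "rhom (\<lambda>c. [:Const c:])" using rhom_Const by (simp add: rhom_def one_pCons)
  have m: "mon (\<lambda>n. [:0, Var n:]) m = monom (mon Var m) (mdeg m)" for m
  proof -
    have "mon (\<lambda>n. [:0, Var n:]) m = mon (\<lambda>n. [:0, 1:] * [:Var n:]) m" by simp
    also have "\<dots> = [:0, 1:] ^ mdeg m * mon (\<lambda>n. [:Var n:]) m" by (rule mon_scale)
    also have "mon (\<lambda>n. [:Var n:]) m = [:mon Var m:]"
      using mon_hom[of "\<lambda>x. [:x:]" Var m] by (simp add: rhom_def one_pCons)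
    finally show ?thesis by (simp add: monom_altdef mult.commute)
  qed
  have H: "?h F = (\<Sum>m\<in>Poly_Mapping.keys F. monom (Const (Poly_Mapping.lookup F m) * mon Var m) (mdeg m))"
    unfolding psub_def by (rule sum.cong) (auto simp: m smult_monom)
  show ?thesis
  proof
    assume hom: "homog D F"
    have "?h F = (\<Sum>m\<in>Poly_Mapping.keys F. monom (Const (Poly_Mapping.lookup F m) * mon Var m) D)"
      unfolding H by (rule sum.cong) (use hom in \<open>auto simp: homog_def\<close>)
    also have "\<dots> = monom (psub Const Var F) D"
      unfolding psub_def by (rule poly_eqI) (simp add: coeff_sum)
    finally show "?h F = monom F D" by simp
  next
    assume e: "?h F = monom F D"
    show "homog D F"
      unfolding homog_def
    proof (rule ballI, rule ccontr)
      fix m assume m: "m \<in> Poly_Mapping.keys F" and d: "mdeg m \<noteq> D"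
      have "coeff (?h F) (mdeg m) = 0" unfolding e using d by simp
      then have "(\<Sum>x\<in>Poly_Mapping.keys F. if mdeg x = mdeg m then Poly_Mapping.single x (Poly_Mapping.lookup F x) else 0) = 0"
        unfolding H coeff_sum single_eq_mon by (simp cong: if_cong)
      then have "(\<Sum>x\<in>Poly_Mapping.keys F. Poly_Mapping.lookup (if mdeg x = mdeg m then Poly_Mapping.single x (Poly_Mapping.lookup F x) else 0) m) = 0"
        unfolding lookup_sum[symmetric] by simp
      moreover have "Poly_Mapping.lookup (if mdeg x = mdeg m then Poly_Mapping.single x (Poly_Mapping.lookup F x) else 0) m
         = (if x = m then Poly_Mapping.lookup F m else 0)" for x
        by (auto simp: lookup_single)
      ultimately have "Poly_Mapping.lookup F m = 0" using m by simp
      then show False using m by (simp add: in_keys_iff)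
    qed
  qed
qed

lemma homog_cancel:
  assumes "homog (D + D') (p * q)" "homog D p" "p \<noteq> 0"
  shows "homog D' q"
proof -
  let ?h = "psub (\<lambda>c. [:Const c:]) (\<lambda>n. [:0, Var n:])"
  have h: "rhom (\<lambda>c. [:Const c:])" using rhom_Const by (simp add: rhom_def one_pCons)
  have "?h p * ?h q = ?h (p * q)" by (simp add: psub_mult[OF h])
  also have "\<dots> = monom p D * monom q D'" using assms(1) by (simp add: homog_iff_scale mult_monom)
  finally have "monom p D * ?h q = monom p D * monom q D'" using assms(2) by (simp add: homog_iff_scale)
  then have "?h q = monom q D'" using assms(3) by simp
  then show ?thesis by (simp add: homog_iff_scale)
qed

lemma homog_eval_fract:
  fixes X :: "nat \<Rightarrow> mpoly fract"
  assumes "homog D F" "c \<noteq> 0"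
  shows "psub (\<lambda>z. to_fract (Const z)) X F = c ^ D * psub (\<lambda>z. to_fract (Const z)) (\<lambda>n. X n / c) F"
proof -
  have X: "(\<lambda>n. c * (X n / c)) = X" using assms(2) by (intro ext) (rule nonzero_mult_div_cancel_left[of c, folded times_divide_eq_right])
  show ?thesis
    using psub_homog[OF assms(1), of "\<lambda>z. to_fract (Const z)" c "\<lambda>n. X n / c"] unfolding X .
qed

lemma rhom_to_fract: "rhom to_fract"
  by (simp add: rhom_def)

lemma rhom_to_fract_Const: "rhom (\<lambda>z. to_fract (Const z))"
  by (rule rhom_comp[OF rhom_Const rhom_to_fract])

lemma Var_nz [simp]: "Var k \<noteq> 0"
proof
  assume "Var k = 0"
  then have "meval (Var k) (\<lambda>_. 1) = 0" by (simp add: meval_eq_psub)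
  then show False by (simp add: meval_eq_psub rhom_id)
qed

text \<open>In the field of fractions F = x_k^D F(x / x_k), so the degree and the dehomogenisation
  determine F.\<close>

lemma dehom_inj:
  assumes "homog D F" "homog D F'" "dehom k F = dehom k F'"
  shows "F = F'"
proof -
  let ?e = "\<lambda>z. to_fract (Const z)" and ?X = "\<lambda>n. to_fract (Var n)"
  have *: "to_fract H = ?X k ^ D * psub ?e (\<lambda>n. ?X n / ?X k) (dehom k H)" if "homog D H" for H
  proof -
    have "to_fract H = to_fract (psub Const Var H)" by simp
    also have "\<dots> = psub ?e ?X H" by (rule psub_hom[OF rhom_to_fract])
    also have "\<dots> = ?X k ^ D * psub ?e (\<lambda>n. ?X n / ?X k) H" by (rule homog_eval_fract[OF that]) simp
    finally show ?thesis by (simp add: psub_dehom[OF rhom_to_fract_Const])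
  qed
  have "to_fract F = to_fract F'" using *[OF assms(1)] *[OF assms(2)] assms(3) by simp
  then show ?thesis by simp
qed

text \<open>All sufficiently large degrees are allowed, since sums need a common degree and later
  several polynomials have to be lifted to the same one. Powers of x_k, which become 1 in the chart,
  make up the difference.\<close>

lemma homogenization_exists:
  assumes "poly_in V u" "insert k V \<subseteq> {0,1,2}" "k \<notin> V"
  shows "\<exists>D0. \<forall>D\<ge>D0. \<exists>F. inS F \<and> homog D F \<and> dehom k F = u"
  using assms(1)
proof (induction rule: poly_in_induct)
  case (Const c)
  have "\<exists>F. inS F \<and> homog D F \<and> dehom k F = Const c" for D
    using assms(2) homog_power[OF homog_Var(1), of D k]
    by (intro exI[of _ "Const c * Var k ^ D"])
      (auto simp: rhom_simps[OF rhom_dehom] dehom_Var intro!: homog_Const_mult)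
  then show ?case by blast
next
  case (Var n)
  have "\<exists>F. inS F \<and> homog D F \<and> dehom k F = Var n" if "D \<ge> 1" for D
    using assms(2,3) homog_mult[OF homog_Var(1)[of n] homog_power[OF homog_Var(1)[of k], of "D - 1"]] Var that
    by (intro exI[of _ "Var n * Var k ^ (D - 1)"])
      (auto simp: rhom_simps[OF rhom_dehom] dehom_Var)
  then show ?case by blast
next
  case (add p q)
  then obtain D1 D2 where D: "\<And>D. D \<ge> D1 \<Longrightarrow> \<exists>F. inS F \<and> homog D F \<and> dehom k F = p"
    "\<And>D. D \<ge> D2 \<Longrightarrow> \<exists>F. inS F \<and> homog D F \<and> dehom k F = q" by blast
  have "\<exists>F. inS F \<and> homog D F \<and> dehom k F = p + q" if "D \<ge> max D1 D2" for D
  proof -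
    have "D1 \<le> D" "D2 \<le> D" using that by auto
    then obtain F1 F2 where F: "inS F1" "homog D F1" "dehom k F1 = p" "inS F2" "homog D F2" "dehom k F2 = q"
      using D(1)[of D] D(2)[of D] by blast
    then show ?thesis by (intro exI[of _ "F1 + F2"]) (simp add: homog_add rhom_add[OF rhom_dehom])
  qed
  then show ?case by blast
next
  case (mult p q)
  then obtain D1 D2 where D: "\<And>D. D \<ge> D1 \<Longrightarrow> \<exists>F. inS F \<and> homog D F \<and> dehom k F = p"
    "\<And>D. D \<ge> D2 \<Longrightarrow> \<exists>F. inS F \<and> homog D F \<and> dehom k F = q" by blast
  have "\<exists>F. inS F \<and> homog D F \<and> dehom k F = p * q" if "D \<ge> D1 + D2" for D
  proof -
    have "D1 \<le> D1" "D2 \<le> D - D1" using that by auto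
    then obtain F1 F2 where F: "inS F1" "homog D1 F1" "dehom k F1 = p" "inS F2" "homog (D - D1) F2" "dehom k F2 = q"
      using D(1)[of D1] D(2)[of "D - D1"] by blast
    have "homog D (F1 * F2)" using homog_mult[OF F(2,5)] that by simp
    then show ?thesis using F by (intro exI[of _ "F1 * F2"]) (simp add: rhom_mult[OF rhom_dehom])
  qed
  then show ?case by blast
qed

lemma Var_eq_lf: assumes "k < 3" shows "Var k = lf (\<lambda>n. if n = k then 1 else 0)"
proof -
  consider "k = 0" | "k = 1" | "k = 2" using assms by linarith
  then show ?thesis by cases (simp_all add: lf_def)
qed

lemma Var_prime: assumes "k < 3" shows "Var k dvd F * G \<longleftrightarrow> Var k dvd F \<or> Var k dvd G"
proof -
  define a where "a n = (if n = k then 1 else 0 :: complex)" for n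
  consider "k = 0" | "k = 1" | "k = 2" using assms by linarith
  then have "(a 0, a 1, a 2) \<noteq> (0, 0, 0)" by cases (simp_all add: a_def)
  then show ?thesis unfolding Var_eq_lf[OF assms] a_def[symmetric] by (rule lf_prime)
qed

text \<open>Homogenising a square factor found in a chart gives an equation only up to a power of
  x_k. As x_k is prime, it is stripped off one factor at a time: from \<open>h\<close>, or from one
  copy of \<open>q\<close> while the factor x_k of the other copy moves into
  \<open>h\<close>.\<close>

lemma square_factor_descent:
  assumes "k < 3" "inS q" "inS h" "q * q * h = f * Var k ^ e"
  shows "\<exists>q' h' j. inS q' \<and> inS h' \<and> q' * q' * h' = f \<and> q = q' * Var k ^ j"
  using assms(2-4)
proof (induction e arbitrary: q h rule: less_induct)
  case (less e)
  have kS: "inS (Var k)" using assms(1) by (rule inS_Var)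
  show ?case
  proof (cases e)
    case 0
    then show ?thesis using less.prems by (intro exI[of _ q] exI[of _ h] exI[of _ 0]) simp
  next
    case (Suc e')
    have "Var k dvd q * q * h" unfolding less.prems(3) Suc by simp
    then consider "Var k dvd h" | "Var k dvd q" using Var_prime[OF assms(1)] by blast
    then show ?thesis
    proof cases
      case 1
      then obtain h1 where h1: "h = Var k * h1" by (rule dvdE)
      have "inS h1" using less.prems(2) kS unfolding h1 by (rule inS_cancel) simp
      moreover have "Var k * (q * q * h1) = Var k * (f * Var k ^ e')"
        using less.prems(3) unfolding h1 Suc by (simp add: mult_ac)
      then have "q * q * h1 = f * Var k ^ e'" by simp
      ultimately show ?thesis using less.IH[of e' q h1] less.prems(1) Suc by simp
    next
      case 2
      then obtain q1 where q1: "q = Var k * q1" by (rule dvdE)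
      have q1S: "inS q1" using less.prems(1) kS unfolding q1 by (rule inS_cancel) simp
      have "Var k * (q1 * q1 * (Var k * h)) = Var k * (f * Var k ^ e')"
        using less.prems(3) unfolding q1 Suc by (simp add: mult_ac)
      then have "q1 * q1 * (Var k * h) = f * Var k ^ e'" by simp
      then obtain q' h' j where "inS q'" "inS h'" "q' * q' * h' = f" "q1 = q' * Var k ^ j"
        using less.IH[of e' q1 "Var k * h"] q1S kS less.prems(2) Suc by auto
      then show ?thesis unfolding q1 by (intro exI[of _ q'] exI[of _ h'] exI[of _ "Suc j"]) (simp add: mult_ac)
    qed
  qed
qed

section \<open>Derivatives in s and t, and restriction to s = 0\<close>

definition dS :: "bpoly \<Rightarrow> bpoly" where "dS = map_poly pderiv"

lemma coeff_dS: "coeff (dS F) j = pderiv (coeff F j)"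
  by (simp add: dS_def coeff_map_poly)

lemma dS_add: "dS (F + G) = dS F + dS G"
  by (rule poly_eqI) (simp add: coeff_dS pderiv_add)

lemma dS_mult: "dS (F * G) = dS F * G + F * dS G"
proof (rule poly_eqI)
  fix n
  have "pderiv (coeff (F * G) n) = (\<Sum>i\<le>n. pderiv (coeff F i) * coeff G (n - i) + coeff F i * pderiv (coeff G (n - i)))"
  proof -
    have "pderiv (sum f A) = (\<Sum>x\<in>A. pderiv (f x))" for f :: "nat \<Rightarrow> complex poly" and A
      using higher_pderiv_sum[of 1 f A] by simp
    then show ?thesis unfolding coeff_mult by (simp add: pderiv_mult mult.commute add.commute)
  qed
  then show "coeff (dS (F * G)) n = coeff (dS F * G + F * dS G) n"
    by (simp add: coeff_dS coeff_mult sum.distrib)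
qed

lemma dS_cc [simp]: "dS (cc c) = 0" and dS_sp [simp]: "dS sp = 1" and dS_tp [simp]: "dS tp = 0"
  by (simp_all add: dS_def cc_def sp_def tp_def map_poly_pCons pderiv_pCons one_pCons)

lemma dT_cc [simp]: "pderiv (cc c) = 0" and dT_sp [simp]: "pderiv sp = 0" and dT_tp [simp]: "pderiv tp = 1"
  by (simp_all add: cc_def sp_def tp_def pderiv_pCons one_pCons)

lemma pderiv_EP: "pderiv (EP F) = EP (pderiv F)"
  by (rule poly_eqI) (simp add: coeff_pderiv coeff_EP rhom_mult[OF rhom_fps_of_poly] rhom_of_nat[OF rhom_fps_of_poly] del: of_nat_Suc)

lemma map_fps_deriv_EP: "map_poly fps_deriv (EP F) = EP (dS F)"
  by (rule poly_eqI) (simp add: coeff_EP coeff_dS coeff_map_poly fps_of_poly_pderiv)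

lemma bpoly_induct:
  assumes "\<And>c. P (cc c)" "P sp" "P tp" "\<And>F G. P F \<Longrightarrow> P G \<Longrightarrow> P (F + G)" "\<And>F G. P F \<Longrightarrow> P G \<Longrightarrow> P (F * G)"
  shows "P F"
proof -
  have c: "P [:a:]" for a
  proof (induction a)
    case 0 show ?case using assms(1)[of 0] by (simp add: cc_def)
  next
    case (pCons x a)
    have "[:pCons x a:] = cc x + sp * [:a:]" by (simp add: cc_def sp_def)
    then show ?case using pCons assms by metis
  qed
  show ?thesis
  proof (induction F)
    case 0 show ?case using c[of 0] by simp
  next
    case (pCons a F)
    have "pCons a F = [:a:] + tp * F" by (simp add: tp_def)
    then show ?case using pCons c assms by metis
  qed
qed

lemma sp_dvd: assumes "sl (bemb F) = 0" shows "sp dvd F"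
proof -
  have z: "coeff (coeff F j) 0 = 0" for j
  proof -
    have "sl (bemb F) $ j = 0" using assms by simp
    then show ?thesis by simp
  qed
  have "F = sp * map_poly (poly_shift 1) F"
  proof (rule poly_eqI)
    fix j
    have "coeff F j = pCons 0 (poly_shift 1 (coeff F j))"
      using z[of j] by (intro poly_eqI) (auto simp: coeff_pCons coeff_poly_shift split: nat.splits)
    then show "coeff F j = coeff (sp * map_poly (poly_shift 1) F) j"
      by (simp add: sp_def coeff_map_poly)
  qed
  then show ?thesis by (rule dvdI)
qed

lemma id2_linear_change:
  assumes "(\<alpha> * \<delta> - \<beta> * \<gamma>) * i = (1::'r::comm_ring_1)"
  shows "id2 (\<alpha> * a + \<beta> * b) (\<gamma> * a + \<delta> * b) = id2 a b"
proof
  show "id2 (\<alpha> * a + \<beta> * b) (\<gamma> * a + \<delta> * b) \<subseteq> id2 a b"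
    by (rule id2_least[OF ideal_id2]) (rule id2I, rule refl)+
  have "(i * \<delta>) * (\<alpha> * a + \<beta> * b) + (- i * \<beta>) * (\<gamma> * a + \<delta> * b) = ((\<alpha> * \<delta> - \<beta> * \<gamma>) * i) * a"
    by (simp add: algebra_simps)
  then have a: "a = (i * \<delta>) * (\<alpha> * a + \<beta> * b) + (- i * \<beta>) * (\<gamma> * a + \<delta> * b)" using assms by simp
  have "(- i * \<gamma>) * (\<alpha> * a + \<beta> * b) + (i * \<alpha>) * (\<gamma> * a + \<delta> * b) = ((\<alpha> * \<delta> - \<beta> * \<gamma>) * i) * b"
    by (simp add: algebra_simps)
  then have b: "b = (- i * \<gamma>) * (\<alpha> * a + \<beta> * b) + (i * \<alpha>) * (\<gamma> * a + \<delta> * b)" using assms by simp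
  show "id2 a b \<subseteq> id2 (\<alpha> * a + \<beta> * b) (\<gamma> * a + \<delta> * b)"
    by (rule id2_least[OF ideal_id2 id2I[OF a] id2I[OF b]])
qed

lemma id3_eq_of_id2:
  assumes "id2 a b = id2 a' b'"
  shows "id3 c a b = id3 c a' b'"
proof -
  have "id3 c a b = {x. \<exists>\<gamma>. x - \<gamma> * c \<in> id2 a b}" for a b :: 'a
  proof (intro set_eqI iffI)
    fix x assume "x \<in> id3 c a b"
    then obtain \<gamma> \<alpha> \<beta> where "x = \<gamma> * c + \<alpha> * a + \<beta> * b" unfolding id3_def by blast
    then have "x - \<gamma> * c = \<alpha> * a + \<beta> * b" by simp
    then show "x \<in> {x. \<exists>\<gamma>. x - \<gamma> * c \<in> id2 a b}" using id2I by blast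
  next
    fix x assume "x \<in> {x. \<exists>\<gamma>. x - \<gamma> * c \<in> id2 a b}"
    then obtain \<gamma> \<alpha> \<beta> where "x - \<gamma> * c = \<alpha> * a + \<beta> * b" unfolding id2_def by blast
    then have "x = \<gamma> * c + \<alpha> * a + \<beta> * b" by (simp add: algebra_simps)
    then show "x \<in> id3 c a b" by (rule id3I)
  qed
  then show ?thesis using assms by simp
qed

section \<open>Affine charts adapted to a line\<close>

text \<open>\<open>(s, t) \<mapsto> p + s w + t v\<close> parametrises the chart \<open>x_k = 1\<close>; \<open>ph\<close> is the pull-back and \<open>psi\<close> its inverse.\<close>

locale affine_frame =
  fixes p w v :: "nat \<Rightarrow> complex" and i j k :: nat
  assumes ij: "i < j" and ijk: "{i, j, k} = {0, 1, 2}" and ki: "k \<noteq> i" and kj: "k \<noteq> j"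
    and pk: "p k = 1" and wk: "w k = 0" and vk: "v k = 0"
    and det: "w i * v j - w j * v i \<noteq> 0"
begin

definition rho :: "nat \<Rightarrow> bpoly" where
  "rho n = cc (p n) + cc (w n) * sp + cc (v n) * tp"

definition ph :: "mpoly \<Rightarrow> bpoly" where
  "ph = psub cc rho"

lemma rhom_ph: "rhom ph"
  unfolding ph_def by (rule rhom_psub[OF rhom_cc])

lemma ph_Const [simp]: "ph (Const c) = cc c" and ph_Var [simp]: "ph (Var n) = rho n"
  by (simp_all add: ph_def rhom_cc)

lemma rho_k: "rho k = 1"
  by (simp add: rho_def pk wk vk rhom_0[OF rhom_cc] rhom_1[OF rhom_cc])

lemma ph_dehom [simp]: "ph (dehom k F) = ph F"
  unfolding ph_def by (rule psub_dehom[OF rhom_cc, where \<rho> = rho, OF rho_k])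

definition D :: complex where "D = w i * v j - w j * v i"

text \<open>\<open>ls\<close> and \<open>lt\<close> solve x - p = s w + t v for s and t by Cramer's
  rule.\<close>

definition ls :: mpoly where
  "ls = Const (v j / D) * (Var i - Const (p i)) - Const (v i / D) * (Var j - Const (p j))"

definition lt :: mpoly where
  "lt = Const (w i / D) * (Var j - Const (p j)) - Const (w j / D) * (Var i - Const (p i))"

definition psi :: "bpoly \<Rightarrow> mpoly" where
  "psi F = poly (map_poly (\<lambda>a. poly (map_poly Const a) ls) F) lt"

lemma rhom_poly: "rhom (\<lambda>q. poly q x)"
  by (simp add: rhom_def)

lemma rhom_psi: "rhom psi"
proof -
  have "rhom (\<lambda>a. poly (map_poly Const a) ls)"
    by (rule rhom_comp[OF rhom_map_poly[OF rhom_Const] rhom_poly])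
  from rhom_comp[OF rhom_map_poly[OF this] rhom_poly] show ?thesis unfolding psi_def .
qed

lemma psi_cc [simp]: "psi (cc c) = Const c" and psi_sp [simp]: "psi sp = ls" and psi_tp [simp]: "psi tp = lt"
  by (simp_all add: psi_def cc_def sp_def tp_def map_poly_pCons)

lemma D_nz: "D \<noteq> 0"
  using det by (simp add: D_def)

lemma ph_ls [simp]: "ph ls = sp" and ph_lt [simp]: "ph lt = tp"
proof -
  have "ph ls = cc (v j / D) * (cc (w i) * sp + cc (v i) * tp) - cc (v i / D) * (cc (w j) * sp + cc (v j) * tp)"
    by (simp add: ls_def rhom_simps[OF rhom_ph] rho_def)
  also have "\<dots> = cc (v j / D * w i - v i / D * w j) * sp + cc (v j / D * v i - v i / D * v j) * tp"
    unfolding rhom_diff[OF rhom_cc] rhom_mult[OF rhom_cc] by (simp add: algebra_simps)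
  also have "v j / D * w i - v i / D * w j = (w i * v j - w j * v i) / D" by (simp add: diff_divide_distrib mult.commute)
  also have "\<dots> = 1" unfolding D_def[symmetric] using D_nz by simp
  finally show "ph ls = sp" by (simp add: rhom_simps[OF rhom_cc])
  have "ph lt = cc (w i / D) * (cc (w j) * sp + cc (v j) * tp) - cc (w j / D) * (cc (w i) * sp + cc (v i) * tp)"
    by (simp add: lt_def rhom_simps[OF rhom_ph] rho_def)
  also have "\<dots> = cc (w i / D * w j - w j / D * w i) * sp + cc (w i / D * v j - w j / D * v i) * tp"
    unfolding rhom_diff[OF rhom_cc] rhom_mult[OF rhom_cc] by (simp add: algebra_simps)
  also have "w i / D * v j - w j / D * v i = (w i * v j - w j * v i) / D" by (simp add: diff_divide_distrib)
  also have "\<dots> = 1" unfolding D_def[symmetric] using D_nz by simp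
  finally show "ph lt = tp" by (simp add: rhom_simps[OF rhom_cc])
qed

lemma ph_psi [simp]: "ph (psi F) = F"
  by (rule bpoly_induct[of "\<lambda>F. ph (psi F) = F"]) (simp_all add: rhom_simps[OF rhom_psi] rhom_simps[OF rhom_ph])

lemma psi_rho: "n \<in> {i, j} \<Longrightarrow> psi (rho n) = Var n"
proof -
  have "psi (rho n) = Const (p n) + Const (w n) * ls + Const (v n) * lt"
    by (simp add: rho_def rhom_simps[OF rhom_psi])
  also have "\<dots> = Const (p n) + Const ((w n * v j - v n * w j) / D) * (Var i - Const (p i))
     + Const ((v n * w i - w n * v i) / D) * (Var j - Const (p j))"
    by (simp add: ls_def lt_def Const_mult Const_diff diff_divide_distrib algebra_simps)
      (simp add: Const_mult[symmetric] mult_ac)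
  finally have *: "psi (rho n) = Const (p n) + Const ((w n * v j - v n * w j) / D) * (Var i - Const (p i))
     + Const ((v n * w i - w n * v i) / D) * (Var j - Const (p j))" .
  have 1: "(w i * v j - v i * w j) / D = 1" "(v j * w i - w j * v i) / D = 1"
    using D_nz by (simp_all add: D_def mult.commute)
  assume "n \<in> {i, j}"
  then consider "n = i" | "n = j" by blast
  then show "psi (rho n) = Var n"
  proof cases
    case 1
    have "(v i * w i - w i * v i) / D = 0" by simp
    then show ?thesis using * 1 \<open>(w i * v j - v i * w j) / D = 1\<close> by (simp only: Const_0 Const_1) simp
  next
    case 2
    have "(w j * v j - v j * w j) / D = 0" by simp
    then show ?thesis using * 2 \<open>(v j * w i - w j * v i) / D = 1\<close> by (simp only: Const_0 Const_1) simp
  qed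
qed

lemma psi_ph: assumes "poly_in {i, j} u" shows "psi (ph u) = u"
  using assms
  by (induction rule: poly_in_induct) (simp_all add: psi_rho rhom_simps[OF rhom_psi] rhom_simps[OF rhom_ph])

lemma poly_in_psi: "poly_in {i, j} (psi F)"
proof (rule bpoly_induct[of "\<lambda>F. poly_in {i, j} (psi F)"])
  show "poly_in {i, j} (psi sp)" "poly_in {i, j} (psi tp)" by (auto simp: ls_def lt_def)
qed (auto simp: rhom_simps[OF rhom_psi])

lemma val0_ph: "val0 (ph s) = meval s p"
proof -
  have "val0 (ph s) = psub (\<lambda>c. val0 (cc c)) (\<lambda>n. val0 (rho n)) s"
    unfolding ph_def by (rule psub_hom[OF rhom_val0])
  also have "(\<lambda>c. val0 (cc c)) = (\<lambda>c. c)" by (simp add: val0_def cc_def)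
  also have "(\<lambda>n. val0 (rho n)) = p"
    by (simp add: rho_def rhom_simps[OF rhom_val0]) (simp add: val0_def cc_def sp_def tp_def)
  finally show ?thesis by (simp add: meval_eq_psub)
qed

lemma loc_ideal_iff:
  assumes G: "\<And>x. x \<in> set G \<Longrightarrow> poly_in {i, j} x" and u: "poly_in {i, j} u"
  shows "loc_ideal {i, j} G p u \<longleftrightarrow> lid (map ph G) (ph u)"
proof
  assume "loc_ideal {i, j} G p u"
  then obtain s x where s: "meval s p \<noteq> 0" "s * u = (\<Sum>n<length G. x n * G ! n)"
    unfolding loc_ideal_def by blast
  then have "ph s * ph u = (\<Sum>n<length (map ph G). ph (x n) * map ph G ! n)"
    by (simp add: rhom_mult[OF rhom_ph, symmetric]) (simp add: rhom_simps[OF rhom_ph])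
  then have "ph s * ph u \<in> idl (map ph G)" by (rule idlI)
  then show "lid (map ph G) (ph u)" unfolding lid_def using s(1) val0_ph by metis
next
  assume "lid (map ph G) (ph u)"
  then obtain s x where s: "val0 s \<noteq> 0" "s * ph u = (\<Sum>n<length G. x n * ph (G ! n))"
    unfolding lid_def idl_def by auto
  have "psi s * u = psi (s * ph u)" using psi_ph[OF u] by (simp add: rhom_mult[OF rhom_psi])
  also have "\<dots> = (\<Sum>n<length G. psi (x n) * psi (ph (G ! n)))"
    unfolding s(2) by (simp add: rhom_simps[OF rhom_psi])
  also have "\<dots> = (\<Sum>n<length G. psi (x n) * G ! n)"
    by (rule sum.cong) (auto simp: psi_ph G)
  finally have "psi s * u = (\<Sum>n<length G. psi (x n) * G ! n)" .
  moreover have "meval (psi s) p \<noteq> 0" using s(1) val0_ph[of "psi s"] by simp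
  ultimately show "loc_ideal {i, j} G p u"
    unfolding loc_ideal_def using poly_in_psi by (intro exI[of _ "psi s"] exI[of _ "\<lambda>n. psi (x n)"]) simp
qed

text \<open>Independence of polynomials modulo the local ideal is independence in the completion. A
  formal spanning family bounds its size, and a polynomial basis attains the bound.\<close>

theorem loc_dim_eq:
  assumes G: "\<And>x. x \<in> set G \<Longrightarrow> poly_in {i, j} x"
    and fin: "Ser.codim (idl (map bemb (map ph G))) n"
  shows "loc_dim {i, j} G p = enat n"
proof -
  have li: "loc_ideal {i, j} G p u \<longleftrightarrow> bemb (ph u) \<in> idl (map bemb (map ph G))" if "poly_in {i, j} u" for u
    using loc_ideal_iff[OF G that] lid_iff_completion[OF fin] by simp
  have lind: "loc_indep {i, j} G p m P \<longleftrightarrow> Ser.ind (idl (map bemb (map ph G))) m (\<lambda>i. bemb (ph (P i)))"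
    if P: "\<forall>n<m. poly_in {i, j} (P n)" for m P
  proof -
    have "poly_in {i, j} (\<Sum>i<m. Const (c i) * P i)" for c
      using P by (intro poly_in_sum) auto
    moreover have "bemb (ph (\<Sum>i<m. Const (c i) * P i)) = (\<Sum>i<m. ec (c i) * bemb (ph (P i)))" for c
      by (simp add: rhom_simps[OF rhom_ph] rhom_simps[OF rhom_bemb])
    ultimately show ?thesis unfolding loc_indep_def Ser.ind_def using P li by simp
  qed
  obtain b where b: "Ser.spans (idl (map bemb (map ph G))) n b" using fin unfolding Ser.codim_def by blast
  obtain x where x: "Ser.ind (idl (map bemb (map ph G))) n (\<lambda>i. bemb (x i))" using codim_poly_basis[OF fin] by blast
  have ex: "loc_indep {i, j} G p n (\<lambda>i. psi (x i))"
    using lind[of n "\<lambda>i. psi (x i)"] x poly_in_psi by simp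
  have le: "m \<le> n" if "loc_indep {i, j} G p m P" for m P
  proof -
    have "\<forall>n<m. poly_in {i, j} (P n)" using that unfolding loc_indep_def by blast
    then show ?thesis using Ser.ind_le_spans[OF ideal_idl b] lind that by blast
  qed
  show ?thesis
    unfolding loc_dim_def
  proof (rule antisym)
    show "Sup {enat n |n. \<exists>P. loc_indep {i, j} G p n P} \<le> enat n"
      by (rule Sup_least) (use le in auto)
    show "enat n \<le> Sup {enat n |n. \<exists>P. loc_indep {i, j} G p n P}"
      by (rule Sup_upper) (use ex in blast)
  qed
qed

lemma sum_ijk: "(f::nat \<Rightarrow> 'a::comm_monoid_add) 0 + f 1 + f 2 = f i + f j + f k"
proof -
  have "(\<Sum>n\<in>{i, j, k}. f n) = f i + f j + f k" using ij ki kj by (simp add: add.assoc)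
  moreover have "(\<Sum>n\<in>{0, 1, 2}. f n) = f 0 + f 1 + f 2" by (simp add: add.assoc)
  ultimately show ?thesis using ijk by simp
qed

lemma chain_rule:
  assumes "inS F"
  shows "dS (ph F) = cc (w i) * ph (pder i F) + cc (w j) * ph (pder j F)"
    and "pderiv (ph F) = cc (v i) * ph (pder i F) + cc (v j) * ph (pder j F)"
proof -
  have S: "{0, 1, 2} = {i, j, k}" using ijk by simp
  note h = rhom_simps[OF rhom_ph] rhom_simps[OF rhom_cc]
  have "dS (ph F) = cc (w i) * ph (pder i F) + cc (w j) * ph (pder j F) \<and>
     pderiv (ph F) = cc (v i) * ph (pder i F) + cc (v j) * ph (pder j F)"
    using assms
  proof (induction rule: poly_in_induct)
    case (Var n)
    have r: "dS (rho n) = cc (w n)" "pderiv (rho n) = cc (v n)"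
      by (simp_all add: rho_def dS_add dS_mult pderiv_add pderiv_mult)
    from Var consider "n = i" | "n = j" | "n = k" unfolding S by blast
    then show ?case
    proof cases
      case 1 then show ?thesis using r ij by (simp add: pder_Var h)
    next
      case 2 then show ?thesis using r ij by (simp add: pder_Var h)
    next
      case 3 then show ?thesis using r ki kj by (simp add: pder_Var h wk vk)
    qed
  qed (simp_all add: pder_add pder_mult dS_add dS_mult pderiv_add pderiv_mult h algebra_simps)
  then show "dS (ph F) = cc (w i) * ph (pder i F) + cc (w j) * ph (pder j F)"
    and "pderiv (ph F) = cc (v i) * ph (pder i F) + cc (v j) * ph (pder j F)" by auto
qed

lemma jacobian_ideal:
  assumes "inS F"
  shows "id2 (bemb (dS (ph F))) (bemb (pderiv (ph F))) = id2 (bemb (ph (pder i F))) (bemb (ph (pder j F)))"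
proof -
  have "(ec (w i) * ec (v j) - ec (w j) * ec (v i)) * ec (1 / D) = ec (D * (1 / D))"
    by (simp only: D_def rhom_simps[OF rhom_ec])
  also have "\<dots> = 1" using D_nz by (simp add: rhom_1[OF rhom_ec])
  finally show ?thesis
    unfolding chain_rule[OF assms] rhom_add[OF rhom_bemb] rhom_mult[OF rhom_bemb] bemb_cc
    by (rule id2_linear_change)
qed

lemma milnor_tjurina_eq:
  assumes F: "inS F" and z: "meval F p = 0" and ch: "chart p = k"
  shows "Ser.codim (id2 (bemb (dS (ph F))) (bemb (pderiv (ph F)))) n \<Longrightarrow> milnor F p = enat n"
    and "Ser.codim (id3 (bemb (ph F)) (bemb (dS (ph F))) (bemb (pderiv (ph F)))) n \<Longrightarrow> tjurina F p = enat n"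
proof -
  have cv: "chart_vars p = {i, j}" unfolding chart_vars_def ch ijk[symmetric] using ki kj by auto
  have sl: "sorted_list_of_set {i, j} = [i, j]" using ij by simp
  have V: "{0, 1, 2} - {k} = {i, j}" unfolding ijk[symmetric] using ki kj by auto
  have inV: "poly_in {i, j} (dehom k F)" using poly_in_dehom[OF F, of k] unfolding V .
  have pd: "ph (pder i (dehom k F)) = ph (pder i F)" "ph (pder j (dehom k F)) = ph (pder j F)"
    using pder_dehom[of i k F] pder_dehom[of j k F] ki kj by auto
  show "milnor F p = enat n" if "Ser.codim (id2 (bemb (dS (ph F))) (bemb (pderiv (ph F)))) n"
  proof -
    have "loc_dim {i, j} [pder i (dehom k F), pder j (dehom k F)] p = enat n"
      by (rule loc_dim_eq) (use that inV in \<open>auto simp: poly_in_pder idl_2 pd jacobian_ideal[OF F]\<close>)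
    then show ?thesis using z by (simp add: milnor_def cv ch sl)
  qed
  show "tjurina F p = enat n" if "Ser.codim (id3 (bemb (ph F)) (bemb (dS (ph F))) (bemb (pderiv (ph F)))) n"
  proof -
    have "loc_dim {i, j} [dehom k F, pder i (dehom k F), pder j (dehom k F)] p = enat n"
      by (rule loc_dim_eq) (use that inV in \<open>auto simp: poly_in_pder idl_3 pd id3_eq_of_id2[OF jacobian_ideal[OF F]]\<close>)
    then show ?thesis using z by (simp add: tjurina_def cv ch sl)
  qed
qed

end

text \<open>\<open>Phi N \<theta> = det (N, X, \<theta>)\<close> for the generic point \<open>X\<close>. On the line \<open>l\<close>, where \<open>l(N) = 1\<close> and \<open>\<theta>\<close> is tangent,
  it measures the component of \<open>\<theta>\<close> along \<open>l\<close> modulo the Euler derivation.\<close>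

definition det3 :: "(nat \<Rightarrow> 'r::comm_ring_1) \<Rightarrow> (nat \<Rightarrow> 'r) \<Rightarrow> (nat \<Rightarrow> 'r) \<Rightarrow> 'r" where
  "det3 x y z = x 0 * (y 1 * z 2 - y 2 * z 1) - x 1 * (y 0 * z 2 - y 2 * z 0) + x 2 * (y 0 * z 1 - y 1 * z 0)"

definition dcoef :: "deriv \<Rightarrow> nat \<Rightarrow> mpoly" where
  "dcoef \<theta> n = (case \<theta> of (g0, g1, g2) \<Rightarrow> if n = 0 then g0 else if n = 1 then g1 else g2)"

lemma dcoef_simps [simp]: "dcoef (g0, g1, g2) 0 = g0" "dcoef (g0, g1, g2) (Suc 0) = g1" "dcoef (g0, g1, g2) 2 = g2"
  by (simp_all add: dcoef_def)

lemma D0_iff: "\<theta> \<in> D0 f \<longleftrightarrow> inS (dcoef \<theta> 0) \<and> inS (dcoef \<theta> 1) \<and> inS (dcoef \<theta> 2) \<and>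
    dcoef \<theta> 0 * pder 0 f + dcoef \<theta> 1 * pder 1 f + dcoef \<theta> 2 * pder 2 f = 0"
  by (cases \<theta>) (simp add: D0_def)

lemma homog_deriv_iff: "homog_deriv e \<theta> \<longleftrightarrow> homog e (dcoef \<theta> 0) \<and> homog e (dcoef \<theta> 1) \<and> homog e (dcoef \<theta> 2)"
  by (cases \<theta>) (simp add: homog_deriv_def)

definition act :: "(nat \<Rightarrow> mpoly) \<Rightarrow> mpoly \<Rightarrow> mpoly" where
  "act g F = g 0 * pder 0 F + g 1 * pder 1 F + g 2 * pder 2 F"

definition Phi :: "(nat \<Rightarrow> complex) \<Rightarrow> deriv \<Rightarrow> mpoly" where
  "Phi N \<theta> = det3 (\<lambda>n. Const (N n)) Var (dcoef \<theta>)"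

lemma act_mult: "act g (F * H) = act g F * H + F * act g H"
  by (simp add: act_def pder_mult algebra_simps)

lemma act_lf: "act g (lf a) = Const (a 0) * g 0 + Const (a 1) * g 1 + Const (a 2) * g 2"
  by (simp add: act_def lf_def pder_add pder_mult pder_Var algebra_simps)

text \<open>Restriction to the line through \<open>p\<close> in the direction \<open>v\<close>,
  expanded at \<open>p\<close>.\<close>

definition line_ev :: "(nat \<Rightarrow> complex) \<Rightarrow> (nat \<Rightarrow> complex) \<Rightarrow> mpoly \<Rightarrow> complex fps" where
  "line_ev p v F = psub fps_const (\<lambda>n. fps_const (p n) + fps_const (v n) * fps_X) F"

text \<open>In \<theta>(f) l + f \<theta>(l) = 0 the line divides f \<theta>(l); being prime and not
  a factor of f it divides \<theta>(l). Cancelling it leaves f dividing \<theta>(f).\<close>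

lemma logarithmic_of_product:
  assumes nz: "(a 0, a 1, a 2) \<noteq> (0, 0, 0)" and nd: "\<not> lf a dvd f"
    and z: "act g (f * lf a) = 0"
  shows "lf a dvd act g (lf a)" and "f dvd act g f"
proof -
  have e: "act g f * lf a + f * act g (lf a) = 0" using z by (simp add: act_mult)
  then have "f * act g (lf a) = lf a * (- act g f)" by (simp add: eq_neg_iff_add_eq_0 mult.commute add.commute)
  then have "lf a dvd f * act g (lf a)" by (rule dvdI)
  then show 1: "lf a dvd act g (lf a)" using nd lf_prime[of a, OF nz] by blast
  then obtain h where "act g (lf a) = lf a * h" by (rule dvdE)
  then have "lf a * act g f = lf a * (f * (- h))" using e by (simp add: algebra_simps eq_neg_iff_add_eq_0)
  then have "act g f = f * (- h)" by (rule mult_left_cancel[OF lf_nz[OF nz], THEN iffD1])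
  then show "f dvd act g f" by (rule dvdI)
qed

text \<open>The normalisations make the pull-back of \<open>lf a\<close> equal to s on the nose
  (\<open>ph_lf\<close>), so the local formula applies without a correcting unit.\<close>

locale line_frame = affine_frame +
  fixes a :: "nat \<Rightarrow> complex"
  assumes ap: "a 0 * p 0 + a 1 * p 1 + a 2 * p 2 = 0"
    and aw: "a 0 * w 0 + a 1 * w 1 + a 2 * w 2 = 1"
    and av: "a 0 * v 0 + a 1 * v 1 + a 2 * v 2 = 0"
begin

lemma a_nz: "(a 0, a 1, a 2) \<noteq> (0, 0, 0)"
  using aw by auto

lemma ph_lf [simp]: "ph (lf a) = sp"
proof -
  have "ph (lf a) = cc (a 0) * rho 0 + cc (a 1) * rho 1 + cc (a 2) * rho 2"
    by (simp add: lf_def rhom_simps[OF rhom_ph])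
  also have "\<dots> = cc (a 0 * p 0 + a 1 * p 1 + a 2 * p 2) + cc (a 0 * w 0 + a 1 * w 1 + a 2 * w 2) * sp + cc (a 0 * v 0 + a 1 * v 1 + a 2 * v 2) * tp"
    unfolding rho_def rhom_add[OF rhom_cc] rhom_mult[OF rhom_cc] by (simp add: algebra_simps)
  finally show ?thesis unfolding ap aw av by (simp add: rhom_simps[OF rhom_cc])
qed

lemma sl_bemb_ph: "sl (bemb (ph F)) = line_ev p v F"
proof -
  have h: "rhom (\<lambda>x. sl (bemb x))" by (rule rhom_comp[OF rhom_bemb rhom_sl])
  have "sl (bemb (ph F)) = psub (\<lambda>c. sl (bemb (cc c))) (\<lambda>n. sl (bemb (rho n))) F"
    unfolding ph_def by (rule psub_hom[OF h])
  also have "(\<lambda>n. sl (bemb (rho n))) = (\<lambda>n. fps_const (p n) + fps_const (v n) * fps_X)"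
    by (simp add: rho_def rhom_simps[OF rhom_bemb] rhom_simps[OF rhom_sl])
  finally show ?thesis by (simp add: line_ev_def)
qed

lemma frame_coords:
  fixes u :: "nat \<Rightarrow> bpoly"
  assumes "u k = 0"
  shows "\<exists>A B. \<forall>n\<in>{i, j, k}. u n = cc (w n) * A + cc (v n) * B"
proof (intro exI ballI)
  let ?A = "cc (1 / D) * (cc (v j) * u i - cc (v i) * u j)"
  let ?B = "cc (1 / D) * (cc (w i) * u j - cc (w j) * u i)"
  have one: "cc (1 / D) * cc D = 1" using D_nz by (simp add: rhom_simps[OF rhom_cc] flip: rhom_mult[OF rhom_cc])
  have cD: "cc D = cc (w i) * cc (v j) - cc (w j) * cc (v i)"
    unfolding D_def by (simp add: rhom_simps[OF rhom_cc])
  fix n assume "n \<in> {i, j, k}"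
  then consider "n = i" | "n = j" | "n = k" by blast
  then show "u n = cc (w n) * ?A + cc (v n) * ?B"
  proof cases
    case 1
    have "cc (w i) * ?A + cc (v i) * ?B = (cc (1 / D) * cc D) * u i" unfolding cD by (simp add: algebra_simps)
    then show ?thesis using 1 one by simp
  next
    case 2
    have "cc (w j) * ?A + cc (v j) * ?B = (cc (1 / D) * cc D) * u j" unfolding cD by (simp add: algebra_simps)
    then show ?thesis using 2 one by simp
  next
    case 3
    then show ?thesis using assms wk vk by (simp add: rhom_0[OF rhom_cc])
  qed
qed

lemma frame_action:
  assumes u: "\<And>n. n \<in> {i, j, k} \<Longrightarrow> u n = cc (w n) * A + cc (v n) * B" and F: "inS F"
  shows "u 0 * ph (pder 0 F) + u 1 * ph (pder 1 F) + u 2 * ph (pder 2 F) = A * dS (ph F) + B * pderiv (ph F)"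
proof -
  have "u 0 * ph (pder 0 F) + u 1 * ph (pder 1 F) + u 2 * ph (pder 2 F) =
    u i * ph (pder i F) + u j * ph (pder j F) + u k * ph (pder k F)"
    by (rule sum_ijk)
  then show ?thesis
    using u[of i] u[of j] u[of k] by (simp add: chain_rule[OF F] wk vk rhom_0[OF rhom_cc] algebra_simps)
qed

text \<open>Multiples of the point do not change the determinant and \<open>A\<close> vanishes on
  the line. What remains is det (N, p + t v, B v) = B det (N, p, v).\<close>

lemma sl_Phi:
  assumes u: "\<And>n. n \<in> {i, j, k} \<Longrightarrow> ph (dcoef \<theta> n) = cc (w n) * A + cc (v n) * B + c * rho n" and A: "sp dvd A"
  shows "sl (bemb (ph (Phi N \<theta>))) = fps_const (det3 N p v) * sl (bemb B)"
proof -
  have all: "\<forall>n\<in>{0,1,2}. ph (dcoef \<theta> n) = cc (w n) * A + cc (v n) * B + c * rho n" using u ijk by blast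
  have "sl (bemb A) = 0" using A by (auto elim!: dvdE simp: rhom_simps[OF rhom_bemb] rhom_simps[OF rhom_sl])
  have c: "sl (bemb (ph (dcoef \<theta> n))) = fps_const (v n) * sl (bemb B) + sl (bemb c) * (fps_const (p n) + fps_const (v n) * fps_X)"
    if n: "n \<in> {0,1,2}" for n
  proof -
    have "ph (dcoef \<theta> n) = cc (w n) * A + cc (v n) * B + c * rho n" using all n by blast
    then show ?thesis using \<open>sl (bemb A) = 0\<close> by (simp add: rhom_simps[OF rhom_bemb] rhom_simps[OF rhom_sl] rho_def)
  qed
  show ?thesis
    unfolding Phi_def det3_def using c[of 0] c[of 1] c[of 2]
    by (simp add: rhom_simps[OF rhom_ph] rhom_simps[OF rhom_bemb] rhom_simps[OF rhom_sl] rho_def algebra_simps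
      flip: fps_const_add fps_const_mult fps_const_sub)
qed

lemma homog_ph_inj:
  assumes "inS F" "inS F'" "homog e F" "homog e F'" "ph F = ph F'"
  shows "F = F'"
proof -
  have V: "{0, 1, 2} - {k} = {i, j}" unfolding ijk[symmetric] using ki kj by auto
  have "dehom k F = psi (ph F)" if "inS F" for F
    using psi_ph[of "dehom k F"] poly_in_dehom[OF that, of k] unfolding V by simp
  then have "dehom k F = dehom k F'" using assms(1,2,5) by metis
  then show ?thesis using dehom_inj[OF assms(3,4)] by blast
qed

lemma homogenize:
  "\<exists>e0. \<forall>e\<ge>e0. \<exists>F. inS F \<and> homog e F \<and> ph F = u"
proof -
  have V: "insert k {i, j} \<subseteq> {0, 1, 2}" "k \<notin> {i, j}"
    using ki kj by (unfold ijk[symmetric], blast, simp)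
  obtain e0 where e0: "\<forall>e\<ge>e0. \<exists>F. inS F \<and> homog e F \<and> dehom k F = psi u"
    using homogenization_exists[OF poly_in_psi[of u] V] by (rule exE)
  have "\<exists>F. inS F \<and> homog e F \<and> ph F = u" if "e \<ge> e0" for e
  proof -
    have "\<exists>F. inS F \<and> homog e F \<and> dehom k F = psi u" using e0 that by simp
    then obtain F where F: "inS F" "homog e F" "dehom k F = psi u" by blast
    have "ph F = u" using arg_cong[OF F(3), of ph] by simp
    then show ?thesis using F by blast
  qed
  then show ?thesis by blast
qed

lemma k_less_3: "k < 3"
proof -
  have "k \<in> {0, 1, 2}" using ijk by blast
  then show ?thesis by auto
qed

text \<open>Reducedness is assumed for the form \<open>f\<close> but needed for its equation in the
  chart. The square factor is homogenised, and the power of x_k this introduces is removed by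
  \<open>square_factor_descent\<close>.\<close>

lemma ph_squarefree:
  assumes f: "inS f" "homog d f" and sqf: "\<And>q h. inS q \<Longrightarrow> inS h \<Longrightarrow> f = q * q * h \<Longrightarrow> \<exists>c. q = Const c"
    and g: "ph f = q * q * h"
  shows "degree q = 0"
proof -
  obtain e1 where e1: "\<And>e. e \<ge> e1 \<Longrightarrow> \<exists>F. inS F \<and> homog e F \<and> ph F = q" using homogenize by blast
  obtain e2 where e2: "\<And>e. e \<ge> e2 \<Longrightarrow> \<exists>F. inS F \<and> homog e F \<and> ph F = h" using homogenize by blast
  obtain Q where Q: "inS Q" "homog e1 Q" "ph Q = q" using e1 by blast
  obtain H where H: "inS H" "homog (e2 + d) H" "ph H = h" using e2[of "e2 + d"] by auto
  have kS: "inS (Var k)" using k_less_3 by (rule inS_Var)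
  have "Q * Q * H = f * Var k ^ (e1 + e1 + e2)"
  proof (rule homog_ph_inj)
    show "homog (e1 + e1 + (e2 + d)) (Q * Q * H)" by (intro homog_mult Q H)
    show "homog (e1 + e1 + (e2 + d)) (f * Var k ^ (e1 + e1 + e2))"
      using homog_mult[OF f(2) homog_power[OF homog_Var(1)[of k], of "e1 + e1 + e2"]] by (simp add: add_ac)
    show "ph (Q * Q * H) = ph (f * Var k ^ (e1 + e1 + e2))"
      using Q H g rho_k by (simp add: rhom_simps[OF rhom_ph])
  qed (use Q H f kS in auto)
  from square_factor_descent[OF k_less_3 Q(1) H(1) this] obtain q' h' l where
    q': "inS q'" "inS h'" "q' * q' * h' = f" "Q = q' * Var k ^ l" by blast
  obtain c where "q' = Const c" using sqf[OF q'(1,2)] q'(3) by blast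
  then have "q = cc c" using Q(3) q'(4) rho_k by (simp add: rhom_simps[OF rhom_ph])
  then show ?thesis by (simp add: cc_def)
qed

text \<open>If the pull-back vanished on s = 0, the line would divide f x_k^n, hence x_k^n; but x_k
  becomes 1 in the chart, where the line is s.\<close>

lemma ph_not_dvd:
  assumes f: "inS f" "homog d f" and nd: "\<not> lf a dvd f"
  shows "sl (bemb (ph f)) \<noteq> 0"
proof
  assume "sl (bemb (ph f)) = 0"
  then obtain h where h: "ph f = sp * h" using sp_dvd by (metis dvdE)
  obtain e2 where e2: "\<And>e. e \<ge> e2 \<Longrightarrow> \<exists>F. inS F \<and> homog e F \<and> ph F = h" using homogenize by blast
  obtain H where H: "inS H" "homog (e2 + d) H" "ph H = h" using e2[of "e2 + d"] by auto
  have kS: "inS (Var k)" using k_less_3 by (rule inS_Var)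
  have "lf a * H = f * Var k ^ (1 + e2)"
  proof (rule homog_ph_inj)
    show "homog (1 + (e2 + d)) (lf a * H)" by (intro homog_mult homog_lf H)
    show "homog (1 + (e2 + d)) (f * Var k ^ (1 + e2))"
      using homog_mult[OF f(2) homog_power[OF homog_Var(1)[of k], of "1 + e2"]] by (simp add: add_ac)
    show "ph (lf a * H) = ph (f * Var k ^ (1 + e2))"
      using H h rho_k by (simp add: rhom_simps[OF rhom_ph])
  qed (intro poly_in_mult poly_in_power inS_lf H f kS)+
  then have "lf a dvd f * Var k ^ (1 + e2)" by (metis dvd_triv_left)
  then have "lf a dvd Var k ^ (1 + e2)" using nd lf_prime[of a, OF a_nz] by blast
  then obtain H' where "Var k ^ (1 + e2) = lf a * H'" by (rule dvdE)
  then have "ph (Var k ^ (1 + e2)) = ph (lf a * H')" by (rule arg_cong)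
  then have "1 = sp * ph H'" by (simp add: rhom_simps[OF rhom_ph] rho_k)
  then have "sl (bemb 1) = sl (bemb (sp * ph H'))" by (rule arg_cong)
  then show False by (simp add: rhom_simps[OF rhom_bemb] rhom_simps[OF rhom_sl])
qed

text \<open>For the bound, a derivation killing f l becomes A d_s + B d_t in the chart with A in (s)
  and B g_t in M, so t^m divides B on the line. For sharpness, the membership of t^m g_t in M is
  turned back into a homogeneous derivation.\<close>

theorem local_line:
  assumes f: "inS f" "homog d f" "f \<noteq> 0" and d: "d \<ge> 1"
    and sqf: "\<And>q h. inS q \<Longrightarrow> inS h \<Longrightarrow> f = q * q * h \<Longrightarrow> \<exists>c. q = Const c"
    and nd: "\<not> lf a dvd f" and fz: "meval f p = 0" and ch: "chart p = k" and N: "det3 N p v \<noteq> 0"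
  shows "\<exists>m. int m = 1 + eps_pt (f * lf a) p - eps_pt f p \<and>
    (\<forall>\<theta>\<in>D0 (f * lf a). fps_X ^ m dvd line_ev p v (Phi N \<theta>)) \<and>
    (\<exists>\<theta>\<in>D0 (f * lf a). (\<exists>e. homog_deriv e \<theta>) \<and> \<not> fps_X ^ Suc m dvd line_ev p v (Phi N \<theta>))"
proof -
  define g where "g = ph f"
  note hp = rhom_simps[OF rhom_ph] and hJ = rhom_simps[OF rhom_bemb] and hs = rhom_simps[OF rhom_sl]
  have g0: "g \<noteq> 0"
  proof
    assume "g = 0"
    then have "f = 0" using homog_ph_inj[of f 0 d] f by (simp add: g_def rhom_0[OF rhom_ph])
    then show False using f(3) by simp
  qed
  have sq: "degree q = 0" if "g = q * q * h" for q h
    by (rule ph_squarefree[OF f(1,2) sqf that[unfolded g_def]])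
  obtain \<alpha> \<beta> r where bez: "r \<noteq> 0" "\<alpha> * g + \<beta> * pderiv g = [:r:]"
  proof -
    have "\<exists>\<alpha> \<beta> r. r \<noteq> 0 \<and> \<alpha> * g + \<beta> * pderiv g = [:r:]"
      by (rule bivariate_bezout[OF g0]) (rule sq)
    then show thesis using that by blast
  qed
  have "EP (\<alpha> * g + \<beta> * pderiv g) = [:fps_of_poly r:]"
    unfolding bez(2) by (simp add: EP_def map_poly_pCons)
  then have bez': "EP \<alpha> * EP g + EP \<beta> * pderiv (EP g) = [:fps_of_poly r:]"
    by (simp add: rhom_add[OF rhom_EP] rhom_mult[OF rhom_EP] pderiv_EP)
  have r': "fps_of_poly r \<noteq> 0" using bez(1) by (metis fps_of_poly_eq_iff fps_of_poly_0)
  have slg: "sl (bemb g) \<noteq> 0" using ph_not_dvd[OF f(1,2) nd] by (simp add: g_def)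
  have sle: "slice0 (EP g) \<noteq> 0"
  proof
    assume z: "slice0 (EP g) = 0"
    have "sl (bemb g) $ n = coeff (slice0 (EP g)) n" for n by (simp add: coeff_EP)
    then have "sl (bemb g) = 0" unfolding z by (intro fps_ext) simp
    then show False using slg by simp
  qed
  have g00: "coeff (EP g) 0 $ 0 = 0" using val0_ph[of f] fz by (simp add: coeff_EP val0_def g_def)
  obtain \<mu> \<tau> \<mu>' \<tau>' m n where L:
    "Ser.codim (id2 (bemb (dS g)) (bemb (pderiv g))) \<mu>" "Ser.codim (id3 (bemb g) (bemb (dS g)) (bemb (pderiv g))) \<tau>"
    "Ser.codim (id2 (bemb g + sv * bemb (dS g)) (sv * bemb (pderiv g))) \<mu>'"
    "Ser.codim (id3 (sv * bemb g) (bemb g + sv * bemb (dS g)) (sv * bemb (pderiv g))) \<tau>'"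
    "Ser.codim (id3 (bemb g) (sv * bemb (dS g)) (sv * bemb (pderiv g))) n"
    "\<forall>F. F * bemb (pderiv g) \<in> id3 (bemb g) (sv * bemb (dS g)) (sv * bemb (pderiv g)) \<longleftrightarrow> fps_X ^ m dvd sl F"
    "\<mu>' + \<tau> + 1 = \<mu> + \<tau>' + m"
    using local_line_formula[OF g00 sle bez' r'] unfolding map_fps_deriv_EP pderiv_EP bemb_def[symmetric] by metis
  have fl: "inS (f * lf a)" "meval (f * lf a) p = 0" "homog (d + 1) (f * lf a)"
  proof -
    show "inS (f * lf a)" by (rule poly_in_mult[OF f(1) inS_lf])
    show "meval (f * lf a) p = 0" using fz by (simp add: meval_eq_psub psub_mult[OF rhom_id])
    show "homog (d + 1) (f * lf a)" by (rule homog_mult[OF f(2) homog_lf])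
  qed
  have phl: "ph (f * lf a) = g * sp" by (simp add: hp g_def)
  have J1: "bemb (dS (g * sp)) = bemb g + sv * bemb (dS g)" "bemb (pderiv (g * sp)) = sv * bemb (pderiv g)" "bemb (g * sp) = sv * bemb g"
    by (simp_all add: dS_mult pderiv_mult hJ algebra_simps)
  have e1: "milnor f p = enat \<mu>" "tjurina f p = enat \<tau>"
    using milnor_tjurina_eq[OF f(1) fz ch] L(1,2) unfolding g_def by blast+
  have e2: "milnor (f * lf a) p = enat \<mu>'" "tjurina (f * lf a) p = enat \<tau>'"
    using milnor_tjurina_eq[OF fl(1,2) ch] L(3,4) unfolding phl J1 by blast+
  have eps: "int m = 1 + eps_pt (f * lf a) p - eps_pt f p"
    using L(7) by (simp add: eps_pt_def e1 e2)
  let ?M = "id3 (bemb g) (sv * bemb (dS g)) (sv * bemb (pderiv g))"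

  have "fps_X ^ m dvd line_ev p v (Phi N \<theta>)" if \<theta>: "\<theta> \<in> D0 (f * lf a)" for \<theta>
  proof -
    have a0: "act (dcoef \<theta>) (f * lf a) = 0" using \<theta> by (simp add: D0_iff act_def)
    note lg = logarithmic_of_product[OF a_nz nd a0]
    \<comment> \<open>Subtracting this multiple of the point, that is of the Euler derivation, makes
      the field tangent to the chart x_k = 1.\<close>
    define u where "u x = ph (dcoef \<theta> x) - rho x * ph (dcoef \<theta> k)" for x
    have "u k = 0" by (simp add: u_def rho_k)
    then obtain A B where AB: "\<And>x. x \<in> {i, j, k} \<Longrightarrow> u x = cc (w x) * A + cc (v x) * B"
      using frame_coords by blast
    have act: "A * dS (ph F) + B * pderiv (ph F) = ph (act (dcoef \<theta>) F) - ph (dcoef \<theta> k) * of_nat e * ph F"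
      if F: "inS F" "homog e F" for F e
    proof -
      have "A * dS (ph F) + B * pderiv (ph F) = u 0 * ph (pder 0 F) + u 1 * ph (pder 1 F) + u 2 * ph (pder 2 F)"
        by (rule frame_action[OF AB F(1), symmetric])
      also have "\<dots> = ph (act (dcoef \<theta>) F) - ph (dcoef \<theta> k) * ph (Var 0 * pder 0 F + Var 1 * pder 1 F + Var 2 * pder 2 F)"
        unfolding u_def act_def rhom_add[OF rhom_ph] rhom_mult[OF rhom_ph] ph_Var by (simp add: algebra_simps)
      finally show ?thesis unfolding euler_formula[OF F(2,1)] by (simp add: hp mult.assoc)
    qed
    obtain h1 where h1: "act (dcoef \<theta>) (lf a) = lf a * h1" using lg(1) by (rule dvdE)
    obtain h2 where h2: "act (dcoef \<theta>) f = f * h2" using lg(2) by (rule dvdE)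
    have "A * dS sp + B * pderiv sp = sp * ph h1 - ph (dcoef \<theta> k) * sp"
      using act[OF inS_lf[of a] homog_lf[of a]] unfolding h1 by (simp add: hp)
    then have A: "A = sp * (ph h1 - ph (dcoef \<theta> k))" by (simp add: algebra_simps)
    then have sA: "sp dvd A" by simp
    have "A * dS g + B * pderiv g = g * ph h2 - ph (dcoef \<theta> k) * of_nat d * g"
      using act[OF f(1,2)] unfolding h2 g_def by (simp add: hp)
    then have "B * pderiv g = (ph h2 - ph (dcoef \<theta> k) * of_nat d) * g + (- (ph h1 - ph (dcoef \<theta> k))) * (sp * dS g) + 0 * (sp * pderiv g)"
      unfolding A by (simp add: algebra_simps)
    then have "bemb (B * pderiv g) = bemb ((ph h2 - ph (dcoef \<theta> k) * of_nat d) * g + (- (ph h1 - ph (dcoef \<theta> k))) * (sp * dS g) + 0 * (sp * pderiv g))"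
      by simp
    then have "bemb B * bemb (pderiv g) = bemb (ph h2 - ph (dcoef \<theta> k) * of_nat d) * bemb g + bemb (- (ph h1 - ph (dcoef \<theta> k))) * (sv * bemb (dS g)) + 0 * (sv * bemb (pderiv g))"
      by (simp only: rhom_add[OF rhom_bemb] rhom_mult[OF rhom_bemb] bemb_sp rhom_0[OF rhom_bemb])
    then have "bemb B * bemb (pderiv g) \<in> ?M" by (rule id3I)
    then have XB: "fps_X ^ m dvd sl (bemb B)" using L(6) by blast
    have "line_ev p v (Phi N \<theta>) = fps_const (det3 N p v) * sl (bemb B)"
      unfolding sl_bemb_ph[symmetric]
    proof (rule sl_Phi[OF _ sA])
      fix x assume "x \<in> {i, j, k}"
      then show "ph (dcoef \<theta> x) = cc (w x) * A + cc (v x) * B + ph (dcoef \<theta> k) * rho x"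
        using AB[of x] by (simp add: u_def algebra_simps)
    qed
    then show ?thesis using XB by simp
  qed
  moreover have "\<exists>\<theta>\<in>D0 (f * lf a). (\<exists>e. homog_deriv e \<theta>) \<and> \<not> fps_X ^ Suc m dvd line_ev p v (Phi N \<theta>)"
  proof -
    let ?G = "[g, sp * dS g, sp * pderiv g]"
    have M: "idl (map bemb ?G) = ?M" by (simp add: idl_3 hJ)
    \<comment> \<open>The membership holds in the completion; descending to the local ring costs a
      factor \<open>s\<close> that does not vanish at \<open>p\<close>.\<close>
    have "bemb (tp ^ m * pderiv g) \<in> idl (map bemb ?G)"
      unfolding M using L(6)[rule_format, of "tv ^ m"] by (simp add: hJ hs)
    then have "lid ?G (tp ^ m * pderiv g)"
      using lid_iff_completion[of ?G n "tp ^ m * pderiv g"] L(5) unfolding M by blast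
    then obtain s where s: "val0 s \<noteq> 0" "s * (tp ^ m * pderiv g) \<in> idl ?G" unfolding lid_def by blast
    then obtain \<alpha> \<beta> \<gamma> where abg: "s * (tp ^ m * pderiv g) = \<alpha> * g + \<beta> * (sp * dS g) + \<gamma> * (sp * pderiv g)"
      unfolding idl_3 id3_def by blast
    \<comment> \<open>The relation \<open>abg\<close> rearranged so that A d_s + B d_t maps g to
      \<alpha> g, with \<open>A\<close> a multiple of \<open>sp\<close> and \<open>B\<close> equal
      to \<open>s * tp ^ m\<close> on the line.\<close>
    define A where "A = - \<beta> * sp"
    define B where "B = s * tp ^ m - \<gamma> * sp"
    have ABg: "A * dS g + B * pderiv g = \<alpha> * g"
      using abg by (simp add: A_def B_def algebra_simps)
    define U where "U x = cc (w x) * A + cc (v x) * B" for x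
    obtain ei where ei: "\<And>e. e \<ge> ei \<Longrightarrow> \<exists>F. inS F \<and> homog e F \<and> ph F = U i" using homogenize by blast
    obtain ej where ej: "\<And>e. e \<ge> ej \<Longrightarrow> \<exists>F. inS F \<and> homog e F \<and> ph F = U j" using homogenize by blast
    obtain ea where ea: "\<And>e. e \<ge> ea \<Longrightarrow> \<exists>F. inS F \<and> homog e F \<and> ph F = \<alpha>" using homogenize by blast
    obtain eb where eb: "\<And>e. e \<ge> eb \<Longrightarrow> \<exists>F. inS F \<and> homog e F \<and> ph F = - \<beta>" using homogenize by blast
    \<comment> \<open>Large enough for all four lifts. The field has coefficients of degree
      \<open>Suc e\<close> and the multipliers \<alpha>, -\<beta> have degree \<open>e\<close>, so
      that \<open>actf\<close> and \<open>actl\<close> compare forms of equal degree.\<close>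
    define e where "e = ei + ej + ea + eb"
    obtain Gi where Gi: "inS Gi" "homog (Suc e) Gi" "ph Gi = U i" using ei[of "Suc e"] by (auto simp: e_def)
    obtain Gj where Gj: "inS Gj" "homog (Suc e) Gj" "ph Gj = U j" using ej[of "Suc e"] by (auto simp: e_def)
    obtain R where R: "inS R" "homog e R" "ph R = \<alpha>" using ea[of e] by (auto simp: e_def)
    obtain R' where R': "inS R'" "homog e R'" "ph R' = - \<beta>" using eb[of e] by (auto simp: e_def)
    define G where "G x = (if x = i then Gi else if x = j then Gj else 0)" for x
    have G: "inS (G x)" "homog (Suc e) (G x)" for x using Gi Gj by (auto simp: G_def)
    have Uk: "U k = 0" by (simp add: U_def wk vk rhom_0[OF rhom_cc])
    have pG: "ph (G x) = U x" if "x \<in> {i, j, k}" for x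
      using that Gi Gj Uk ki kj by (auto simp: G_def rhom_0[OF rhom_ph])
    have phact: "ph (act G F) = A * dS (ph F) + B * pderiv (ph F)" if F: "inS F" for F
    proof -
      have "ph (act G F) = ph (G 0) * ph (pder 0 F) + ph (G 1) * ph (pder 1 F) + ph (G 2) * ph (pder 2 F)"
        by (simp add: act_def hp)
      also have "\<dots> = A * dS (ph F) + B * pderiv (ph F)"
        by (rule frame_action[OF _ F]) (simp add: pG U_def)
      finally show ?thesis .
    qed
    have actf: "act G f = R * f"
    proof (rule homog_ph_inj)
      obtain d' where d': "d = Suc d'" using d by (cases d) auto
      have "homog d' (pder x f)" for x using homog_pder f(2) unfolding d' by blast
      then have "homog (Suc e + d') (act G f)" unfolding act_def by (intro homog_add homog_mult G)
      then show "homog (e + d) (act G f)" by (simp add: d')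
      show "homog (e + d) (R * f)" by (intro homog_mult R f)
      show "ph (act G f) = ph (R * f)"
        unfolding phact[OF f(1)] using ABg by (simp add: hp R g_def)
    qed (unfold act_def, (intro poly_in_add poly_in_mult poly_in_pder G R f)+)
    have actl: "act G (lf a) = R' * lf a"
    proof (rule homog_ph_inj)
      have "homog (0 + Suc e) (act G (lf a))" unfolding act_lf by (intro homog_add homog_mult G homog_Const)
      then show "homog (e + 1) (act G (lf a))" by simp
      show "homog (e + 1) (R' * lf a)" by (intro homog_mult R' homog_lf)
      show "ph (act G (lf a)) = ph (R' * lf a)"
        unfolding phact[OF inS_lf] by (simp add: hp R' A_def)
    qed (unfold act_lf, (intro poly_in_add poly_in_mult poly_in_Const inS_lf G R')+)
    \<comment> \<open>The Euler derivation multiplies f l by d + 1, so subtracting this multiple of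
      it cancels G(f l) = (R + R') f l.\<close>
    define \<kappa> where "\<kappa> = Const (1 / of_nat (d + 1)) * (R + R')"
    define \<theta> where "\<theta> = (G 0 - \<kappa> * Var 0, G 1 - \<kappa> * Var 1, G 2 - \<kappa> * Var 2)"
    have \<kappa>: "inS \<kappa>" "homog e \<kappa>" using R R' by (auto simp: \<kappa>_def intro!: homog_Const_mult homog_add)
    have c\<theta>: "dcoef \<theta> x = G x - \<kappa> * Var x" if "x \<in> {i, j, k}" for x
      using that unfolding ijk by (auto simp: \<theta>_def)
    have h\<theta>: "homog (Suc e) (G x - \<kappa> * Var x)" for x
      using homog_mult[OF \<kappa>(2) homog_Var(1)[of x]] by (intro homog_diff G) simp
    have aG: "act G (f * lf a) = (R + R') * (f * lf a)"
      unfolding act_mult actf actl by (simp add: algebra_simps)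
    have "Const (1 / of_nat (d + 1)) * of_nat (d + 1) = (1 :: mpoly)"
    proof -
      have "Const (1 / of_nat (d + 1)) * Const (of_nat (d + 1)) = Const (1 / of_nat (d + 1) * of_nat (d + 1))"
        by (rule Const_mult[symmetric])
      also have "\<dots> = 1" by (simp del: of_nat_add of_nat_Suc)
      finally show ?thesis by (simp only: rhom_of_nat[OF rhom_Const])
    qed
    then have kE: "\<kappa> * (of_nat (d + 1) * (f * lf a)) = (R + R') * (f * lf a)"
      unfolding \<kappa>_def by (metis (no_types, lifting) mult.assoc mult.commute mult.left_neutral)
    have "act G (f * lf a) - \<kappa> * (Var 0 * pder 0 (f * lf a) + Var 1 * pder 1 (f * lf a) + Var 2 * pder 2 (f * lf a)) = 0"
      unfolding euler_formula[OF fl(3,1)] aG kE by (rule diff_self)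
    then have "(G 0 - \<kappa> * Var 0) * pder 0 (f * lf a) + (G 1 - \<kappa> * Var 1) * pder 1 (f * lf a) + (G 2 - \<kappa> * Var 2) * pder 2 (f * lf a) = 0"
      unfolding act_def by (simp add: algebra_simps)
    moreover have "inS (G x - \<kappa> * Var x)" if "x < 3" for x
      by (intro poly_in_diff poly_in_mult G \<kappa> inS_Var that)
    ultimately have t1: "\<theta> \<in> D0 (f * lf a)"
      unfolding D0_def \<theta>_def by simp
    have t2: "homog_deriv (Suc e) \<theta>" using h\<theta> by (simp add: homog_deriv_def \<theta>_def)
    have t3: "line_ev p v (Phi N \<theta>) = fps_const (det3 N p v) * sl (bemb B)"
      unfolding sl_bemb_ph[symmetric]
    proof (rule sl_Phi)
      show "sp dvd A" by (simp add: A_def)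
      fix x assume x: "x \<in> {i, j, k}"
      show "ph (dcoef \<theta> x) = cc (w x) * A + cc (v x) * B + (- ph \<kappa>) * rho x"
        unfolding c\<theta>[OF x] by (simp add: hp pG[OF x] U_def)
    qed
    have t4: "\<not> fps_X ^ Suc m dvd fps_const (det3 N p v) * sl (bemb B)"
    proof -
      have "sl (bemb B) = sl (bemb s) * fps_X ^ m" by (simp add: B_def hJ hs)
      then have "(fps_const (det3 N p v) * sl (bemb B)) $ m = det3 N p v * sl (bemb s) $ 0"
        by (simp add: fps_X_power_mult_right_nth)
      also have "\<dots> \<noteq> 0" using N s(1) by (simp add: val0_def)
      finally show ?thesis unfolding fps_X_power_dvd_iff by blast
    qed
    show ?thesis using t1 t2 t4 unfolding t3[symmetric] by blast
  qed
  ultimately show ?thesis using eps by blast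
qed

end

section \<open>Restriction of logarithmic derivations to the line\<close>

lemma degree_eq_sum_order:
  fixes p :: "complex poly"
  assumes "p \<noteq> 0"
  shows "degree p = (\<Sum>z | poly p z = 0. order z p)"
proof -
  have "degree p = size (proots p)" by (rule size_proots_complex[symmetric])
  also have "\<dots> = (\<Sum>z\<in>set_mset (proots p). count (proots p) z)"
    by (rule size_multiset_overloaded_eq)
  also have "\<dots> = (\<Sum>z | poly p z = 0. order z p)"
    using assms by (intro sum.cong) auto
  finally show ?thesis .
qed

lemma cramer3:
  fixes x y z u :: "nat \<Rightarrow> 'r::comm_ring_1"
  assumes "n < 3"
  shows "det3 x y z * u n = det3 x u z * y n + det3 x y u * z n + det3 u y z * x n"
proof -
  consider "n = 0" | "n = 1" | "n = 2" using assms by linarith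
  then show ?thesis by cases (simp_all add: det3_def algebra_simps)
qed

lemma rhom_pconst: "rhom (\<lambda>c::'a::comm_ring_1. [:c:])"
  by (simp add: rhom_def one_pCons)

lemma coeff_mult_bounded:
  fixes p q :: "'a::comm_ring_1 poly"
  assumes "degree p \<le> m" "degree q \<le> n"
  shows "coeff (p * q) (m + n) = coeff p m * coeff q n"
proof -
  have "coeff (p * q) (m + n) = (\<Sum>i\<le>m + n. if i = m then coeff p m * coeff q n else 0)"
    unfolding coeff_mult
  proof (rule sum.cong[OF refl])
    fix i assume "i \<in> {..m + n}"
    consider "i = m" | "i < m" | "i > m" by linarith
    then show "coeff p i * coeff q (m + n - i) = (if i = m then coeff p m * coeff q n else 0)"
    proof cases
      case 2
      then have "coeff q (m + n - i) = 0" using assms(2) by (intro coeff_eq_0) simp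
      then show ?thesis using 2 by simp
    next
      case 3
      then have "coeff p i = 0" using assms(1) by (intro coeff_eq_0) simp
      then show ?thesis using 3 by simp
    qed simp
  qed
  then show ?thesis by simp
qed

text \<open>The coefficient in the nominal degree is the value at the point at infinity
  \<open>P1\<close>. Non-vanishing there is what later turns upper bounds for degrees into
  equalities.\<close>

lemma mon_linear_degree:
  fixes P0 P1 :: "nat \<Rightarrow> complex"
  shows "degree (mon (\<lambda>n. [:P0 n, P1 n:]) m) \<le> mdeg m \<and> coeff (mon (\<lambda>n. [:P0 n, P1 n:]) m) (mdeg m) = mon P1 m"
proof -
  have pw: "degree ([:P0 n, P1 n:] ^ k) \<le> k \<and> coeff ([:P0 n, P1 n:] ^ k) k = P1 n ^ k" for n k
  proof (induction k)
    case (Suc k)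
    have d: "degree [:P0 n, P1 n:] \<le> 1" by simp
    have "degree ([:P0 n, P1 n:] * [:P0 n, P1 n:] ^ k) \<le> 1 + k"
      using degree_mult_le[of "[:P0 n, P1 n:]" "[:P0 n, P1 n:] ^ k"] Suc d by linarith
    then show ?case using coeff_mult_bounded[OF d, of "[:P0 n, P1 n:] ^ k" k] Suc by simp
  qed simp
  have "degree (\<Prod>i\<in>A. [:P0 i, P1 i:] ^ f i) \<le> sum f A \<and> coeff (\<Prod>i\<in>A. [:P0 i, P1 i:] ^ f i) (sum f A) = (\<Prod>i\<in>A. P1 i ^ f i)"
    if "finite A" for A and f :: "nat \<Rightarrow> nat"
    using that
  proof (induction A)
    case (insert x A)
    have "degree ([:P0 x, P1 x:] ^ f x * (\<Prod>i\<in>A. [:P0 i, P1 i:] ^ f i)) \<le> f x + sum f A"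
      using degree_mult_le[of "[:P0 x, P1 x:] ^ f x" "\<Prod>i\<in>A. [:P0 i, P1 i:] ^ f i"] insert.IH pw[of x "f x"] by linarith
    moreover have "coeff ([:P0 x, P1 x:] ^ f x * (\<Prod>i\<in>A. [:P0 i, P1 i:] ^ f i)) (f x + sum f A) = P1 x ^ f x * (\<Prod>i\<in>A. P1 i ^ f i)"
      using coeff_mult_bounded[of "[:P0 x, P1 x:] ^ f x" "f x" "\<Prod>i\<in>A. [:P0 i, P1 i:] ^ f i" "sum f A"] insert.IH pw[of x "f x"] by simp
    ultimately show ?case using insert.hyps by simp
  qed simp
  from this[of "Poly_Mapping.keys m" "Poly_Mapping.lookup m"] show ?thesis unfolding mon_def mdeg_def by simp
qed

lemma ppoint_chart:
  assumes "ppoint p"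
  shows "chart p < 3" "p (chart p) = 1" "\<forall>n\<ge>3. p n = 0" "\<forall>n<chart p. p n = 0"
proof -
  obtain k where k: "k < 3" "p k = 1" "\<forall>j<k. p j = 0" using assms unfolding ppoint_def by blast
  have "chart p = k"
    unfolding chart_def by (rule Least_equality) (use k in \<open>auto simp: not_less[symmetric]\<close>)
  then show "chart p < 3" "p (chart p) = 1" "\<forall>n\<ge>3. p n = 0" "\<forall>n<chart p. p n = 0"
    using k assms unfolding ppoint_def by auto
qed

definition lin :: "(nat \<Rightarrow> 'r::comm_ring_1) \<Rightarrow> (nat \<Rightarrow> 'r) \<Rightarrow> 'r" where
  "lin a x = a 0 * x 0 + a 1 * x 1 + a 2 * x 2"

lemma lin_combination:
  fixes a x y z u :: "nat \<Rightarrow> 'r::comm_ring_1"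
  assumes "\<And>m. m < 3 \<Longrightarrow> d * x m = \<alpha> * y m + \<beta> * z m + \<gamma> * u m"
  shows "d * lin a x = \<alpha> * lin a y + \<beta> * lin a z + \<gamma> * lin a u"
proof -
  have "d * lin a x = a 0 * (d * x 0) + a 1 * (d * x 1) + a 2 * (d * x 2)" by (simp add: lin_def algebra_simps)
  also have "\<dots> = \<alpha> * lin a y + \<beta> * lin a z + \<gamma> * lin a u"
  proof -
    have h: "d * x 0 = \<alpha> * y 0 + \<beta> * z 0 + \<gamma> * u 0" "d * x 1 = \<alpha> * y 1 + \<beta> * z 1 + \<gamma> * u 1"
      "d * x 2 = \<alpha> * y 2 + \<beta> * z 2 + \<gamma> * u 2" by (rule assms, simp)+
    show ?thesis unfolding h by (simp add: lin_def algebra_simps)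
  qed
  finally show ?thesis .
qed

lemma meval_lf: "meval (lf a) x = lin a x"
  unfolding meval_eq_psub psub_lf[OF rhom_id] lin_def ..

lemma line_basis_exists:
  fixes a N :: "nat \<Rightarrow> complex"
  assumes "lin a N = 1"
  shows "\<exists>B0 B1. lin a B0 = 0 \<and> lin a B1 = 0 \<and> det3 N B0 B1 \<noteq> 0 \<and> (\<forall>n\<ge>3. B0 n = 0) \<and> (\<forall>n\<ge>3. B1 n = 0)"
proof -
  define vec where "vec x y z n = (if n = 0 then x else if n = 1 then y else if n = 2 then z else (0::complex))" for x y z and n :: nat
  have v: "vec x y z 0 = x" "vec x y z (Suc 0) = y" "vec x y z 2 = z" "n \<ge> 3 \<Longrightarrow> vec x y z n = 0" for x y z n
    by (simp_all add: vec_def)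
  have "a 0 \<noteq> 0 \<or> a 1 \<noteq> 0 \<or> a 2 \<noteq> 0"
    by (rule ccontr) (use assms in \<open>simp add: lin_def\<close>)
  then consider "a 0 \<noteq> 0" | "a 1 \<noteq> 0" | "a 2 \<noteq> 0" by blast
  then show ?thesis
  proof cases
    case 1
    have "det3 N (vec (- a 1) (a 0) 0) (vec (- a 2) 0 (a 0)) = a 0 * lin a N"
      by (simp add: det3_def lin_def v algebra_simps)
    then show ?thesis using assms 1
      by (intro exI[of _ "vec (- a 1) (a 0) 0"] exI[of _ "vec (- a 2) 0 (a 0)"]) (simp add: lin_def v)
  next
    case 2
    have "det3 N (vec (a 1) (- a 0) 0) (vec 0 (- a 2) (a 1)) = - a 1 * lin a N"
      by (simp add: det3_def lin_def v algebra_simps)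
    then show ?thesis using assms 2
      by (intro exI[of _ "vec (a 1) (- a 0) 0"] exI[of _ "vec 0 (- a 2) (a 1)"]) (simp add: lin_def v)
  next
    case 3
    have "det3 N (vec (a 2) 0 (- a 0)) (vec 0 (a 2) (- a 1)) = a 2 * lin a N"
      by (simp add: det3_def lin_def v algebra_simps)
    then show ?thesis using assms 3
      by (intro exI[of _ "vec (a 2) 0 (- a 0)"] exI[of _ "vec 0 (a 2) (- a 1)"]) (simp add: lin_def v)
  qed
qed

lemma line_frame_exists:
  fixes p a N :: "nat \<Rightarrow> complex"
  assumes p: "ppoint p" and ap: "lin a p = 0" and N: "lin a N = 1"
  shows "\<exists>w v i j. line_frame p w v i j (chart p) a \<and> det3 N p v \<noteq> 0 \<and> lin a v = 0"
proof -
  define k where "k = chart p"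
  note pc = ppoint_chart[OF p, folded k_def]
  have main: ?thesis if ij: "i < j" "{i, j, k} = {0, 1, 2}" "k \<noteq> i" "k \<noteq> j" for i j
  proof -
    have s3: "f 0 + f 1 + f 2 = f i + f j + f k" for f :: "nat \<Rightarrow> complex"
    proof -
      have "sum f {i, j, k} = f i + f j + f k" using ij(1,3,4) by (simp add: add.assoc)
      moreover have "sum f {0, 1, 2} = f 0 + f 1 + f 2" by (simp add: add.assoc)
      moreover have "sum f {i, j, k} = sum f {0, 1, 2}" by (rule arg_cong[OF ij(2)])
      ultimately show ?thesis by (simp only:)
    qed
    have l: "lin a x = a i * x i + a j * x j + a k * x k" for x
      unfolding lin_def by (rule s3[of "\<lambda>n. a n * x n"])
    have nz: "a i \<noteq> 0 \<or> a j \<noteq> 0"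
    proof (rule ccontr)
      assume "\<not> (a i \<noteq> 0 \<or> a j \<noteq> 0)"
      then have "a k = 0" using ap pc(2) by (simp add: l)
      then show False using N \<open>\<not> (a i \<noteq> 0 \<or> a j \<noteq> 0)\<close> by (simp add: l)
    qed
    define v where "v n = (if n = i then - a j else if n = j then a i else 0)" for n
    define w where "w n = (if a i \<noteq> 0 then (if n = i then 1 / a i else 0) else (if n = j then 1 / a j else 0))" for n
    have vv: "v i = - a j" "v j = a i" "v k = 0" using ij by (auto simp: v_def)
    have ww: "a i * w i + a j * w j = 1" "w k = 0" using ij nz by (auto simp: w_def)
    have av: "lin a v = 0" by (simp add: l vv)
    have aw: "lin a w = 1" using ww by (simp add: l)
    have fr: "line_frame p w v i j k a"
      using ij pc(2) vv ww ap av aw by unfold_locales (simp_all add: lin_def mult.commute add.commute)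
    have "det3 N p v \<noteq> 0"
    proof -
      \<comment> \<open>The cross product of p and v is a or -a: it is proportional to a, and p_k =
        1 together with the choice of v fixes the factor.\<close>
      have "det3 N p v = lin a N \<or> det3 N p v = - lin a N"
      proof -
        have m: "i < 3" "j < 3" "k < 3"
        proof -
          have "\<forall>n\<in>{i, j, k}. n < 3" unfolding ij(2) by simp
          then show "i < 3" "j < 3" "k < 3" by blast+
        qed
        from ap have ap': "a 0 * p 0 + a 1 * p 1 + a 2 * p 2 = 0" by (simp only: lin_def)
        consider "k = 0" | "k = 1" | "k = 2" using m by linarith
        then show ?thesis
        proof cases
          case 1
          then have "i = 1" "j = 2" using ij m by linarith+
          then have "v 1 = - a 2" "v 2 = a 1" "v 0 = 0" "p 0 = 1" using vv pc(2) 1 by auto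
          then have "det3 N p v = - lin a N" using ap' unfolding det3_def lin_def by algebra
          then show ?thesis ..
        next
          case 2
          then have "i = 0" "j = 2" using ij m by linarith+
          then have "v 0 = - a 2" "v 2 = a 0" "v 1 = 0" "p 1 = 1" using vv pc(2) 2 by auto
          then have "det3 N p v = lin a N" using ap' unfolding det3_def lin_def by algebra
          then show ?thesis ..
        next
          case 3
          then have "i = 0" "j = 1" using ij m by linarith+
          then have "v 0 = - a 1" "v 1 = a 0" "v 2 = 0" "p 2 = 1" using vv pc(2) 3 by auto
          then have "det3 N p v = - lin a N" using ap' unfolding det3_def lin_def by algebra
          then show ?thesis ..
        qed
      qed
      then show ?thesis using N by auto
    qed
    then show ?thesis using fr av unfolding k_def by blast
  qed
  consider "k = 0" | "k = 1" | "k = 2" using pc(1) by linarith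
  then show ?thesis
  proof cases
    case 1 then show ?thesis by (intro main[of 1 2]) auto
  next
    case 2 then show ?thesis by (intro main[of 0 2]) auto
  next
    case 3 then show ?thesis by (intro main[of 0 1]) auto
  qed
qed

text \<open>The line is parametrised by z \<mapsto> P0 + z P1, with \<open>P1\<close> at infinity;
  \<open>N\<close> is a vector off the line that serves both for projecting onto it and for
  \<open>Phi\<close>.\<close>

locale line_param =
  fixes a N P0 P1 :: "nat \<Rightarrow> complex"
  assumes lN: "lin a N = 1" and l0: "lin a P0 = 0" and l1: "lin a P1 = 0"
    and det_nz: "det3 N P0 P1 \<noteq> 0"
    and tail0: "\<forall>n\<ge>3. P0 n = 0" and tail1: "\<forall>n\<ge>3. P1 n = 0"
begin

definition R :: "mpoly \<Rightarrow> complex poly" where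
  "R = psub (\<lambda>c. [:c:]) (\<lambda>n. [:P0 n, P1 n:])"

lemma rhom_R: "rhom R"
  unfolding R_def by (rule rhom_psub[OF rhom_pconst])

lemma R_Const [simp]: "R (Const c) = [:c:]" and R_Var [simp]: "R (Var n) = [:P0 n, P1 n:]"
  by (simp_all add: R_def rhom_pconst)

lemma a_nz: "(a 0, a 1, a 2) \<noteq> (0, 0, 0)"
  using lN by (auto simp: lin_def)

lemma R_lf [simp]: "R (lf a) = 0"
proof -
  have "R (lf a) = [:lin a P0, lin a P1:]"
    by (simp add: lf_def rhom_simps[OF rhom_R] lin_def algebra_simps)
  then show ?thesis using l0 l1 by simp
qed

lemma poly_R: "poly (R F) z = meval F (\<lambda>n. P0 n + z * P1 n)"
proof -
  have "rhom (\<lambda>q. poly q z)" by (simp add: rhom_def)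
  from psub_hom[OF this, of "\<lambda>c. [:c:]" "\<lambda>n. [:P0 n, P1 n:]" F] show ?thesis
    by (simp add: R_def meval_eq_psub)
qed

lemma R_homog:
  assumes "homog e F"
  shows "degree (R F) \<le> e" and "coeff (R F) e = meval F P1"
proof -
  have m: "degree (mon (\<lambda>n. [:P0 n, P1 n:]) m) \<le> e" "coeff (mon (\<lambda>n. [:P0 n, P1 n:]) m) e = mon P1 m"
    if "m \<in> Poly_Mapping.keys F" for m
    using mon_linear_degree[of P0 P1 m] assms that unfolding homog_def by auto
  show "degree (R F) \<le> e"
    unfolding R_def psub_def
    by (rule degree_sum_le) (use m in \<open>auto intro: order_trans[OF degree_smult_le]\<close>)
  have "coeff (R F) e = (\<Sum>m\<in>Poly_Mapping.keys F. Poly_Mapping.lookup F m * mon P1 m)"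
    unfolding R_def psub_def coeff_sum by (rule sum.cong) (auto simp: m)
  then show "coeff (R F) e = meval F P1" by (simp add: meval_eq_psub psub_def)
qed

lemma line_point_coords:
  assumes "lin a x = 0" "n < 3"
  shows "x n = det3 N x P1 / det3 N P0 P1 * P0 n + det3 N P0 x / det3 N P0 P1 * P1 n"
proof -
  have c: "det3 N P0 P1 * x m = det3 N x P1 * P0 m + det3 N P0 x * P1 m + det3 x P0 P1 * N m" if "m < 3" for m
    using cramer3[OF that, of N P0 P1 x] .
  have "det3 N P0 P1 * lin a x = det3 N x P1 * lin a P0 + det3 N P0 x * lin a P1 + det3 x P0 P1 * lin a N"
    by (rule lin_combination[OF c])
  then have "det3 x P0 P1 = 0" using assms(1) l0 l1 lN by simp
  then show ?thesis using c[OF assms(2)] det_nz by (simp add: field_simps)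
qed

text \<open>Linear forms which restrict to the two homogeneous coordinates \<open>1, z\<close> of the line.\<close>

definition E0 :: mpoly where "E0 = Const (1 / det3 N P0 P1) * det3 (\<lambda>n. Const (N n)) Var (\<lambda>n. Const (P1 n))"
definition E1 :: mpoly where "E1 = Const (1 / det3 N P0 P1) * det3 (\<lambda>n. Const (N n)) (\<lambda>n. Const (P0 n)) Var"

lemma R_E0 [simp]: "R E0 = 1" and R_E1 [simp]: "R E1 = [:0, 1:]"
proof -
  have "R (det3 (\<lambda>n. Const (N n)) Var (\<lambda>n. Const (P1 n))) = [:det3 N P0 P1:]"
    by (simp add: det3_def rhom_simps[OF rhom_R] algebra_simps)
  then have "R E0 = [:1 / det3 N P0 P1:] * [:det3 N P0 P1:]"
    by (simp only: E0_def rhom_mult[OF rhom_R] R_Const)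
  then show "R E0 = 1" using det_nz by (simp add: one_pCons)
  have "R (det3 (\<lambda>n. Const (N n)) (\<lambda>n. Const (P0 n)) Var) = [:0, det3 N P0 P1:]"
    by (simp add: det3_def rhom_simps[OF rhom_R] algebra_simps)
  then have "R E1 = [:1 / det3 N P0 P1:] * [:0, det3 N P0 P1:]"
    by (simp only: E1_def rhom_mult[OF rhom_R] R_Const)
  then show "R E1 = [:0, 1:]" using det_nz by simp
qed

lemma inS_E0: "inS E0" and inS_E1: "inS E1"
  unfolding E0_def E1_def det3_def by (intro poly_in_mult poly_in_add poly_in_diff poly_in_Const inS_Var; simp)+

lemma homog_E0: "homog 1 E0" and homog_E1: "homog 1 E1"
proof -
  have h: "homog 1 (Const c * (Var n * Const d - Var m * Const d'))"
    "homog 1 (Const c * (Const d * Var n - Const d' * Var m))" for c d d' n m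
    using homog_mult[OF homog_Var(1)[of n] homog_Const[of d]] homog_mult[OF homog_Var(1)[of m] homog_Const[of d']]
    by (auto intro!: homog_Const_mult homog_diff)
  show "homog 1 E0" unfolding E0_def det3_def by (intro homog_Const_mult[OF homog_add[OF homog_diff]] h)
  show "homog 1 E1" unfolding E1_def det3_def by (intro homog_Const_mult[OF homog_add[OF homog_diff]] h)
qed

text \<open>x - l(x) N is the projection along N onto the plane l = 0, and Cramer's rule gives its
  coordinates in the basis \<open>P0\<close>, \<open>P1\<close>. This ties reduction modulo l to the
  parametrisation.\<close>

lemma reduction_coords:
  assumes "n < 3"
  shows "Var n - Const (N n) * lf a = E0 * Const (P0 n) + E1 * Const (P1 n)"
proof -
  let ?N = "\<lambda>n. Const (N n)" and ?A = "\<lambda>n. Const (P0 n)" and ?B = "\<lambda>n. Const (P1 n)"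
  define x where "x n = Var n - Const (N n) * lf a" for n
  let ?D = "det3 ?N ?A ?B"
  have D: "?D = Const (det3 N P0 P1)" by (simp add: det3_def rhom_simps[OF rhom_Const])
  have la: "lin (\<lambda>n. Const (a n)) (\<lambda>n. Const (y n)) = Const (lin a y)" for y
    by (simp add: lin_def rhom_simps[OF rhom_Const])
  have lx: "lin (\<lambda>n. Const (a n)) x = 0"
  proof -
    have "lin (\<lambda>n. Const (a n)) x = lf a - lin (\<lambda>n. Const (a n)) ?N * lf a"
      by (simp add: lin_def x_def lf_def algebra_simps)
    then show ?thesis unfolding la lN by simp
  qed
  have c: "?D * x m = det3 ?N x ?B * ?A m + det3 ?N ?A x * ?B m + det3 x ?A ?B * ?N m" if "m < 3" for m
    using cramer3[OF that, of ?N ?A ?B x] .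
  have "?D * lin (\<lambda>n. Const (a n)) x = det3 ?N x ?B * lin (\<lambda>n. Const (a n)) ?A + det3 ?N ?A x * lin (\<lambda>n. Const (a n)) ?B + det3 x ?A ?B * lin (\<lambda>n. Const (a n)) ?N"
    by (rule lin_combination[OF c])
  then have z: "det3 x ?A ?B = 0" unfolding lx la l0 l1 lN by simp
  have "det3 ?N x ?B = det3 ?N Var ?B" "det3 ?N ?A x = det3 ?N ?A Var"
    by (simp_all add: det3_def x_def algebra_simps)
  then have "?D * x n = det3 ?N Var ?B * ?A n + det3 ?N ?A Var * ?B n" using c[OF assms] z by simp
  then have "Const (1 / det3 N P0 P1) * (?D * x n) = E0 * ?A n + E1 * ?B n"
    by (simp add: E0_def E1_def algebra_simps)
  moreover have "Const (1 / det3 N P0 P1) * (?D * x n) = Const (1 / det3 N P0 P1 * det3 N P0 P1) * x n"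
    unfolding D Const_mult by (simp add: mult.assoc)
  ultimately show ?thesis using det_nz by (simp add: x_def)
qed

text \<open>By homogeneity, the reduction of F modulo l equals E0^e (R F)(E1 / E0) in the field of
  fractions, so it vanishes with \<open>R F\<close>.\<close>

lemma lf_dvd_of_R_zero:
  assumes F: "inS F" "homog e F" and z: "R F = 0"
  shows "lf a dvd F"
proof -
  let ?t = "\<lambda>z. to_fract (Const z)"
  let ?r = "psub Const (\<lambda>n. Var n - Const (N n) * lf a)"
  have t: "rhom ?t" by (rule rhom_to_fract_Const)
  define y where "y = to_fract E1 / to_fract E0"
  have E0nz: "to_fract E0 \<noteq> 0"
  proof
    assume "to_fract E0 = 0"
    then have "R E0 = R 0" by simp
    then show False by (simp add: rhom_0[OF rhom_R])
  qed
  define h where "h q = poly (map_poly ?t q) y" for q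
  have h: "rhom h" unfolding h_def by (rule rhom_comp[OF rhom_map_poly[OF t]]) (simp add: rhom_def)
  have "to_fract (?r F) = to_fract (psub Const (\<lambda>n. E0 * Const (P0 n) + E1 * Const (P1 n)) F)"
  proof -
    have "?r F = psub Const (\<lambda>n. E0 * Const (P0 n) + E1 * Const (P1 n)) F"
      by (rule psub_cong[OF F(1)], rule reduction_coords) auto
    then show ?thesis by simp
  qed
  also have "\<dots> = psub ?t (\<lambda>n. to_fract (E0 * Const (P0 n) + E1 * Const (P1 n))) F"
    by (rule psub_hom[OF rhom_to_fract])
  also have "(\<lambda>n. to_fract (E0 * Const (P0 n) + E1 * Const (P1 n))) = (\<lambda>n. to_fract E0 * (?t (P0 n) + y * ?t (P1 n)))"
    using E0nz by (intro ext) (simp add: y_def field_simps)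
  also have "psub ?t (\<lambda>n. to_fract E0 * (?t (P0 n) + y * ?t (P1 n))) F = to_fract E0 ^ e * psub ?t (\<lambda>n. ?t (P0 n) + y * ?t (P1 n)) F"
    by (rule psub_homog[OF F(2)])
  also have "psub ?t (\<lambda>n. ?t (P0 n) + y * ?t (P1 n)) F = h (R F)"
    unfolding R_def psub_hom[OF h] by (simp add: h_def map_poly_pCons)
  also have "\<dots> = 0" unfolding z by (rule rhom_0[OF h])
  finally have "?r F = 0" by simp
  then show ?thesis using lf_dvd_iff[of a N F] lN unfolding lin_def by blast
qed

lemma map_poly_fps_const_at:
  assumes "\<zeta> $ 0 = z"
  shows "poly (map_poly fps_const c) \<zeta> $ 0 = poly c z"
  using assms by (induction c) (simp_all add: map_poly_pCons)

text \<open>The parameter t at \<open>p\<close> and the coordinate z are related by a fractional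
  linear map \<zeta>, with \<zeta> - z0 a unit times t because p and v are independent. Homogeneity
  contributes only a power of the unit \<open>u\<close>.\<close>

lemma line_ev_order:
  assumes F: "inS F" "homog e F" and p: "\<And>n. n < 3 \<Longrightarrow> p n = \<alpha> * P0 n + \<beta> * P1 n" and v: "\<And>n. n < 3 \<Longrightarrow> v n = \<gamma> * P0 n + \<delta> * P1 n"
    and \<alpha>: "\<alpha> \<noteq> 0" and ind: "\<alpha> * \<delta> \<noteq> \<beta> * \<gamma>"
  shows "fps_X ^ m dvd line_ev p v F \<longleftrightarrow> [:- (\<beta> / \<alpha>), 1:] ^ m dvd R F"
proof -
  \<comment> \<open>Chosen so that p + t v = u (P0 + \<zeta> P1).\<close>
  define u where "u = fps_const \<alpha> + fps_const \<gamma> * fps_X"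
  have u0: "u $ 0 \<noteq> 0" using \<alpha> by (simp add: u_def)
  have uu: "inverse u * u = 1" using u0 by (rule inverse_mult_eq_1)
  define \<zeta> where "\<zeta> = inverse u * (fps_const \<beta> + fps_const \<delta> * fps_X)"
  have \<zeta>: "u * \<zeta> = fps_const \<beta> + fps_const \<delta> * fps_X" unfolding \<zeta>_def using uu by (simp add: mult.assoc[symmetric] mult.commute[of u])
  define z where "z = \<beta> / \<alpha>"
  have "line_ev p v F = psub fps_const (\<lambda>n. u * (fps_const (P0 n) + \<zeta> * fps_const (P1 n))) F"
    unfolding line_ev_def
  proof (rule psub_cong[OF F(1)])
    fix n :: nat assume "n \<in> {0, 1, 2}"
    then have n: "n < 3" by auto
    have "u * (fps_const (P0 n) + \<zeta> * fps_const (P1 n)) = u * fps_const (P0 n) + (u * \<zeta>) * fps_const (P1 n)"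
      by (simp add: distrib_left mult.assoc)
    also have "\<dots> = fps_const (p n) + fps_const (v n) * fps_X"
      unfolding \<zeta> p[OF n] v[OF n] unfolding u_def by (simp add: algebra_simps flip: fps_const_add fps_const_mult)
    finally show "fps_const (p n) + fps_const (v n) * fps_X = u * (fps_const (P0 n) + \<zeta> * fps_const (P1 n))" ..
  qed
  also have "\<dots> = u ^ e * psub fps_const (\<lambda>n. fps_const (P0 n) + \<zeta> * fps_const (P1 n)) F"
    by (rule psub_homog[OF F(2)])
  also have "psub fps_const (\<lambda>n. fps_const (P0 n) + \<zeta> * fps_const (P1 n)) F = poly (map_poly fps_const (R F)) \<zeta>"
  proof -
    have h: "rhom (\<lambda>q. poly (map_poly fps_const q) \<zeta>)"
      by (rule rhom_comp[OF rhom_map_poly[OF rhom_fps_const]]) (simp add: rhom_def)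
    show ?thesis unfolding R_def psub_hom[OF h] by (simp add: map_poly_pCons)
  qed
  finally have ev: "line_ev p v F = u ^ e * poly (map_poly fps_const (R F)) \<zeta>" .
  show ?thesis
  proof (cases "R F = 0")
    case True
    then show ?thesis by (simp add: ev)
  next
    case False
    define k where "k = order z (R F)"
    obtain c where c: "R F = [:- z, 1:] ^ k * c" "\<not> [:- z, 1:] dvd c"
      using order_decomp[OF False, of z] unfolding k_def by blast
    have hm: "rhom (map_poly fps_const :: complex poly \<Rightarrow> complex fps poly)" by (rule rhom_map_poly[OF rhom_fps_const])
    define \<eta> where "\<eta> = inverse u * fps_const (\<delta> - z * \<gamma>)"
    have "u * (\<zeta> - fps_const z) = fps_const (\<delta> - z * \<gamma>) * fps_X"
    proof -
      have "fps_const \<alpha> * fps_const z = fps_const \<beta>" using \<alpha> by (simp add: z_def)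
      then have "u * fps_const z = fps_const \<beta> + fps_const (z * \<gamma>) * fps_X"
        unfolding u_def distrib_right by (simp add: mult.commute mult.left_commute)
      then show ?thesis unfolding right_diff_distrib \<zeta> by (simp add: algebra_simps flip: fps_const_sub)
    qed
    then have "inverse u * u * (\<zeta> - fps_const z) = \<eta> * fps_X" unfolding \<eta>_def by (simp add: mult.assoc)
    then have \<zeta>z: "\<zeta> - fps_const z = \<eta> * fps_X" unfolding uu by simp
    have \<eta>0: "\<eta> $ 0 \<noteq> 0" using u0 ind \<alpha> by (simp add: \<eta>_def z_def field_simps)
    have \<zeta>0: "\<zeta> $ 0 = z"
    proof -
      have "(\<zeta> - fps_const z) $ 0 = 0" unfolding \<zeta>z by simp
      then show ?thesis by simp
    qed
    have "poly (map_poly fps_const (R F)) \<zeta> = (\<eta> * fps_X) ^ k * poly (map_poly fps_const c) \<zeta>"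
    proof -
      have "poly (map_poly fps_const [:- z, 1:]) \<zeta> = \<eta> * fps_X"
        unfolding \<zeta>z[symmetric] by (simp add: map_poly_pCons fps_const_neg[symmetric] del: fps_const_neg)
      then show ?thesis
        unfolding c(1) rhom_mult[OF hm] rhom_power[OF hm] poly_mult poly_power by simp
    qed
    then have ev2: "line_ev p v F = fps_X ^ k * (u ^ e * \<eta> ^ k * poly (map_poly fps_const c) \<zeta>)"
      unfolding ev by (simp add: power_mult_distrib mult_ac)
    define W where "W = u ^ e * \<eta> ^ k * poly (map_poly fps_const c) \<zeta>"
    have "poly c z \<noteq> 0" using c(2) by (simp add: poly_eq_0_iff_dvd)
    then have W0: "W $ 0 \<noteq> 0" using u0 \<eta>0 by (simp add: W_def map_poly_fps_const_at[OF \<zeta>0])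
    have "fps_X ^ m dvd line_ev p v F \<longleftrightarrow> m \<le> k"
    proof
      assume "m \<le> k"
      then have "fps_X ^ m dvd (fps_X ^ k :: complex fps)" by (rule le_imp_power_dvd)
      then show "fps_X ^ m dvd line_ev p v F" unfolding ev2 by (rule dvd_mult2)
    next
      assume d: "fps_X ^ m dvd line_ev p v F"
      have "line_ev p v F $ k = W $ 0" unfolding ev2 W_def[symmetric] by (simp add: fps_X_power_mult_nth)
      then show "m \<le> k" using d W0 unfolding fps_X_power_dvd_iff by (metis not_le)
    qed
    also have "\<dots> \<longleftrightarrow> [:- z, 1:] ^ m dvd R F" using False by (simp add: order_divides k_def)
    finally show ?thesis unfolding z_def .
  qed
qed

lemma homog_Phi: assumes "homog_deriv e \<theta>" shows "homog (Suc e) (Phi N' \<theta>)"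
proof -
  have g: "homog (Suc e) (Const (N' n) * (Var l * dcoef \<theta> i - Var m * dcoef \<theta> j))" if "i \<in> {0,1,2}" "j \<in> {0,1,2}" for n l m i j
    using that assms homog_mult[OF homog_Var(1)[of l], of e] homog_mult[OF homog_Var(1)[of m], of e]
    by (auto simp: homog_deriv_iff intro!: homog_Const_mult homog_diff)
  show ?thesis unfolding Phi_def det3_def by (intro homog_add homog_diff g; simp)
qed

lemma inS_Phi: assumes "\<theta> \<in> D0 F" shows "inS (Phi N' \<theta>)"
proof -
  have "inS (dcoef \<theta> 0)" "inS (dcoef \<theta> 1)" "inS (dcoef \<theta> 2)" using assms unfolding D0_iff by blast+
  then show ?thesis unfolding Phi_def det3_def by (intro poly_in_add poly_in_diff poly_in_mult poly_in_Const inS_Var) simp_all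
qed

lemma R_Phi: "R (Phi N \<theta>) = det3 (\<lambda>n. [:N n:]) (\<lambda>n. [:P0 n, P1 n:]) (\<lambda>n. R (dcoef \<theta> n))"
  unfolding Phi_def det3_def by (simp add: rhom_simps[OF rhom_R])

text \<open>The cross product of a constant vector \<open>c\<close> with the gradient of
  \<open>F\<close>: a supply of derivations killing \<open>F\<close> whose restrictions can be
  computed without any knowledge of a basis.\<close>

definition koszul :: "(nat \<Rightarrow> complex) \<Rightarrow> mpoly \<Rightarrow> deriv" where
  "koszul c F = (Const (c 1) * pder 2 F - Const (c 2) * pder 1 F,
    Const (c 2) * pder 0 F - Const (c 0) * pder 2 F, Const (c 0) * pder 1 F - Const (c 1) * pder 0 F)"

lemma koszul_D0: "inS F \<Longrightarrow> koszul c F \<in> D0 F"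
  unfolding koszul_def D0_def by (auto simp: algebra_simps intro!: poly_in_diff poly_in_mult poly_in_pder)

lemma koszul_homog: "homog (Suc e) F \<Longrightarrow> homog_deriv e (koszul c F)"
  unfolding koszul_def homog_deriv_def by (auto intro!: homog_diff homog_Const_mult homog_pder)

lemma pder_lf: "n < 3 \<Longrightarrow> pder n (lf a) = Const (a n)"
proof -
  assume "n < 3"
  then consider "n = 0" | "n = 1" | "n = 2" by linarith
  then show ?thesis by cases (simp_all add: lf_def pder_add pder_mult pder_Var)
qed

text \<open>On the line, \<open>grad (f l) = f a\<close>, and \<open>det (N, X, c \<times> a) = (N c) (X a) - (N a) (X c) = - (c X)\<close>.\<close>

lemma R_Phi_koszul: "R (Phi N (koszul c (f * lf a))) = - R f * [:lin c P0, lin c P1:]"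
proof -
  define K where "K x = [:x:]" for x :: complex
  define X where "X n = [:P0 n, P1 n:]" for n
  have g: "R (pder n (f * lf a)) = R f * K (a n)" if "n < 3" for n
    by (simp add: pder_mult pder_lf[OF that] rhom_simps[OF rhom_R] K_def)
  have k: "R (dcoef (koszul c (f * lf a)) 0) = R f * (K (c 1) * K (a 2) - K (c 2) * K (a 1))"
    "R (dcoef (koszul c (f * lf a)) 1) = R f * (K (c 2) * K (a 0) - K (c 0) * K (a 2))"
    "R (dcoef (koszul c (f * lf a)) 2) = R f * (K (c 0) * K (a 1) - K (c 1) * K (a 0))"
    using g[of 0] g[of 1] g[of 2]
    by (simp_all only: koszul_def dcoef_simps dcoef_simps(2)[folded One_nat_def] rhom_diff[OF rhom_R] rhom_mult[OF rhom_R] R_Const K_def[symmetric]) (simp_all add: algebra_simps)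
  have "R (Phi N (koszul c (f * lf a))) = R f * (lin (\<lambda>n. K (N n)) (\<lambda>n. K (c n)) * lin X (\<lambda>n. K (a n)) - lin (\<lambda>n. K (N n)) (\<lambda>n. K (a n)) * lin X (\<lambda>n. K (c n)))"
    unfolding R_Phi det3_def k X_def[symmetric] unfolding K_def[symmetric] by (simp add: lin_def algebra_simps)
  moreover have "lin X (\<lambda>n. K (a n)) = [:lin a P0, lin a P1:]" "lin X (\<lambda>n. K (c n)) = [:lin c P0, lin c P1:]"
    "lin (\<lambda>n. K (N n)) (\<lambda>n. K (a n)) = [:lin a N:]"
    by (simp_all add: lin_def K_def X_def algebra_simps)
  ultimately show ?thesis unfolding l0 l1 lN by simp
qed

lemma point_nonzero: "\<exists>c. lin c P0 + z * lin c P1 \<noteq> 0"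
proof (rule ccontr)
  assume no: "\<nexists>c. lin c P0 + z * lin c P1 \<noteq> 0"
  have "P0 n + z * P1 n = 0" if n: "n < 3" for n
  proof -
    consider "n = 0" | "n = 1" | "n = 2" using n by linarith
    then show ?thesis using no[simplified, rule_format, of "\<lambda>m. if m = n then 1 else 0"] by cases (simp_all add: lin_def)
  qed
  then have "P0 0 = - z * P1 0" "P0 1 = - z * P1 1" "P0 2 = - z * P1 2"
    by (simp_all add: eq_neg_iff_add_eq_0)
  then have "det3 N P0 P1 = 0" by (simp add: det3_def algebra_simps)
  then show False using det_nz by simp
qed

lemma P1_nonzero: "\<exists>c. lin c P1 \<noteq> 0"
proof (rule ccontr)
  assume no: "\<nexists>c. lin c P1 \<noteq> 0"
  have "P1 n = 0" if n: "n < 3" for n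
  proof -
    consider "n = 0" | "n = 1" | "n = 2" using n by linarith
    then show ?thesis using no[simplified, rule_format, of "\<lambda>m. if m = n then 1 else 0"] by cases (simp_all add: lin_def)
  qed
  then have "det3 N P0 P1 = 0" by (simp add: det3_def)
  then show False using det_nz by simp
qed

text \<open>The affine coordinate \<beta>/\<alpha> of the point \<alpha> P0 + \<beta> P1. The
  denominator vanishes only at \<open>P1\<close>, which is kept off the curve.\<close>

definition zc :: "(nat \<Rightarrow> complex) \<Rightarrow> complex" where
  "zc p = det3 N P0 p / det3 N P0 P1 / (det3 N p P1 / det3 N P0 P1)"

lemma meval_scale:
  assumes "inS F" "homog e F" "\<And>n. n < 3 \<Longrightarrow> x n = c * y n"
  shows "meval F x = c ^ e * meval F y"
proof -
  have "meval F x = psub (\<lambda>c. c) (\<lambda>n. c * y n) F"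
    unfolding meval_eq_psub by (rule psub_cong[OF assms(1)]) (use assms(3) in auto)
  then show ?thesis using psub_homog[OF assms(2)] by (simp add: meval_eq_psub)
qed

lemma cap_coords:
  assumes f: "inS f" "homog d f" and fP1: "meval f P1 \<noteq> 0" and p: "p \<in> cap f (lf a)"
  shows "det3 N p P1 / det3 N P0 P1 \<noteq> 0"
    and "\<And>n. n < 3 \<Longrightarrow> p n = det3 N p P1 / det3 N P0 P1 * (P0 n + zc p * P1 n)"
    and "poly (R f) (zc p) = 0"
proof -
  have pp: "ppoint p" "meval f p = 0" "lin a p = 0" using p by (auto simp: cap_def meval_lf)
  define \<alpha> where "\<alpha> = det3 N p P1 / det3 N P0 P1"
  define \<beta> where "\<beta> = det3 N P0 p / det3 N P0 P1"
  have c: "p n = \<alpha> * P0 n + \<beta> * P1 n" if "n < 3" for n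
    using line_point_coords[OF pp(3) that] by (simp add: \<alpha>_def \<beta>_def)
  have \<alpha>: "\<alpha> \<noteq> 0"
  proof
    assume "\<alpha> = 0"
    then have pb: "p n = \<beta> * P1 n" if "n < 3" for n using c[OF that] by simp
    then have "meval f p = \<beta> ^ d * meval f P1" by (rule meval_scale[OF f])
    then have "\<beta> = 0" using pp(2) fP1 by auto
    then have "p (chart p) = 0" using pb ppoint_chart(1)[OF pp(1)] by simp
    then show False using ppoint_chart(2)[OF pp(1)] by simp
  qed
  then show "det3 N p P1 / det3 N P0 P1 \<noteq> 0" by (simp add: \<alpha>_def)
  have z: "zc p = \<beta> / \<alpha>" by (simp add: zc_def \<alpha>_def \<beta>_def)
  have az: "\<alpha> * zc p = \<beta>" using \<alpha> by (simp add: z)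
  have pz: "p n = \<alpha> * (P0 n + zc p * P1 n)" if "n < 3" for n
    unfolding distrib_left mult.assoc[symmetric] az by (rule c[OF that])
  show "p n = det3 N p P1 / det3 N P0 P1 * (P0 n + zc p * P1 n)" if "n < 3" for n
    using pz[OF that] unfolding \<alpha>_def .
  have "meval f p = \<alpha> ^ d * meval f (\<lambda>n. P0 n + zc p * P1 n)" by (rule meval_scale[OF f pz])
  then show "poly (R f) (zc p) = 0" using pp(2) \<alpha> by (simp add: poly_R)
qed

lemma cap_bij:
  assumes f: "inS f" "homog d f" and fP1: "meval f P1 \<noteq> 0"
  shows "bij_betw zc (cap f (lf a)) {z. poly (R f) z = 0}"
  unfolding bij_betw_def
proof
  show "inj_on zc (cap f (lf a))"
  proof (rule inj_onI)
    fix p p' assume p: "p \<in> cap f (lf a)" and p': "p' \<in> cap f (lf a)" and z: "zc p = zc p'"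
    define q where "q n = P0 n + zc p * P1 n" for n
    obtain \<alpha> where \<alpha>: "\<alpha> \<noteq> 0" "\<And>n. n < 3 \<Longrightarrow> p n = \<alpha> * q n"
      using cap_coords(1,2)[OF f fP1 p] unfolding q_def by blast
    obtain \<alpha>' where \<alpha>': "\<alpha>' \<noteq> 0" "\<And>n. n < 3 \<Longrightarrow> p' n = \<alpha>' * q n"
      using cap_coords(1,2)[OF f fP1 p'] unfolding q_def z by blast
    have pp: "ppoint p" "ppoint p'" using p p' by (auto simp: cap_def)
    note c = ppoint_chart[OF pp(1)] and c' = ppoint_chart[OF pp(2)]
    have "p n \<noteq> 0 \<longleftrightarrow> p' n \<noteq> 0" for n
    proof (cases "n < 3")
      case True then show ?thesis using \<alpha> \<alpha>' by simp
    next
      case False then show ?thesis using c(3) c'(3) by simp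
    qed
    then have ch: "chart p = chart p'" by (simp add: chart_def)
    have "\<alpha> * q (chart p) = 1" "\<alpha>' * q (chart p) = 1"
      using \<alpha>(2)[OF c(1)] c(2) \<alpha>'(2)[OF c'(1)] c'(2) ch by auto
    then have "\<alpha> = \<alpha>'" by (metis mult_cancel_right mult_zero_right zero_neq_one)
    show "p = p'"
    proof
      fix n show "p n = p' n"
      proof (cases "n < 3")
        case True then show ?thesis using \<alpha>(2)[of n] \<alpha>'(2)[of n] \<open>\<alpha> = \<alpha>'\<close> by simp
      next
        case False then show ?thesis using c(3) c'(3) by simp
      qed
    qed
  qed
  show "zc ` cap f (lf a) = {z. poly (R f) z = 0}"
  proof
    show "zc ` cap f (lf a) \<subseteq> {z. poly (R f) z = 0}" using cap_coords(3)[OF f fP1] by auto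
    show "{z. poly (R f) z = 0} \<subseteq> zc ` cap f (lf a)"
    proof
      fix z assume "z \<in> {z. poly (R f) z = 0}"
      then have z: "poly (R f) z = 0" by simp
      define q where "q n = P0 n + z * P1 n" for n
      have qn: "\<exists>n<3. q n \<noteq> 0"
      proof (rule ccontr)
        assume "\<not> (\<exists>n<3. q n \<noteq> 0)"
        then have q0: "q 0 = 0" "q 1 = 0" "q 2 = 0" by auto
        obtain c where "lin c P0 + z * lin c P1 \<noteq> 0" using point_nonzero by blast
        moreover have "lin c P0 + z * lin c P1 = c 0 * q 0 + c 1 * q 1 + c 2 * q 2"
          by (simp add: lin_def q_def algebra_simps)
        ultimately show False using q0 by simp
      qed
      define k where "k = (LEAST n. q n \<noteq> 0)"
      have k: "q k \<noteq> 0" "\<And>n. n < k \<Longrightarrow> q n = 0"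
      proof -
        have "\<exists>n. q n \<noteq> 0" using qn by blast
        then show "q k \<noteq> 0" unfolding k_def by (rule LeastI_ex)
        show "q n = 0" if "n < k" for n using not_less_Least[of n "\<lambda>n. q n \<noteq> 0"] that unfolding k_def by blast
      qed
      have k3: "k < 3"
      proof -
        obtain n where n: "n < 3" "q n \<noteq> 0" using qn by blast
        have "k \<le> n" unfolding k_def using n(2) by (rule Least_le)
        then show ?thesis using n(1) by simp
      qed
      define p where "p n = q n / q k" for n
      have "ppoint p"
        unfolding ppoint_def
      proof
        show "\<forall>n\<ge>3. p n = 0" using tail0 tail1 by (simp add: p_def q_def)
        show "\<exists>k<3. p k = 1 \<and> (\<forall>j<k. p j = 0)" using k k3 by (intro exI[of _ k]) (simp add: p_def)
      qed
      moreover have "meval f p = (1 / q k) ^ d * meval f q"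
        by (rule meval_scale[OF f]) (simp add: p_def)
      then have "meval f p = 0" using z unfolding poly_R q_def[symmetric] by (simp add: q_def[abs_def])
      moreover have "lin a p = (lin a P0 + z * lin a P1) / q k"
        by (simp add: lin_def p_def q_def field_simps add_divide_distrib)
      then have "lin a p = 0" using l0 l1 by simp
      ultimately have pc: "p \<in> cap f (lf a)" by (simp add: cap_def meval_lf)
      have "det3 N P0 p = z / q k * det3 N P0 P1"
        unfolding det3_def p_def q_def[of 0] q_def[of 1] q_def[of 2] by (simp add: algebra_simps add_divide_distrib diff_divide_distrib)
      moreover have "det3 N p P1 = 1 / q k * det3 N P0 P1"
        unfolding det3_def p_def q_def[of 0] q_def[of 1] q_def[of 2] by (simp add: algebra_simps add_divide_distrib diff_divide_distrib)
      ultimately have "zc p = z" using det_nz k(1) by (simp add: zc_def)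
      then show "z \<in> zc ` cap f (lf a)" using pc by blast
    qed
  qed
qed

text \<open>\<open>Q\<close> is described by divisibility alone, so that each application may
  produce it from its own generators. Its degree is the sum of its root orders;
  \<open>local_line\<close> computes these as 1 plus the local change of \<epsilon>.\<close>

theorem line_count:
  assumes f: "inS f" "homog d f" "f \<noteq> 0"
    and sqf: "\<And>q h. inS q \<Longrightarrow> inS h \<Longrightarrow> f = q * q * h \<Longrightarrow> \<exists>c. q = Const c"
    and nd: "\<not> lf a dvd f" and fP1: "meval f P1 \<noteq> 0"
    and Q: "Q \<noteq> 0"
    and Qd: "\<And>\<theta> e. \<theta> \<in> D0 (f * lf a) \<Longrightarrow> homog_deriv e \<theta> \<Longrightarrow> Q dvd R (Phi N \<theta>)"
    and Qg: "\<And>h. (\<And>\<theta> e. \<theta> \<in> D0 (f * lf a) \<Longrightarrow> homog_deriv e \<theta> \<Longrightarrow> h dvd R (Phi N \<theta>)) \<Longrightarrow> h dvd Q"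
  shows "int (card (cap f (lf a))) + eps_curves f (lf a) = int (degree Q)"
proof -
  have Rf: "R f \<noteq> 0" using R_homog(2)[OF f(2)] fP1 by auto
  have bij: "bij_betw zc (cap f (lf a)) {z. poly (R f) z = 0}" by (rule cap_bij[OF f(1,2) fP1])
  have fin: "finite {z. poly (R f) z = 0}" by (rule poly_roots_finite[OF Rf])
  have fl: "inS (f * lf a)" by (rule poly_in_mult[OF f(1) inS_lf])
  have flh: "homog (Suc d) (f * lf a)" using homog_mult[OF f(2) homog_lf, of a] by simp
  \<comment> \<open>\<open>Q\<close> divides the restrictions of all Koszul derivations, which are
    -f times arbitrary linear forms on the line; one of these forms is nonzero at z.\<close>
  have roots: "poly (R f) z = 0" if "poly Q z = 0" for z
  proof -
    obtain c where c: "lin c P0 + z * lin c P1 \<noteq> 0" using point_nonzero by blast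
    have "Q dvd - R f * [:lin c P0, lin c P1:]"
      using Qd[OF koszul_D0[OF fl] koszul_homog[OF flh], of c] unfolding R_Phi_koszul .
    then obtain k where "- R f * [:lin c P0, lin c P1:] = Q * k" by (rule dvdE)
    then have "poly (- R f * [:lin c P0, lin c P1:]) z = poly (Q * k) z" by (rule arg_cong)
    moreover have "poly (- R f * [:lin c P0, lin c P1:]) z = - (poly (R f) z * (lin c P0 + z * lin c P1))"
      by (simp add: algebra_simps)
    ultimately have "poly (R f) z * (lin c P0 + z * lin c P1) = 0" using that by simp
    then show ?thesis using c by simp
  qed
  have loc: "int (order (zc p) Q) = 1 + (eps_pt (f * lf a) p - eps_pt f p)" if p: "p \<in> cap f (lf a)" for p
  proof -
    have pp: "ppoint p" "meval f p = 0" "lin a p = 0" using p by (auto simp: cap_def meval_lf)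
    \<comment> \<open>\<open>f\<close> may be a nonzero constant, when the line is the whole free
      curve; the presence of an intersection point excludes this.\<close>
    have d: "d \<ge> 1"
    proof (rule ccontr)
      assume "\<not> d \<ge> 1"
      then have "degree (R f) = 0" using R_homog(1)[OF f(2)] by simp
      then obtain c where c: "R f = [:c:]" by (rule degree_eq_zeroE)
      then have "c = 0" using cap_coords(3)[OF f(1,2) fP1 p] by simp
      then show False using Rf c by simp
    qed
    obtain w v i j where fr: "line_frame p w v i j (chart p) a" and dv: "det3 N p v \<noteq> 0" and av: "lin a v = 0"
      using line_frame_exists[OF pp(1,3) lN] by blast
    have "\<exists>m. int m = 1 + eps_pt (f * lf a) p - eps_pt f p \<and>
      (\<forall>\<theta>\<in>D0 (f * lf a). fps_X ^ m dvd line_ev p v (Phi N \<theta>)) \<and>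
      (\<exists>\<theta>\<in>D0 (f * lf a). (\<exists>e. homog_deriv e \<theta>) \<and> \<not> fps_X ^ Suc m dvd line_ev p v (Phi N \<theta>))"
      by (rule line_frame.local_line[OF fr f d _ nd pp(2) refl dv]) (rule sqf)
    then obtain m where m: "int m = 1 + eps_pt (f * lf a) p - eps_pt f p"
      "\<forall>\<theta>\<in>D0 (f * lf a). fps_X ^ m dvd line_ev p v (Phi N \<theta>)"
      "\<exists>\<theta>\<in>D0 (f * lf a). (\<exists>e. homog_deriv e \<theta>) \<and> \<not> fps_X ^ Suc m dvd line_ev p v (Phi N \<theta>)"
      by (elim exE conjE)
    define \<alpha> where "\<alpha> = det3 N p P1 / det3 N P0 P1"
    define \<beta> where "\<beta> = det3 N P0 p / det3 N P0 P1"
    define \<gamma> where "\<gamma> = det3 N v P1 / det3 N P0 P1"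
    define \<delta> where "\<delta> = det3 N P0 v / det3 N P0 P1"
    have pe: "p n = \<alpha> * P0 n + \<beta> * P1 n" if "n < 3" for n
      using line_point_coords[OF pp(3) that] by (simp add: \<alpha>_def \<beta>_def)
    have ve: "v n = \<gamma> * P0 n + \<delta> * P1 n" if "n < 3" for n
      using line_point_coords[OF av that] by (simp add: \<gamma>_def \<delta>_def)
    have \<alpha>: "\<alpha> \<noteq> 0" using cap_coords(1)[OF f(1,2) fP1 p] by (simp add: \<alpha>_def)
    have "det3 N p v = (\<alpha> * \<delta> - \<beta> * \<gamma>) * det3 N P0 P1"
      unfolding det3_def by (simp add: pe ve algebra_simps)
    then have ind: "\<alpha> * \<delta> \<noteq> \<beta> * \<gamma>" using dv by auto
    have z: "zc p = \<beta> / \<alpha>" by (simp add: zc_def \<alpha>_def \<beta>_def)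
    have ord: "fps_X ^ l dvd line_ev p v (Phi N \<theta>) \<longleftrightarrow> [:- zc p, 1:] ^ l dvd R (Phi N \<theta>)"
      if "\<theta> \<in> D0 (f * lf a)" "homog_deriv e \<theta>" for l \<theta> e
      unfolding z by (rule line_ev_order[OF inS_Phi[OF that(1)] homog_Phi[OF that(2)] pe ve \<alpha> ind])
    \<comment> \<open>The m-th power divides every restriction, hence \<open>Q\<close>; the sharp
      homogeneous derivation from \<open>local_line\<close> excludes the next power.\<close>
    have "[:- zc p, 1:] ^ m dvd Q" by (rule Qg) (use m(2) ord in blast)
    then have "m \<le> order (zc p) Q" using Q by (simp add: order_divides)
    moreover have "\<not> [:- zc p, 1:] ^ Suc m dvd Q"
    proof
      assume q: "[:- zc p, 1:] ^ Suc m dvd Q"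
      obtain \<theta> e where \<theta>: "\<theta> \<in> D0 (f * lf a)" "homog_deriv e \<theta>" "\<not> fps_X ^ Suc m dvd line_ev p v (Phi N \<theta>)"
        using m(3) by blast
      have "[:- zc p, 1:] ^ Suc m dvd R (Phi N \<theta>)" using q Qd[OF \<theta>(1,2)] by (rule dvd_trans)
      then show False using ord[OF \<theta>(1,2)] \<theta>(3) by blast
    qed
    then have "\<not> Suc m \<le> order (zc p) Q" using order_divides[of "zc p" "Suc m" Q] Q by blast
    ultimately have "order (zc p) Q = m" by simp
    then show ?thesis using m(1) by simp
  qed
  have "degree Q = (\<Sum>z | poly Q z = 0. order z Q)" by (rule degree_eq_sum_order[OF Q])
  also have "\<dots> = (\<Sum>z | poly (R f) z = 0. order z Q)"
    by (rule sum.mono_neutral_left[OF fin]) (use roots Q Rf in \<open>auto simp: order_root\<close>)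
  also have "\<dots> = (\<Sum>p\<in>cap f (lf a). order (zc p) Q)"
    by (rule sum.reindex_bij_betw[OF bij, symmetric])
  finally have "int (degree Q) = (\<Sum>p\<in>cap f (lf a). int (order (zc p) Q))" by simp
  also have "\<dots> = (\<Sum>p\<in>cap f (lf a). 1 + (eps_pt (f * lf a) p - eps_pt f p))"
    by (rule sum.cong[OF refl loc])
  also have "\<dots> = int (card (cap f (lf a))) + eps_curves f (lf a)"
    by (simp add: sum.distrib eps_curves_def)
  finally show ?thesis by simp
qed

section \<open>Free curves containing the line\<close>

lemma dcoef_dlin: "dcoef (dlin h1 \<theta>1 h2 \<theta>2) n = h1 * dcoef \<theta>1 n + h2 * dcoef \<theta>2 n"
  by (cases \<theta>1; cases \<theta>2) (simp add: dlin_def dcoef_def)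

lemma R_Phi_dlin: "R (Phi N (dlin h1 \<theta>1 h2 \<theta>2)) = R h1 * R (Phi N \<theta>1) + R h2 * R (Phi N \<theta>2)"
  unfolding R_Phi det3_def dcoef_dlin by (simp add: rhom_simps[OF rhom_R] algebra_simps)

text \<open>The coefficient of top degree in the restriction is -f(P1) times the linear form c at
  \<open>P1\<close>, and some c is nonzero there.\<close>

lemma koszul_at_P1:
  assumes "homog d f" "meval f P1 \<noteq> 0" "homog (Suc d) (f * lf a)"
  shows "\<exists>c. meval (Phi N (koszul c (f * lf a))) P1 \<noteq> 0"
proof -
  obtain c where c: "lin c P1 \<noteq> 0" using P1_nonzero by blast
  have "homog (Suc d) (Phi N (koszul c (f * lf a)))" by (rule homog_Phi[OF koszul_homog[OF assms(3)]])
  then have "meval (Phi N (koszul c (f * lf a))) P1 = coeff (- R f * [:lin c P0, lin c P1:]) (d + 1)"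
    using R_homog(2) unfolding R_Phi_koszul[symmetric] by simp
  also have "\<dots> = - meval f P1 * lin c P1"
    using coeff_mult_bounded[of "- R f" d "[:lin c P0, lin c P1:]" 1] R_homog[OF assms(1)] by simp
  finally show ?thesis using c assms(2) by (intro exI[of _ c]) simp
qed

text \<open>Here \<open>f\<close> is the residual curve and \<open>f * lf a\<close> is the free one;
  the two generators make \<open>Q\<close> a gcd of two polynomials.\<close>

theorem component_count:
  assumes f: "inS f" "homog d f" "f \<noteq> 0"
    and sqf: "\<And>q h. inS q \<Longrightarrow> inS h \<Longrightarrow> f = q * q * h \<Longrightarrow> \<exists>c. q = Const c"
    and nd: "\<not> lf a dvd f" and fP1: "meval f P1 \<noteq> 0"
    and \<theta>1: "\<theta>1 \<in> D0 (f * lf a)" "homog_deriv e1 \<theta>1" and \<theta>2: "\<theta>2 \<in> D0 (f * lf a)" "homog_deriv e2 \<theta>2"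
    and gen: "\<And>\<theta>. \<theta> \<in> D0 (f * lf a) \<Longrightarrow> \<exists>h1 h2. inS h1 \<and> inS h2 \<and> \<theta> = dlin h1 \<theta>1 h2 \<theta>2"
  shows "int (card (cap f (lf a))) + eps_curves f (lf a) = int e2 + 1 \<or>
    int (card (cap f (lf a))) + eps_curves f (lf a) \<le> int e1 + 1"
proof -
  define A where "A = R (Phi N \<theta>1)"
  define B where "B = R (Phi N \<theta>2)"
  have fl: "inS (f * lf a)" by (rule poly_in_mult[OF f(1) inS_lf])
  have flh: "homog (Suc d) (f * lf a)" using homog_mult[OF f(2) homog_lf, of a] by simp
  have hA: "degree A \<le> Suc e1" "coeff A (Suc e1) = meval (Phi N \<theta>1) P1"
    unfolding A_def by (rule R_homog[OF homog_Phi[OF \<theta>1(2)]])+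
  have hB: "degree B \<le> Suc e2" "coeff B (Suc e2) = meval (Phi N \<theta>2) P1"
    unfolding B_def by (rule R_homog[OF homog_Phi[OF \<theta>2(2)]])+
  obtain c where c: "meval (Phi N (koszul c (f * lf a))) P1 \<noteq> 0" using koszul_at_P1[OF f(2) fP1 flh] by blast
  \<comment> \<open>Non-vanishing at infinity passes from the Koszul derivation to one of the two
    generators. This makes the gcd nonzero and fixes the degree of \<open>B\<close> when
    \<open>A\<close> is zero.\<close>
  obtain h1 h2 where h: "koszul c (f * lf a) = dlin h1 \<theta>1 h2 \<theta>2" using gen[OF koszul_D0[OF fl]] by blast
  have "Phi N (dlin h1 \<theta>1 h2 \<theta>2) = h1 * Phi N \<theta>1 + h2 * Phi N \<theta>2"
    unfolding Phi_def det3_def dcoef_dlin by (simp add: algebra_simps)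
  then have nz: "meval (Phi N \<theta>1) P1 \<noteq> 0 \<or> meval (Phi N \<theta>2) P1 \<noteq> 0"
    using c unfolding h by (auto simp: meval_eq_psub psub_add[OF rhom_id] psub_mult[OF rhom_id])
  define Q where "Q = gcd A B"
  have Q0: "Q \<noteq> 0" using nz hA(2) hB(2) by (auto simp: Q_def)
  have "int (card (cap f (lf a))) + eps_curves f (lf a) = int (degree Q)"
  proof (rule line_count[OF f sqf nd fP1 Q0])
    fix \<theta> e assume "\<theta> \<in> D0 (f * lf a)"
    then obtain h1 h2 where "\<theta> = dlin h1 \<theta>1 h2 \<theta>2" using gen by blast
    then have "R (Phi N \<theta>) = R h1 * A + R h2 * B" by (simp add: R_Phi_dlin A_def B_def)
    then show "Q dvd R (Phi N \<theta>)" by (simp add: Q_def)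
  next
    fix h assume "\<And>\<theta> e. \<theta> \<in> D0 (f * lf a) \<Longrightarrow> homog_deriv e \<theta> \<Longrightarrow> h dvd R (Phi N \<theta>)"
    then show "h dvd Q" using \<theta>1 \<theta>2 unfolding Q_def A_def B_def by (intro gcd_greatest)
  qed
  moreover have "degree Q = Suc e2 \<or> degree Q \<le> Suc e1"
  proof (cases "A = 0")
    case True
    then have "coeff B (Suc e2) \<noteq> 0" using nz hA(2) hB(2) by simp
    then have "degree B = Suc e2" using hB(1) le_degree by (metis le_antisym)
    moreover have "degree Q = degree B"
    proof (rule antisym)
      have "Q dvd B" "B dvd Q" "B \<noteq> 0" using True Q0 by (auto simp: Q_def)
      then show "degree Q \<le> degree B" "degree B \<le> degree Q" using Q0 by (auto intro: dvd_imp_degree_le)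
    qed
    ultimately show ?thesis by simp
  next
    case False
    then have "degree Q \<le> degree A" unfolding Q_def by (intro dvd_imp_degree_le) auto
    then show ?thesis using hA(1) by simp
  qed
  ultimately show ?thesis by auto
qed

section \<open>Free curves not containing the line\<close>

definition sub_euler :: "mpoly \<Rightarrow> deriv \<Rightarrow> deriv" where
  "sub_euler \<kappa> \<theta> = (dcoef \<theta> 0 - \<kappa> * Var 0, dcoef \<theta> 1 - \<kappa> * Var 1, dcoef \<theta> 2 - \<kappa> * Var 2)"

lemma act_sub_euler:
  assumes "inS F" "homog e F"
  shows "act (dcoef (sub_euler \<kappa> \<theta>)) F = act (dcoef \<theta>) F - \<kappa> * (of_nat e * F)"
proof -
  have "act (dcoef (sub_euler \<kappa> \<theta>)) F = act (dcoef \<theta>) F - \<kappa> * (Var 0 * pder 0 F + Var 1 * pder 1 F + Var 2 * pder 2 F)"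
    by (simp add: act_def sub_euler_def algebra_simps)
  then show ?thesis unfolding euler_formula[OF assms(2,1)] .
qed

lemma Phi_sub_euler: "Phi N' (sub_euler \<kappa> \<theta>) = Phi N' \<theta>"
  by (simp add: Phi_def det3_def sub_euler_def algebra_simps)

text \<open>A derivation with \<open>\<theta> F = \<kappa> F\<close> becomes an element of \<open>D0 F\<close> after subtracting a multiple of the Euler derivation.\<close>

lemma sub_euler_D0:
  assumes F: "inS F" "homog e F" "e \<ge> 1" and \<theta>: "inS (dcoef \<theta> 0)" "inS (dcoef \<theta> 1)" "inS (dcoef \<theta> 2)"
    and \<kappa>: "inS \<kappa>" "act (dcoef \<theta>) F = \<kappa> * F"
  shows "sub_euler (Const (1 / of_nat e) * \<kappa>) \<theta> \<in> D0 F"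
proof -
  let ?c = "Const (1 / of_nat e) * \<kappa>"
  have "Const (1 / of_nat e) * of_nat e = (1 :: mpoly)"
  proof -
    have "Const (1 / of_nat e) * Const (of_nat e) = Const (1 / of_nat e * of_nat e)" by (rule Const_mult[symmetric])
    also have "\<dots> = 1" using F(3) by simp
    finally show ?thesis by (simp only: rhom_of_nat[OF rhom_Const])
  qed
  then have "?c * (of_nat e * F) = \<kappa> * F" by (metis (no_types, lifting) mult.assoc mult.commute mult.left_neutral)
  then have "act (dcoef (sub_euler ?c \<theta>)) F = 0" unfolding act_sub_euler[OF F(1,2)] \<kappa>(2) by simp
  moreover have "inS (dcoef (sub_euler ?c \<theta>) 0)" "inS (dcoef (sub_euler ?c \<theta>) 1)" "inS (dcoef (sub_euler ?c \<theta>) 2)"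
    unfolding sub_euler_def dcoef_simps dcoef_simps(2)[folded One_nat_def]
    by (intro poly_in_diff poly_in_mult poly_in_Const \<theta> \<kappa>(1) inS_Var; simp)+
  ultimately show ?thesis unfolding D0_iff act_def by blast
qed

text \<open>\<open>E0\<close> restricts to 1, so its powers bring every monomial z^n up to degree
  \<open>e\<close>.\<close>

lemma homog_lift:
  assumes "degree q \<le> e"
  shows "\<exists>F. inS F \<and> homog e F \<and> R F = q"
proof -
  define F where "F = (\<Sum>n\<le>e. Const (coeff q n) * (E1 ^ n * E0 ^ (e - n)))"
  have "homog e (Const (coeff q n) * (E1 ^ n * E0 ^ (e - n)))" if "n \<le> e" for n
    using homog_mult[OF homog_power[OF homog_E1, of n] homog_power[OF homog_E0, of "e - n"]] that
    by (intro homog_Const_mult) simp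
  then have "homog e F" unfolding F_def by (intro homog_sum) simp
  moreover have "inS F" unfolding F_def
    by (intro poly_in_sum poly_in_mult poly_in_power poly_in_Const inS_E0 inS_E1)
  moreover have "R F = q"
  proof -
    have "R F = (\<Sum>n\<le>e. monom (coeff q n) n)"
      unfolding F_def by (simp add: rhom_simps[OF rhom_R] monom_altdef)
    also have "\<dots> = q"
      by (rule poly_eqI) (use assms in \<open>auto simp: coeff_sum coeff_eq_0\<close>)
    finally show ?thesis .
  qed
  ultimately show ?thesis by blast
qed

lemma act_dlin: "act (dcoef (dlin h1 \<theta>1 h2 \<theta>2)) F = h1 * act (dcoef \<theta>1) F + h2 * act (dcoef \<theta>2) F"
  by (simp add: act_def dcoef_dlin algebra_simps)

lemma koszul_act_lf: "R (act (dcoef (koszul c f)) (lf a)) =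
   [:c 0:] * ([:a 2:] * R (pder 1 f) - [:a 1:] * R (pder 2 f)) + [:c 1:] * ([:a 0:] * R (pder 2 f) - [:a 2:] * R (pder 0 f))
    + [:c 2:] * ([:a 1:] * R (pder 0 f) - [:a 0:] * R (pder 1 f))"
proof -
  define K where "K x = [:x:]" for x :: complex
  have "R (act (dcoef (koszul c f)) (lf a)) = K (a 0) * (K (c 1) * R (pder 2 f) - K (c 2) * R (pder 1 f))
    + K (a 1) * (K (c 2) * R (pder 0 f) - K (c 0) * R (pder 2 f)) + K (a 2) * (K (c 0) * R (pder 1 f) - K (c 1) * R (pder 0 f))"
    unfolding act_lf koszul_def dcoef_simps dcoef_simps(2)[folded One_nat_def]
    by (simp only: rhom_add[OF rhom_R] rhom_diff[OF rhom_R] rhom_mult[OF rhom_R] R_Const K_def)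
  then show ?thesis unfolding K_def[symmetric] by (simp add: algebra_simps)
qed

text \<open>If all Koszul derivations of f were tangent to the line, the gradient of f would be a
  multiple of the vector a along it, and Euler's formula would give d f = 0 there. So the two values
  of the basis on l cannot both vanish on the line.\<close>

lemma tangent_to_line_impossible:
  assumes f: "inS f" "homog d f" "d \<ge> 1" and Rf: "R f \<noteq> 0"
  shows "\<exists>c. R (act (dcoef (koszul c f)) (lf a)) \<noteq> 0"
proof (rule ccontr)
  assume no: "\<nexists>c. R (act (dcoef (koszul c f)) (lf a)) \<noteq> 0"
  define K where "K x = [:x:]" for x :: complex
  define g where "g n = R (pder n f)" for n
  have e: "K (a 2) * g 1 - K (a 1) * g 2 = 0" "K (a 0) * g 2 - K (a 2) * g 0 = 0" "K (a 1) * g 0 - K (a 0) * g 1 = 0"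
  proof -
    have "R (act (dcoef (koszul c f)) (lf a)) = 0" for c using no by blast
    then have z: "K (c 0) * (K (a 2) * g 1 - K (a 1) * g 2) + K (c 1) * (K (a 0) * g 2 - K (a 2) * g 0)
      + K (c 2) * (K (a 1) * g 0 - K (a 0) * g 1) = 0" for c :: "nat \<Rightarrow> complex"
      unfolding koszul_act_lf K_def[symmetric] g_def[symmetric] .
    have K01: "K 0 = 0" "K 1 = 1" by (simp_all add: K_def one_pCons)
    show "K (a 2) * g 1 - K (a 1) * g 2 = 0" using z[of "\<lambda>n. if n = 0 then 1 else 0"] by (simp add: K01)
    show "K (a 0) * g 2 - K (a 2) * g 0 = 0" using z[of "\<lambda>n. if n = 1 then 1 else 0"] by (simp add: K01)
    show "K (a 1) * g 0 - K (a 0) * g 1 = 0" using z[of "\<lambda>n. if n = 2 then 1 else 0"] by (simp add: K01)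
  qed
  define s where "s = K (N 0) * g 0 + K (N 1) * g 1 + K (N 2) * g 2"
  have KN: "K (a 0) * K (N 0) + K (a 1) * K (N 1) + K (a 2) * K (N 2) = 1"
    using lN by (simp add: K_def lin_def one_pCons mult.commute)
  have g: "g 0 = K (a 0) * s" "g 1 = K (a 1) * s" "g 2 = K (a 2) * s"
    using e KN unfolding s_def by algebra+
  define X where "X n = [:P0 n, P1 n:]" for n
  have lX: "K (a 0) * X 0 + K (a 1) * X 1 + K (a 2) * X 2 = 0"
  proof -
    have "K (a 0) * X 0 + K (a 1) * X 1 + K (a 2) * X 2 = [:lin a P0, lin a P1:]"
      by (simp add: K_def X_def lin_def algebra_simps)
    then show ?thesis using l0 l1 by simp
  qed
  have "R (of_nat d * f) = R (Var 0 * pder 0 f + Var 1 * pder 1 f + Var 2 * pder 2 f)"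
    unfolding euler_formula[OF f(2,1)] ..
  also have "\<dots> = X 0 * g 0 + X 1 * g 1 + X 2 * g 2"
    unfolding rhom_add[OF rhom_R] rhom_mult[OF rhom_R] R_Var X_def g_def ..
  also have "\<dots> = 0" unfolding g using lX by algebra
  finally have "of_nat d * R f = 0" by (simp add: rhom_simps[OF rhom_R])
  then show False using Rf f(3) by simp
qed

lemma meval_eq_0_on_line: "lin a x = 0 \<Longrightarrow> lf a dvd F \<Longrightarrow> meval F x = 0"
  by (auto elim!: dvdE simp: meval_eq_psub psub_mult[OF rhom_id] meval_lf[unfolded meval_eq_psub])

text \<open>The line brings one new condition, a syzygy between the restrictions of
  \<open>u1\<close> and \<open>u2\<close>. Dividing these by their gcd \<open>G\<close> gives the
  generating syzygy (V2, -V1), hence \<open>Q\<close>, and \<open>G * Q\<close> is a determinant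
  \<open>\<Delta>\<close> of degree e1 + e2 + 1.\<close>

theorem addition_count:
  assumes f: "inS f" "homog d f" "f \<noteq> 0" and d: "d \<ge> 1"
    and sqf: "\<And>q h. inS q \<Longrightarrow> inS h \<Longrightarrow> f = q * q * h \<Longrightarrow> \<exists>c. q = Const c"
    and nd: "\<not> lf a dvd f" and fP1: "meval f P1 \<noteq> 0"
    and \<theta>1: "\<theta>1 \<in> D0 f" "homog_deriv e1 \<theta>1" and \<theta>2: "\<theta>2 \<in> D0 f" "homog_deriv e2 \<theta>2"
    and gen: "\<And>\<theta>. \<theta> \<in> D0 f \<Longrightarrow> \<exists>h1 h2. inS h1 \<and> inS h2 \<and> \<theta> = dlin h1 \<theta>1 h2 \<theta>2"
    and u1P: "\<not> lf a dvd act (dcoef \<theta>1) (lf a) \<Longrightarrow> meval (act (dcoef \<theta>1) (lf a)) P1 \<noteq> 0"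
    and u2P: "\<not> lf a dvd act (dcoef \<theta>2) (lf a) \<Longrightarrow> meval (act (dcoef \<theta>2) (lf a)) P1 \<noteq> 0"
  shows "int (card (cap f (lf a))) + eps_curves f (lf a) = int e1 + 1 \<or>
    int (card (cap f (lf a))) + eps_curves f (lf a) \<ge> int e2 + 1"
proof -
  define u1 where "u1 = act (dcoef \<theta>1) (lf a)"
  define u2 where "u2 = act (dcoef \<theta>2) (lf a)"
  define A where "A = R (Phi N \<theta>1)"
  define B where "B = R (Phi N \<theta>2)"
  define F where "F = f * lf a"
  have fl: "inS F" unfolding F_def by (rule poly_in_mult[OF f(1) inS_lf])
  have flh: "homog (Suc d) F" using homog_mult[OF f(2) homog_lf, of a] by (simp add: F_def)
  have Rf: "R f \<noteq> 0" using R_homog(2)[OF f(2)] fP1 by auto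
  have c1: "inS (dcoef \<theta>1 0)" "inS (dcoef \<theta>1 1)" "inS (dcoef \<theta>1 2)" using \<theta>1(1) unfolding D0_iff by blast+
  have c2: "inS (dcoef \<theta>2 0)" "inS (dcoef \<theta>2 1)" "inS (dcoef \<theta>2 2)" using \<theta>2(1) unfolding D0_iff by blast+
  have u1h: "homog e1 u1" unfolding u1_def act_lf
    using \<theta>1(2) unfolding homog_deriv_iff by (intro homog_add homog_Const_mult) blast+
  have u2h: "homog e2 u2" unfolding u2_def act_lf
    using \<theta>2(2) unfolding homog_deriv_iff by (intro homog_add homog_Const_mult) blast+
  have Rl: "R x = 0" if dl: "lf a dvd x" for x
  proof -
    obtain y where "x = lf a * y" using dl by (rule dvdE)
    then show ?thesis by (simp add: rhom_mult[OF rhom_R])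
  qed
  have Ru1: "R u1 \<noteq> 0 \<Longrightarrow> meval u1 P1 \<noteq> 0"
    using u1P Rl[of u1] unfolding u1_def[symmetric] by blast
  have Ru2: "R u2 \<noteq> 0 \<Longrightarrow> meval u2 P1 \<noteq> 0"
    using u2P Rl[of u2] unfolding u2_def[symmetric] by blast
  have Rnz: "R u1 \<noteq> 0 \<or> R u2 \<noteq> 0"
  proof -
    obtain c where c: "R (act (dcoef (koszul c f)) (lf a)) \<noteq> 0" using tangent_to_line_impossible[OF f(1,2) d Rf] by blast
    obtain h1 h2 where "koszul c f = dlin h1 \<theta>1 h2 \<theta>2" using gen[OF koszul_D0[OF f(1)]] by blast
    then have "R (act (dcoef (koszul c f)) (lf a)) = R h1 * R u1 + R h2 * R u2"
      by (simp add: act_dlin u1_def u2_def rhom_simps[OF rhom_R])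
    then show ?thesis using c by auto
  qed

  \<comment> \<open>An Euler correction moves the derivation into the free module of
    \<open>f\<close> without altering \<open>Phi\<close>; tangency to the line becomes the condition
    on the coefficients.\<close>
  have reduce: "\<exists>h1 h2. lf a dvd h1 * u1 + h2 * u2 \<and> Phi N \<theta> = h1 * Phi N \<theta>1 + h2 * Phi N \<theta>2"
    if \<theta>: "\<theta> \<in> D0 F" for \<theta>
  proof -
    have cS: "inS (dcoef \<theta> 0)" "inS (dcoef \<theta> 1)" "inS (dcoef \<theta> 2)" using \<theta> unfolding D0_iff by blast+
    have a0: "act (dcoef \<theta>) (f * lf a) = 0" using \<theta> unfolding D0_iff act_def F_def by blast
    note lg = logarithmic_of_product[OF a_nz nd a0]
    obtain \<kappa> where \<kappa>: "act (dcoef \<theta>) f = f * \<kappa>" using lg(2) by (rule dvdE)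
    have "inS (act (dcoef \<theta>) f)"
      unfolding act_def by (intro poly_in_add poly_in_mult poly_in_pder cS f)
    then have \<kappa>S: "inS \<kappa>" unfolding \<kappa> using f(1,3) by (rule inS_cancel)
    let ?\<theta> = "sub_euler (Const (1 / of_nat d) * \<kappa>) \<theta>"
    have "?\<theta> \<in> D0 f"
      by (rule sub_euler_D0[OF f(1,2) d cS \<kappa>S]) (simp add: \<kappa> mult.commute)
    then obtain h1 h2 where h: "?\<theta> = dlin h1 \<theta>1 h2 \<theta>2" using gen by blast
    have "h1 * u1 + h2 * u2 = act (dcoef ?\<theta>) (lf a)" unfolding h act_dlin u1_def u2_def ..
    also have "\<dots> = act (dcoef \<theta>) (lf a) - Const (1 / of_nat d) * \<kappa> * (of_nat 1 * lf a)"
      by (rule act_sub_euler[OF inS_lf homog_lf])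
    finally have "lf a dvd h1 * u1 + h2 * u2" using lg(1) by (simp add: dvd_diff)
    moreover have "Phi N \<theta> = Phi N (dlin h1 \<theta>1 h2 \<theta>2)" unfolding h[symmetric] Phi_sub_euler ..
    then have "Phi N \<theta> = h1 * Phi N \<theta>1 + h2 * Phi N \<theta>2"
      unfolding Phi_def det3_def dcoef_dlin by (simp add: algebra_simps)
    ultimately show ?thesis by blast
  qed
  have hA: "degree A \<le> Suc e1" "coeff A (Suc e1) = meval (Phi N \<theta>1) P1"
    unfolding A_def by (rule R_homog[OF homog_Phi[OF \<theta>1(2)]])+
  have hB: "degree B \<le> Suc e2" "coeff B (Suc e2) = meval (Phi N \<theta>2) P1"
    unfolding B_def by (rule R_homog[OF homog_Phi[OF \<theta>2(2)]])+
  have h1: "degree (R u1) \<le> e1" "coeff (R u1) e1 = meval u1 P1" by (rule R_homog[OF u1h])+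
  have h2: "degree (R u2) \<le> e2" "coeff (R u2) e2 = meval u2 P1" by (rule R_homog[OF u2h])+
  define \<Delta> where "\<Delta> = R u2 * A - R u1 * B"
  \<comment> \<open>This is the top coefficient of \<Delta>. If it vanished, then in the relation x
    u1 + y u2 = 0 at \<open>P1\<close> coming from a Koszul derivation with nonzero
    \<open>Phi\<close> there, both u1 and u2 would vanish at \<open>P1\<close>. The choice of
    \<open>P1\<close> allows this only if both vanish on the whole line.\<close>
  have nz: "meval u2 P1 * meval (Phi N \<theta>1) P1 - meval u1 P1 * meval (Phi N \<theta>2) P1 \<noteq> 0"
  proof
    assume z: "meval u2 P1 * meval (Phi N \<theta>1) P1 - meval u1 P1 * meval (Phi N \<theta>2) P1 = 0"
    obtain c where c: "meval (Phi N (koszul c F)) P1 \<noteq> 0"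
      using koszul_at_P1[OF f(2) fP1] flh unfolding F_def by blast
    obtain x y where xy: "lf a dvd x * u1 + y * u2" "Phi N (koszul c F) = x * Phi N \<theta>1 + y * Phi N \<theta>2"
      using reduce[OF koszul_D0[OF fl]] by blast
    have "meval (x * u1 + y * u2) P1 = 0" by (rule meval_eq_0_on_line[OF l1 xy(1)])
    then have 1: "meval x P1 * meval u1 P1 + meval y P1 * meval u2 P1 = 0"
      by (simp add: meval_eq_psub psub_add[OF rhom_id] psub_mult[OF rhom_id])
    have 2: "meval x P1 * meval (Phi N \<theta>1) P1 + meval y P1 * meval (Phi N \<theta>2) P1 \<noteq> 0"
      using c unfolding xy(2) by (simp add: meval_eq_psub psub_add[OF rhom_id] psub_mult[OF rhom_id])
    have "meval u1 P1 * (meval x P1 * meval (Phi N \<theta>1) P1 + meval y P1 * meval (Phi N \<theta>2) P1) = 0"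
      using 1 z by algebra
    moreover have "meval u2 P1 * (meval x P1 * meval (Phi N \<theta>1) P1 + meval y P1 * meval (Phi N \<theta>2) P1) = 0"
      using 1 z by algebra
    ultimately show False using 2 Rnz Ru1 Ru2 by auto
  qed
  have c\<Delta>: "coeff \<Delta> (e1 + e2 + 1) \<noteq> 0"
  proof -
    have "coeff (R u2 * A) (e2 + Suc e1) = meval u2 P1 * meval (Phi N \<theta>1) P1"
      using coeff_mult_bounded[OF h2(1) hA(1)] h2(2) hA(2) by simp
    moreover have "coeff (R u1 * B) (e1 + Suc e2) = meval u1 P1 * meval (Phi N \<theta>2) P1"
      using coeff_mult_bounded[OF h1(1) hB(1)] h1(2) hB(2) by simp
    moreover have "e2 + Suc e1 = e1 + e2 + 1" "e1 + Suc e2 = e1 + e2 + 1" by simp_all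
    ultimately show ?thesis using nz by (simp only: \<Delta>_def coeff_diff not_False_eq_True)
  qed
  have d\<Delta>: "degree \<Delta> = e1 + e2 + 1"
  proof (rule antisym)
    have "degree (R u2 * A) \<le> e1 + e2 + 1" using degree_mult_le[of "R u2" A] h2(1) hA(1) by linarith
    moreover have "degree (R u1 * B) \<le> e1 + e2 + 1" using degree_mult_le[of "R u1" B] h1(1) hB(1) by linarith
    ultimately show "degree \<Delta> \<le> e1 + e2 + 1" unfolding \<Delta>_def by (rule degree_diff_le)
    show "e1 + e2 + 1 \<le> degree \<Delta>" by (rule le_degree[OF c\<Delta>])
  qed
  define G where "G = gcd (R u1) (R u2)"
  have G0: "G \<noteq> 0" using Rnz by (auto simp: G_def)
  then obtain V1 V2 where V: "R u1 = V1 * G" "R u2 = V2 * G" "coprime V1 V2"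
    using gcd_coprime_exists[of "R u1" "R u2"] unfolding G_def by blast
  define Q where "Q = V2 * A - V1 * B"
  have GQ: "G * Q = \<Delta>" unfolding \<Delta>_def Q_def V(1,2) by (simp add: algebra_simps)
  have Q0: "Q \<noteq> 0" using GQ c\<Delta> by auto
  have dGQ: "degree G + degree Q = e1 + e2 + 1" using degree_mult_eq[OF G0 Q0] GQ d\<Delta> by simp
  have "int (card (cap f (lf a))) + eps_curves f (lf a) = int (degree Q)"
  proof (rule line_count[OF f _ nd fP1 Q0])
    fix \<theta> e assume "\<theta> \<in> D0 (f * lf a)"
    then obtain x y where xy: "lf a dvd x * u1 + y * u2" "Phi N \<theta> = x * Phi N \<theta>1 + y * Phi N \<theta>2"
      using reduce unfolding F_def by blast
    have "R (x * u1 + y * u2) = 0" by (rule Rl[OF xy(1)])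
    then have "G * (R x * V1 + R y * V2) = 0" by (simp add: rhom_simps[OF rhom_R] V(1,2) algebra_simps)
    then have z: "R x * V1 + R y * V2 = 0" using G0 by simp
    \<comment> \<open>Coprimality of V1 and V2 makes (R x, R y) a multiple of (V2, -V1); the Bezout
      relation produces the factor \<open>w\<close>.\<close>
    obtain s t where st: "s * V1 + t * V2 = 1"
      using bezout_coefficients_fst_snd[of V1 V2] V(3) by (metis coprime_iff_gcd_eq_1)
    define w where "w = t * R x - s * R y"
    have "R x = V2 * w" "R y = - (V1 * w)" unfolding w_def using z st by algebra+
    then have "R (Phi N \<theta>) = w * Q"
      unfolding xy(2) Q_def by (simp add: rhom_simps[OF rhom_R] A_def B_def algebra_simps)
    then show "Q dvd R (Phi N \<theta>)" by simp
  next
    fix h assume hd: "\<And>\<theta> e. \<theta> \<in> D0 (f * lf a) \<Longrightarrow> homog_deriv e \<theta> \<Longrightarrow> h dvd R (Phi N \<theta>)"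
    \<comment> \<open>\<open>Q\<close> itself is realised by one homogeneous derivation, lifted from
      V2 \<theta>1 - V1 \<theta>2 on the line. Lifting V2 and V1 to degrees m + e2 and m + e1 gives
      both terms the degree m + e1 + e2.\<close>
    define m where "m = degree V1 + degree V2 + 1"
    obtain x where x: "inS x" "homog (m + e2) x" "R x = V2" using homog_lift[of V2 "m + e2"] by (auto simp: m_def)
    obtain y where y: "inS y" "homog (m + e1) y" "R y = - V1" using homog_lift[of "- V1" "m + e1"] by (auto simp: m_def)
    define \<theta>' where "\<theta>' = dlin x \<theta>1 y \<theta>2"
    have c': "inS (dcoef \<theta>' 0)" "inS (dcoef \<theta>' 1)" "inS (dcoef \<theta>' 2)"
      unfolding \<theta>'_def dcoef_dlin by (intro poly_in_add poly_in_mult x y c1 c2)+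
    define e where "e = degree V1 + degree V2 + e1 + e2"
    have hom': "homog (Suc e) (dcoef \<theta>' n)" if "n \<in> {0, 1, 2}" for n
    proof -
      have "homog e1 (dcoef \<theta>1 n)" "homog e2 (dcoef \<theta>2 n)"
        using \<theta>1(2) \<theta>2(2) that unfolding homog_deriv_iff by auto
      then have "homog (m + e2 + e1) (x * dcoef \<theta>1 n)" "homog (m + e1 + e2) (y * dcoef \<theta>2 n)"
        using x(2) y(2) by (auto intro: homog_mult)
      moreover have "m + e2 + e1 = Suc e" "m + e1 + e2 = Suc e" by (simp_all add: m_def e_def)
      ultimately show ?thesis unfolding \<theta>'_def dcoef_dlin by (auto intro: homog_add)
    qed
    have al: "act (dcoef \<theta>') (lf a) = x * u1 + y * u2" unfolding \<theta>'_def act_dlin u1_def u2_def ..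
    have ahom: "homog (Suc e) (act (dcoef \<theta>') (lf a))"
      unfolding act_lf by (intro homog_add homog_Const_mult hom') auto
    have aS: "inS (act (dcoef \<theta>') (lf a))"
      unfolding act_lf by (intro poly_in_add poly_in_mult poly_in_Const c')
    have "R (act (dcoef \<theta>') (lf a)) = 0"
      unfolding al by (simp add: rhom_simps[OF rhom_R] x(3) y(3) V(1,2))
    from lf_dvd_of_R_zero[OF aS ahom this] obtain \<kappa> where \<kappa>: "act (dcoef \<theta>') (lf a) = lf a * \<kappa>" by (rule dvdE)
    have \<kappa>S: "inS \<kappa>" using aS inS_lf lf_nz[OF a_nz] unfolding \<kappa> by (rule inS_cancel)
    have \<kappa>h: "homog e \<kappa>" using homog_cancel[OF _ homog_lf lf_nz[OF a_nz], of e \<kappa>] ahom unfolding \<kappa> by simp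
    have "act (dcoef \<theta>') f = x * act (dcoef \<theta>1) f + y * act (dcoef \<theta>2) f" unfolding \<theta>'_def act_dlin ..
    also have "\<dots> = 0" using \<theta>1(1) \<theta>2(1) unfolding D0_iff act_def by simp
    finally have aF: "act (dcoef \<theta>') F = \<kappa> * F" unfolding F_def act_mult \<kappa> by simp
    define \<theta> where "\<theta> = sub_euler (Const (1 / of_nat (Suc d)) * \<kappa>) \<theta>'"
    have t1: "\<theta> \<in> D0 (f * lf a)"
      using sub_euler_D0[OF fl flh _ c' \<kappa>S aF] unfolding \<theta>_def F_def by simp
    have eu: "homog (Suc e) (dcoef \<theta>' n - Const (1 / of_nat (Suc d)) * \<kappa> * Var l)" if "n \<in> {0, 1, 2}" for n l
      using homog_mult[OF homog_Const_mult[OF \<kappa>h] homog_Var(1)[of l]] hom'[OF that] by (auto intro: homog_diff)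
    have t2: "homog_deriv (Suc e) \<theta>"
      unfolding homog_deriv_iff \<theta>_def sub_euler_def dcoef_simps dcoef_simps(2)[folded One_nat_def] by (intro conjI eu) auto
    have "R (Phi N \<theta>) = Q"
      unfolding \<theta>_def Phi_sub_euler \<theta>'_def R_Phi_dlin x(3) y(3) Q_def A_def B_def by simp
    then show "h dvd Q" using hd[OF t1 t2] by simp
  qed (rule sqf)
  moreover have "degree Q = e1 + 1 \<or> degree Q \<ge> e2 + 1"
  proof (cases "R u1 = 0")
    case True
    then have "R u2 \<noteq> 0" using Rnz by simp
    then have "coeff (R u2) e2 \<noteq> 0" using Ru2 h2(2) by simp
    then have "degree (R u2) = e2" using h2(1) le_degree by (metis le_antisym)
    moreover have "degree G = degree (R u2)"
    proof (rule antisym)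
      have "G dvd R u2" "R u2 dvd G" using True by (auto simp: G_def)
      then show "degree G \<le> degree (R u2)" "degree (R u2) \<le> degree G"
        using G0 \<open>R u2 \<noteq> 0\<close> by (auto intro: dvd_imp_degree_le)
    qed
    ultimately show ?thesis using dGQ by simp
  next
    case False
    then have "degree G \<le> degree (R u1)" unfolding G_def by (intro dvd_imp_degree_le) auto
    then show ?thesis using dGQ h1(1) by simp
  qed
  ultimately show ?thesis by auto
qed

end

text \<open>A form not divisible by l has finitely many zeros on the line, so some B0 + z B1 misses
  them all and becomes the new point at infinity. Pairing it with \<open>B1\<close> only changes the
  sign of the determinant.\<close>

lemma line_param_avoiding:
  assumes nz: "(a 0, a 1, a 2) \<noteq> (0, 0, 0)" and fin: "finite S"
    and S: "\<And>F. F \<in> S \<Longrightarrow> inS F \<and> (\<exists>e. homog e F) \<and> \<not> lf a dvd F"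
  shows "\<exists>N P0 P1. line_param a N P0 P1 \<and> (\<forall>F\<in>S. meval F P1 \<noteq> 0)"
proof -
  obtain N where N: "lin a N = 1" using lf_normal_exists[OF nz] unfolding lin_def by blast
  obtain B0 B1 where B: "lin a B0 = 0" "lin a B1 = 0" "det3 N B0 B1 \<noteq> 0" "\<forall>n\<ge>3. B0 n = 0" "\<forall>n\<ge>3. B1 n = 0"
    using line_basis_exists[OF N] by blast
  interpret B: line_param a N B0 B1 by unfold_locales (use N B in auto)
  have R0: "B.R F \<noteq> 0" if "F \<in> S" for F
    using S[OF that] B.lf_dvd_of_R_zero by blast
  have "finite (\<Union>F\<in>S. {z. poly (B.R F) z = 0})"
    using fin R0 by (intro finite_UN_I poly_roots_finite) auto
  then obtain z where z: "z \<notin> (\<Union>F\<in>S. {z. poly (B.R F) z = 0})"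
    using ex_new_if_finite[OF infinite_UNIV_char_0] by blast
  define P1 where "P1 n = B0 n + z * B1 n" for n
  have "lin a P1 = lin a B0 + z * lin a B1" by (simp add: lin_def P1_def algebra_simps)
  then have l1: "lin a P1 = 0" using B(1,2) by simp
  have "det3 N B1 P1 = - det3 N B0 B1" by (simp add: det3_def P1_def algebra_simps)
  then have "line_param a N B1 P1" by unfold_locales (use N B l1 in \<open>auto simp: P1_def\<close>)
  moreover have "\<forall>F\<in>S. meval F P1 \<noteq> 0"
  proof
    fix F assume "F \<in> S"
    then have "poly (B.R F) z \<noteq> 0" using z by blast
    then show "meval F P1 \<noteq> 0" unfolding B.poly_R P1_def[abs_def] .
  qed
  ultimately show ?thesis by blast
qed

theorem theorem2p4:
  fixes f l :: mpoly and a b :: nat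
  assumes "reduced_curve f" and "free_curve f a b" and "a \<le> b" and "is_line l"
  shows "(\<forall>f'. f = l * f' \<longrightarrow>
            int (card (cap f' l)) = int b + 1 - eps_curves f' l \<or>
            int (card (cap f' l)) \<le> int a + 1 - eps_curves f' l)
       \<and> ((\<nexists>h. f = l * h) \<longrightarrow>
            int (card (cap f l)) = int a + 1 - eps_curves f l \<or>
            int (card (cap f l)) \<ge> int b + 1 - eps_curves f l)"
proof -
  obtain x y z where xyz: "(x, y, z) \<noteq> (0, 0, 0)" "l = Const x * Var 0 + Const y * Var 1 + Const z * Var 2"
    using assms(4) unfolding is_line_def by blast
  define c where "c n = (if n = 0 then x else if n = 1 then y else z)" for n :: nat
  have c: "c 0 = x" "c 1 = y" "c 2 = z" by (simp_all add: c_def)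
  have l: "l = lf c" unfolding lf_def c xyz(2) ..
  have nz: "(c 0, c 1, c 2) \<noteq> (0, 0, 0)" unfolding c by (rule xyz(1))
  obtain d where f: "inS f" "f \<noteq> 0" "d \<ge> 1" "homog d f"
    and sqf: "\<And>g h. inS g \<Longrightarrow> inS h \<Longrightarrow> f = g * g * h \<Longrightarrow> \<exists>c. g = Const c"
    using assms(1) unfolding reduced_curve_def by blast
  obtain \<theta>1 \<theta>2 where \<theta>: "\<theta>1 \<in> D0 f" "\<theta>2 \<in> D0 f" "homog_deriv a \<theta>1" "homog_deriv b \<theta>2"
    and ex1: "\<forall>\<theta>\<in>D0 f. \<exists>!(h1, h2). inS h1 \<and> inS h2 \<and> \<theta> = dlin h1 \<theta>1 h2 \<theta>2"
    using assms(2) unfolding free_curve_def by blast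
  have gen: "\<exists>h1 h2. inS h1 \<and> inS h2 \<and> \<theta> = dlin h1 \<theta>1 h2 \<theta>2" if "\<theta> \<in> D0 f" for \<theta>
    using ex1[rule_format, OF that] by (auto dest: ex1_implies_ex)
  have part1: "int (card (cap f' l)) = int b + 1 - eps_curves f' l \<or> int (card (cap f' l)) \<le> int a + 1 - eps_curves f' l"
    if f': "f = l * f'" for f'
  proof -
    have comm: "f' * lf c = f" using f' l by (simp add: mult.commute)
    have f'S: "inS f'" using f(1) inS_lf lf_nz[OF nz] unfolding f' l by (rule inS_cancel)
    have f'0: "f' \<noteq> 0" using f(2) f' by auto
    have "homog (1 + (d - 1)) (lf c * f')" using f(3,4) f' l by simp
    then have f'h: "homog (d - 1) f'" using homog_lf lf_nz[OF nz] by (rule homog_cancel)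
    have sqf': "\<exists>c. q = Const c" if "inS q" "inS h" "f' = q * q * h" for q h
    proof (rule sqf[of q "l * h"])
      show "inS (l * h)" unfolding l using inS_lf that(2) by (rule poly_in_mult)
      show "f = q * q * (l * h)" unfolding f' that(3) by (simp add: mult_ac)
    qed fact
    \<comment> \<open>Otherwise the square of the line would divide f, contrary to
      reducedness.\<close>
    have nd: "\<not> lf c dvd f'"
    proof
      assume "lf c dvd f'"
      then obtain h where h: "f' = lf c * h" by (rule dvdE)
      have hS: "inS h" using f'S inS_lf lf_nz[OF nz] unfolding h by (rule inS_cancel)
      have "\<exists>k. lf c = Const k"
        by (rule sqf[OF inS_lf hS]) (simp add: f' l h mult.assoc)
      then obtain k where "lf c = Const k" by blast
      then have "homog 0 (lf c)" by simp
      then have "1 = (0::nat)" using homog_unique[OF homog_lf _ lf_nz[OF nz]] by blast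
      then show False by simp
    qed
    obtain N P0 P1 where P: "line_param c N P0 P1" "meval f' P1 \<noteq> 0"
    proof -
      have "inS F \<and> (\<exists>e. homog e F) \<and> \<not> lf c dvd F" if "F \<in> {f'}" for F
        using that f'S f'h nd by blast
      then have "\<exists>N P0 P1. line_param c N P0 P1 \<and> (\<forall>F\<in>{f'}. meval F P1 \<noteq> 0)"
        by (intro line_param_avoiding[OF nz]) simp_all
      then show thesis using that by (elim exE conjE) simp
    qed
    have "int (card (cap f' (lf c))) + eps_curves f' (lf c) = int b + 1 \<or>
      int (card (cap f' (lf c))) + eps_curves f' (lf c) \<le> int a + 1"
      by (rule line_param.component_count[OF P(1) f'S f'h f'0 sqf' nd P(2), unfolded comm,
            OF _ _ _ \<theta>(1,3,2,4) gen])
    then show ?thesis unfolding l by linarith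
  qed
  have part2: "int (card (cap f l)) = int a + 1 - eps_curves f l \<or> int (card (cap f l)) \<ge> int b + 1 - eps_curves f l"
    if no: "\<nexists>h. f = l * h"
  proof -
    have nd: "\<not> lf c dvd f" using no unfolding l dvd_def by blast
    define u1 where "u1 = act (dcoef \<theta>1) (lf c)"
    define u2 where "u2 = act (dcoef \<theta>2) (lf c)"
    have cS: "inS (dcoef \<theta>1 0)" "inS (dcoef \<theta>1 1)" "inS (dcoef \<theta>1 2)" "inS (dcoef \<theta>2 0)" "inS (dcoef \<theta>2 1)" "inS (dcoef \<theta>2 2)"
      using \<theta>(1,2) unfolding D0_iff by blast+
    have uS: "inS u1" "inS u2" unfolding u1_def u2_def act_lf by (intro poly_in_add poly_in_mult poly_in_Const cS)+
    have uh: "homog a u1" "homog b u2"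
      unfolding u1_def u2_def act_lf using \<theta>(3,4) unfolding homog_deriv_iff by (auto intro!: homog_add homog_Const_mult)
    \<comment> \<open>\<open>u1\<close> or \<open>u2\<close> may vanish identically on the line, and
      then no point at infinity can avoid it; only the remaining forms are imposed.\<close>
    define S where "S = {F \<in> {f, u1, u2}. \<not> lf c dvd F}"
    have "finite S" by (simp add: S_def)
    moreover have "inS F \<and> (\<exists>e. homog e F) \<and> \<not> lf c dvd F" if "F \<in> S" for F
      using that f(1,4) uS uh unfolding S_def by blast
    ultimately have "\<exists>N P0 P1. line_param c N P0 P1 \<and> (\<forall>F\<in>S. meval F P1 \<noteq> 0)"
      by (rule line_param_avoiding[OF nz])
    then obtain N P0 P1 where P: "line_param c N P0 P1" "\<forall>F\<in>S. meval F P1 \<noteq> 0"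
      by (elim exE conjE)
    have fP: "meval f P1 \<noteq> 0" using P(2) nd by (simp add: S_def)
    have uP: "\<not> lf c dvd u1 \<Longrightarrow> meval u1 P1 \<noteq> 0" "\<not> lf c dvd u2 \<Longrightarrow> meval u2 P1 \<noteq> 0"
      using P(2) by (simp_all add: S_def)
    have "int (card (cap f (lf c))) + eps_curves f (lf c) = int a + 1 \<or>
      int (card (cap f (lf c))) + eps_curves f (lf c) \<ge> int b + 1"
    proof (rule line_param.addition_count[OF P(1) f(1,4,2,3) sqf nd fP \<theta>(1,3,2,4) gen])
      show "\<not> lf c dvd act (dcoef \<theta>1) (lf c) \<Longrightarrow> meval (act (dcoef \<theta>1) (lf c)) P1 \<noteq> 0"
        by (rule uP(1)[unfolded u1_def])
      show "\<not> lf c dvd act (dcoef \<theta>2) (lf c) \<Longrightarrow> meval (act (dcoef \<theta>2) (lf c)) P1 \<noteq> 0"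
        by (rule uP(2)[unfolded u2_def])
    qed
    then show ?thesis unfolding l by linarith
  qed
  show ?thesis using part1 part2 by blast
qed

end
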